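(* Let $x_0\in\mathbb{R}$ and $\alpha\in\mathbb{R}$, let $Q_0(t)=\frac14 e^{2t}$, and let $\varepsilon:[x_0,\infty)\to\mathbb{R}$ be a function satisfying $|\varepsilon(t)|\lesssim e^{t}$, i.e. there is a constant $C>0$ with $|\varepsilon(t)|\le Ce^{t}$ for all $t\ge x_0$. Then, as $T\to\infty$, $$N(T;Q_0+\varepsilon,x_0,\alpha)=\frac1\pi\sqrt T\log\sqrt T+\frac1\pi\left(2\log 2-1-x_0\right)\sqrt T+O(1),$$ where the constant in the $O(1)$ depends on $x_0$ and $\varepsilon$. In particular, $$\left|N(T;Q_0,x_0,\alpha)-N(T;Q_0+\varepsilon,x_0,\alpha)\right|= O(1)\quad\text{as }T\to\infty.$$
   Context: For a real-valued, locally integrable potential $V$ on $[x_0,\infty)$, $L_{V,x_0,\alpha}$ denotes the self-adjoint Schrödinger operator $f\mapsto -f''+Vf$ on $L^2([x_0,\infty))$ with boundary condition $\cos(\alpha)f(x_0)+\sin(\alpha)f'(x_0)=0$ at $x_0$ (the limit point case at $\infty$ is considered, so no boundary condition is imposed there). For $T>0$, $N(T;V,x_0,\alpha)$ denotes the number of eigenvalues of $L_{V,x_0,\alpha}$ that are less than $T$. *)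

theory Defs
  imports "HOL-Analysis.Analysis"
begin

definition locally_integrable_from :: "real \<Rightarrow> (real \<Rightarrow> 'a::euclidean_space) \<Rightarrow> bool" where
  "locally_integrable_from x0 f \<longleftrightarrow> (\<forall>b. f absolutely_integrable_on {x0..b})"

definition square_integrable_from :: "real \<Rightarrow> (real \<Rightarrow> complex) \<Rightarrow> bool" where
  "square_integrable_from x0 f \<longleftrightarrow>
     f \<in> borel_measurable (lebesgue_on {x0..}) \<and>
     integrable (lebesgue_on {x0..}) (\<lambda>t. (norm (f t))\<^sup>2)"

(* f is locally absolutely continuous on [x0,oo), with almost-everywhere derivative g;
   both are expressed through the fundamental theorem of calculus for Lebesgue integrals. *)
definition locally_AC_with_deriv ::
    "real \<Rightarrow> (real \<Rightarrow> complex) \<Rightarrow> (real \<Rightarrow> complex) \<Rightarrow> bool" where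
  "locally_AC_with_deriv x0 f g \<longleftrightarrow>
     locally_integrable_from x0 g \<and> (\<forall>t\<ge>x0. f t = f x0 + integral {x0..t} g)"

(* The graph of the operator L f = -f'' + V f on L^2([x0,oo)) with the boundary condition
   cos alpha * f(x0) + sin alpha * f'(x0) = 0, on its maximal domain: f in L^2 such that f, f' are
   locally absolutely continuous, f satisfies the boundary condition and L f is in L^2.  No condition
   is imposed at infinity, so this is the self-adjoint operator exactly in the limit point case.
   Elements of L^2([x0,oo)) are represented by functions on the reals whose values to the left of
   x0 play no role; f itself is the continuous representative of its class.  The derivative f' (f1)
   is one-sided at x0, and f'' (f2) is determined almost everywhere. *)
definition schrodinger_graph ::
    "(real \<Rightarrow> real) \<Rightarrow> real \<Rightarrow> real \<Rightarrow> ((real \<Rightarrow> complex) \<times> (real \<Rightarrow> complex)) set" where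
  "schrodinger_graph V x0 \<alpha> = {(f, g).
     square_integrable_from x0 f \<and> square_integrable_from x0 g \<and>
     (\<exists>f1 f2.
        (\<forall>t\<ge>x0. (f has_vector_derivative f1 t) (at t within {x0..})) \<and>
        locally_AC_with_deriv x0 f1 f2 \<and>
        complex_of_real (cos \<alpha>) * f x0 + complex_of_real (sin \<alpha>) * f1 x0 = 0 \<and>
        (AE t in lebesgue_on {x0..}. g t = - f2 t + complex_of_real (V t) * f t))}"

definition schrodinger_eigenvalue ::
    "(real \<Rightarrow> real) \<Rightarrow> real \<Rightarrow> real \<Rightarrow> complex \<Rightarrow> bool" where
  "schrodinger_eigenvalue V x0 \<alpha> z \<longleftrightarrow>
     (\<exists>f. (f, \<lambda>t. z * f t) \<in> schrodinger_graph V x0 \<alpha> \<and>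
          \<not> (AE t in lebesgue_on {x0..}. f t = 0))"

definition eigenvalues_below ::
    "real \<Rightarrow> (real \<Rightarrow> real) \<Rightarrow> real \<Rightarrow> real \<Rightarrow> real set" where
  "eigenvalues_below T V x0 \<alpha> =
     {l. l < T \<and> schrodinger_eigenvalue V x0 \<alpha> (complex_of_real l)}"

(* Every eigenvalue is simple: the boundary condition fixes a solution up to a scalar factor.
   Hence counting the set agrees with counting multiplicities.  Beware that card is 0 on
   infinite sets, so statements about the counting function should also assert finiteness. *)
definition eigenvalue_count :: "real \<Rightarrow> (real \<Rightarrow> real) \<Rightarrow> real \<Rightarrow> real \<Rightarrow> nat" where
  "eigenvalue_count T V x0 \<alpha> = card (eigenvalues_below T V x0 \<alpha>)"

definition Q0 :: "real \<Rightarrow> real" where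
  "Q0 t = exp (2 * t) / 4"

end

theory Submission
  imports Defs "HOL-Real_Asymp.Real_Asymp"
begin

text \<open>
  Write a solution of \<open>- f'' + V f = T f\<close> as \<open>f = r cos \<theta>\<close>, \<open>f' = r sin \<theta>\<close>; then
  \<open>\<theta>' = (V - T) cos\<^sup>2 \<theta> - sin\<^sup>2 \<theta>\<close>.  Among the angles there is one that stays in
  \<open>[-\<pi>/2, 0]\<close> near infinity; it belongs to the square-integrable solution.  Its value at \<open>x0\<close> is
  continuous and strictly increasing in \<open>T\<close>, and \<open>T\<close> is an eigenvalue iff this value lies in
  \<open>\<alpha> + \<pi>/2 + \<pi>\<int>\<close>.  So the counting function is the angle divided by \<open>\<pi>\<close>, up to a bounded error
  that is uniform in \<open>\<alpha>\<close>.

  To estimate the angle, put \<open>P = sqrt (T - Q0)\<close>.  In the frame \<open>tan \<phi> = (f'/f + P'/(2P)) / P\<close> it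
  satisfies \<open>\<phi>' = - P + O((e\<^sup>t + T Q0 / P\<^sup>4) / P)\<close>, and the error has a bounded integral up to the
  point where \<open>P\<^sup>3 = T\<close>.  The remaining window around the turning point has width
  \<open>O(T powr (-1/3))\<close> and there \<open>|V - T| = O(T powr (2/3))\<close>, so the angle changes by \<open>O(1)\<close>; beyond it
  \<open>V \<ge> T\<close>.  The integral of \<open>P\<close> is elementary.
\<close>

subsection \<open>Functions with a bounded integrable derivative\<close>

text \<open>The perturbation is only measurable, so the angle is differentiable almost everywhere at
  best. It is locally bounded, however, so every function that occurs is Lipschitz:
  \<open>primitive_on\<close> records this by increments and a pointwise bound, and all comparisons
  are Gronwall arguments for such functions. An O(1) error forces the choice of frames. Near the
  turning point the rate of \<open>\<theta>\<close> is only bounded by a multiple of T powr (2/3),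
  too much for a width of T powr (-1/3); dividing the slope by T powr (1/3) brings both terms of the
  rate down to T powr (1/3). Before that, the shift P'/(2P) is the one that cancels the mixed term
  sin * cos, whose coefficient P'/P has an integral of order ln T. The perturbation then costs at
  most the integral of C * exp t / P, an arcsine and so bounded in T, and the cut-off P^3 = T is
  where the other error integral, a multiple of T / P^3, reaches order 1. Each change of frame moves
  the angle by less than pi, so only boundedly much is lost by switching frames.\<close>

definition primitive_on :: "real \<Rightarrow> real \<Rightarrow> (real \<Rightarrow> real) \<Rightarrow> (real \<Rightarrow> real) \<Rightarrow> bool" where
  "primitive_on a b f F \<longleftrightarrow>
     (\<forall>s t. a \<le> s \<longrightarrow> s \<le> t \<longrightarrow> t \<le> b \<longrightarrow> (f has_integral F t - F s) {s..t}) \<and>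
     (\<exists>M. \<forall>t\<in>{a..b}. \<bar>f t\<bar> \<le> M)"

lemma primitive_on_has_integral:
  "primitive_on a b f F \<Longrightarrow> a \<le> s \<Longrightarrow> s \<le> t \<Longrightarrow> t \<le> b \<Longrightarrow> (f has_integral F t - F s) {s..t}"
  by (auto simp: primitive_on_def)

lemma primitive_on_bound:
  assumes "primitive_on a b f F"
  obtains M where "M \<ge> 0" "\<And>t. t \<in> {a..b} \<Longrightarrow> \<bar>f t\<bar> \<le> M"
proof -
  obtain M where "\<forall>t\<in>{a..b}. \<bar>f t\<bar> \<le> M"
    using assms by (auto simp: primitive_on_def)
  then show ?thesis
    by (intro that[of "max M 0"]) fastforce+
qed

lemma primitive_on_integrable: "primitive_on a b f F \<Longrightarrow> f integrable_on {a..b}"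
  by (cases "a \<le> b") (use primitive_on_has_integral[of a b f F a b] in \<open>auto simp: integrable_on_def\<close>)

lemma primitive_on_subinterval:
  "primitive_on a b f F \<Longrightarrow> a \<le> a' \<Longrightarrow> b' \<le> b \<Longrightarrow> primitive_on a' b' f F"
  unfolding primitive_on_def by (meson atLeastAtMost_iff order_trans)

lemma primitive_on_cong:
  assumes "primitive_on a b f F" "\<And>t. t \<in> {a..b} \<Longrightarrow> f t = g t" "\<And>t. t \<in> {a..b} \<Longrightarrow> F t = G t"
  shows "primitive_on a b g G"
proof -
  have "(g has_integral G t - G s) {s..t}" if "a \<le> s" "s \<le> t" "t \<le> b" for s t
  proof -
    have "(f has_integral G t - G s) {s..t}"
      using primitive_on_has_integral[OF assms(1) that] assms(3) that by simp
    then show ?thesis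
      by (rule has_integral_eq[rotated]) (use that assms(2) in auto)
  qed
  moreover have "\<exists>M. \<forall>t\<in>{a..b}. \<bar>g t\<bar> \<le> M"
    using assms(1,2) by (metis primitive_on_def)
  ultimately show ?thesis by (simp add: primitive_on_def)
qed

lemma primitive_onI_integral:
  assumes f: "f integrable_on {a..b}" and "\<And>t. t \<in> {a..b} \<Longrightarrow> \<bar>f t\<bar> \<le> M"
    and F: "\<And>t. t \<in> {a..b} \<Longrightarrow> F t = c + integral {a..t} f"
  shows "primitive_on a b f F"
proof -
  have "(f has_integral F t - F s) {s..t}" if "a \<le> s" "s \<le> t" "t \<le> b" for s t
  proof -
    have "f integrable_on {a..t}" "f integrable_on {s..t}"
      using that by (auto intro: integrable_on_subinterval[OF f])
    moreover have "integral {a..s} f + integral {s..t} f = integral {a..t} f"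
      using that calculation(1) by (intro Henstock_Kurzweil_Integration.integral_combine) auto
    ultimately show ?thesis
      using F[of s] F[of t] that by (simp add: has_integral_iff)
  qed
  then show ?thesis using assms(2) unfolding primitive_on_def by blast
qed

lemma primitive_on_lipschitz:
  assumes "primitive_on a b f F"
  obtains M where "M \<ge> 0" "\<And>t. t \<in> {a..b} \<Longrightarrow> \<bar>f t\<bar> \<le> M"
    "\<And>s t. s \<in> {a..b} \<Longrightarrow> t \<in> {a..b} \<Longrightarrow> \<bar>F t - F s\<bar> \<le> M * \<bar>t - s\<bar>"
proof -
  obtain M where M: "M \<ge> 0" "\<And>t. t \<in> {a..b} \<Longrightarrow> \<bar>f t\<bar> \<le> M"
    using primitive_on_bound[OF assms] by blast
  have *: "\<bar>F t - F s\<bar> \<le> M * (t - s)" if "a \<le> s" "s \<le> t" "t \<le> b" for s t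
    using has_integral_bound_real[OF M(1) finite.emptyI primitive_on_has_integral[OF assms that]] M(2) that
    by (auto simp: mult.commute)
  have "\<bar>F t - F s\<bar> \<le> M * \<bar>t - s\<bar>" if "s \<in> {a..b}" "t \<in> {a..b}" for s t
    using *[of s t] *[of t s] that by (cases "s \<le> t") (auto simp: abs_minus_commute)
  then show ?thesis using M that by blast
qed

lemma primitive_on_continuous:
  assumes "primitive_on a b f F" shows "continuous_on {a..b} F"
proof -
  obtain M where M: "M \<ge> 0" "\<And>s t. s \<in> {a..b} \<Longrightarrow> t \<in> {a..b} \<Longrightarrow> \<bar>F t - F s\<bar> \<le> M * \<bar>t - s\<bar>"
    using primitive_on_lipschitz[OF assms] by metis
  then have "M-lipschitz_on {a..b} F"
    by (auto simp: lipschitz_on_def dist_real_def)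
  then show ?thesis by (rule lipschitz_on_continuous_on)
qed

lemma continuous_on_interval_bound:
  fixes f :: "real \<Rightarrow> real"
  assumes "continuous_on {a..b} f"
  obtains M where "M \<ge> 0" "\<And>t. t \<in> {a..b} \<Longrightarrow> \<bar>f t\<bar> \<le> M"
proof -
  have "bounded (f ` {a..b})"
    using assms compact_continuous_image compact_imp_bounded by blast
  then obtain M where "\<forall>t\<in>{a..b}. \<bar>f t\<bar> \<le> M" by (auto simp: bounded_iff)
  then show ?thesis
    by (intro that[of "max M 0"]) fastforce+
qed

lemma primitive_on_C1:
  assumes "\<And>t. t \<in> {a..b} \<Longrightarrow> (F has_real_derivative f t) (at t within {a..b})"
    and "continuous_on {a..b} f"
  shows "primitive_on a b f F"
proof -
  have "(f has_integral F t - F s) {s..t}" if "a \<le> s" "s \<le> t" "t \<le> b" for s t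
  proof (rule fundamental_theorem_of_calculus[OF that(2)])
    fix x assume "x \<in> {s..t}"
    then have "(F has_vector_derivative f x) (at x within {a..b})"
      using that assms(1)[of x] by (simp add: has_real_derivative_iff_has_vector_derivative)
    then show "(F has_vector_derivative f x) (at x within {s..t})"
      by (rule has_vector_derivative_within_subset) (use that in auto)
  qed
  then show ?thesis
    using continuous_on_interval_bound[OF assms(2)] by (metis primitive_on_def)
qed

lemma primitive_on_add:
  assumes "primitive_on a b f F" "primitive_on a b g G"
  shows "primitive_on a b (\<lambda>t. f t + g t) (\<lambda>t. F t + G t)"
proof -
  obtain M N where "\<And>t. t \<in> {a..b} \<Longrightarrow> \<bar>f t\<bar> \<le> M" "\<And>t. t \<in> {a..b} \<Longrightarrow> \<bar>g t\<bar> \<le> N"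
    using assms primitive_on_bound by metis
  then have "\<bar>f t + g t\<bar> \<le> M + N" if "t \<in> {a..b}" for t
    by (metis abs_triangle_ineq add_mono order_trans that)
  moreover have "((\<lambda>t. f t + g t) has_integral (F t + G t) - (F s + G s)) {s..t}"
    if "a \<le> s" "s \<le> t" "t \<le> b" for s t
    using has_integral_add[OF assms[THEN primitive_on_has_integral, OF that]]
    by (simp add: algebra_simps)
  ultimately show ?thesis unfolding primitive_on_def by blast
qed

lemma primitive_on_cmult:
  assumes "primitive_on a b f F"
  shows "primitive_on a b (\<lambda>t. c * f t) (\<lambda>t. c * F t)"
proof -
  obtain M where "\<And>t. t \<in> {a..b} \<Longrightarrow> \<bar>f t\<bar> \<le> M"
    using assms primitive_on_bound by metis
  then have "\<bar>c * f t\<bar> \<le> \<bar>c\<bar> * M" if "t \<in> {a..b}" for t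
    using that by (simp only: abs_mult) (intro mult_left_mono, auto)
  moreover have "((\<lambda>t. c * f t) has_integral c * F t - c * F s) {s..t}"
    if "a \<le> s" "s \<le> t" "t \<le> b" for s t
    using has_integral_mult_right[OF primitive_on_has_integral[OF assms that], of c]
    by (simp add: algebra_simps)
  ultimately show ?thesis unfolding primitive_on_def by blast
qed

lemma primitive_on_minus:
  "primitive_on a b f F \<Longrightarrow> primitive_on a b (\<lambda>t. - f t) (\<lambda>t. - F t)"
  using primitive_on_cmult[of a b f F "-1"] by simp

lemma primitive_on_diff:
  "primitive_on a b f F \<Longrightarrow> primitive_on a b g G \<Longrightarrow> primitive_on a b (\<lambda>t. f t - g t) (\<lambda>t. F t - G t)"
  using primitive_on_add[of a b f F "\<lambda>t. - g t" "\<lambda>t. - G t"] primitive_on_minus[of a b g G] by simp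

lemma primitive_on_const: "primitive_on a b (\<lambda>t. 0) (\<lambda>t. c)"
  by (auto simp: primitive_on_def)

lemma primitive_on_mono:
  assumes "primitive_on a b f F" "\<And>t. t \<in> {a..b} \<Longrightarrow> f t \<ge> 0" "a \<le> s" "s \<le> t" "t \<le> b"
  shows "F s \<le> F t"
  using has_integral_nonneg[OF primitive_on_has_integral[OF assms(1,3,4,5)]] assms by auto

lemma primitive_on_mono_diff:
  assumes "primitive_on a b f F" "primitive_on a b g G" "\<And>t. t \<in> {a..b} \<Longrightarrow> f t \<le> g t"
    "a \<le> s" "s \<le> t" "t \<le> b"
  shows "F t - F s \<le> G t - G s"
  using primitive_on_mono[OF primitive_on_diff[OF assms(2,1)], of s t] assms(3-) by auto

text \<open>This replaces almost-everywhere differentiation: the defect in a chain rule for functions with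
  bounded derivative has quadratically small increments.\<close>

lemma constant_of_quadratic_increments:
  fixes H :: "real \<Rightarrow> real"
  assumes "\<And>s t. a \<le> s \<Longrightarrow> s \<le> t \<Longrightarrow> t \<le> b \<Longrightarrow> \<bar>H t - H s\<bar> \<le> K * (t - s)\<^sup>2"
    and "s \<in> {a..b}" "t \<in> {a..b}"
  shows "H s = H t"
proof -
  have *: "\<bar>H t - H s\<bar> \<le> \<bar>K\<bar> * (t - s)\<^sup>2" if "s \<in> {a..b}" "t \<in> {a..b}" for s t
  proof -
    have "\<bar>H t - H s\<bar> \<le> K * (t - s)\<^sup>2"
      using assms(1)[of s t] assms(1)[of t s] that
      by (cases "s \<le> t") (auto simp: abs_minus_commute power2_commute)
    also have "\<dots> \<le> \<bar>K\<bar> * (t - s)\<^sup>2" by (intro mult_right_mono) auto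
    finally show ?thesis .
  qed
  have "(H has_field_derivative 0) (at x within {a..b})" if x: "x \<in> {a..b}" for x
    unfolding has_field_derivative_iff
  proof (rule Lim_null_comparison)
    show "\<forall>\<^sub>F y in at x within {a..b}. norm ((H y - H x) / (y - x)) \<le> \<bar>K\<bar> * \<bar>y - x\<bar>"
      unfolding eventually_at
    proof (intro exI[of _ 1] conjI ballI impI)
      fix y assume y: "y \<in> {a..b}" "y \<noteq> x \<and> dist y x < 1"
      have "\<bar>H y - H x\<bar> \<le> \<bar>K\<bar> * \<bar>y - x\<bar> * \<bar>y - x\<bar>"
        using *[OF x y(1)] by (simp add: power2_eq_square abs_mult_self_eq mult.assoc)
      then show "norm ((H y - H x) / (y - x)) \<le> \<bar>K\<bar> * \<bar>y - x\<bar>"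
        using y by (simp add: abs_divide divide_le_eq)
    qed simp
    show "((\<lambda>y. \<bar>K\<bar> * \<bar>y - x\<bar>) \<longlongrightarrow> 0) (at x within {a..b})"
      by (auto intro!: tendsto_eq_intros)
  qed
  then show ?thesis
    using has_field_derivative_zero_constant[of "{a..b}" H] assms(2,3) by auto
qed

text \<open>Gauge integrability alone does not survive multiplication by a continuous function; the
  bound on \<open>f\<close> makes it absolutely integrable, and then it does.\<close>

lemma integrable_continuous_mult_bounded:
  fixes f g :: "real \<Rightarrow> real"
  assumes "continuous_on {a..b} g" "f integrable_on {a..b}" "\<And>t. t \<in> {a..b} \<Longrightarrow> \<bar>f t\<bar> \<le> M"
  shows "(\<lambda>t. g t * f t) integrable_on {a..b}"
proof -
  have "f absolutely_integrable_on {a..b}"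
    by (rule absolutely_integrable_integrable_bound[where g="\<lambda>_. M"]) (use assms in auto)
  moreover have "g \<in> borel_measurable (lebesgue_on {a..b})"
    using assms(1) by (simp add: continuous_imp_measurable_on_sets_lebesgue)
  moreover have "bounded (g ` {a..b})"
    using assms(1) compact_continuous_image compact_imp_bounded by blast
  ultimately have "(\<lambda>t. g t * f t) absolutely_integrable_on {a..b}"
    by (intro absolutely_integrable_bounded_measurable_product_real) auto
  then show ?thesis by (rule set_lebesgue_integral_eq_integral(1))
qed

text \<open>On \<open>{s..t}\<close> the increment of \<open>\<phi> (F t)\<close> (mean value
  theorem) and the integral of \<open>\<phi>' (F t) * f t\<close> (Lipschitz bounds for
  \<open>\<phi>'\<close> and \<open>F\<close>) both equal \<open>\<phi>' (F s) * (F t - F s)\<close>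
  up to a multiple of \<open>(t - s)\<^sup>2\<close>. So their difference has quadratic increments
  and is constant.\<close>

lemma primitive_on_chain:
  assumes P: "primitive_on a b f F"
    and \<phi>: "\<And>x. (\<phi> has_real_derivative \<phi>' x) (at x)"
    and lip: "\<And>R. \<exists>L. \<forall>x\<in>{-R..R}. \<forall>y\<in>{-R..R}. \<bar>\<phi>' x - \<phi>' y\<bar> \<le> L * \<bar>x - y\<bar>"
  shows "primitive_on a b (\<lambda>t. \<phi>' (F t) * f t) (\<lambda>t. \<phi> (F t))"
proof (cases "a \<le> b")
  case False
  then show ?thesis by (auto simp: primitive_on_def)
next
  case True
  obtain M where M: "M \<ge> 0" "\<And>t. t \<in> {a..b} \<Longrightarrow> \<bar>f t\<bar> \<le> M"
    "\<And>s t. s \<in> {a..b} \<Longrightarrow> t \<in> {a..b} \<Longrightarrow> \<bar>F t - F s\<bar> \<le> M * \<bar>t - s\<bar>"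
    using primitive_on_lipschitz[OF P] by metis
  have cF: "continuous_on {a..b} F" using primitive_on_continuous[OF P] .
  obtain R where R: "R \<ge> 0" "\<And>t. t \<in> {a..b} \<Longrightarrow> \<bar>F t\<bar> \<le> R"
    using continuous_on_interval_bound[OF cF] by metis
  obtain L0 where L0: "\<forall>x\<in>{-R..R}. \<forall>y\<in>{-R..R}. \<bar>\<phi>' x - \<phi>' y\<bar> \<le> L0 * \<bar>x - y\<bar>"
    using lip by blast
  define L where "L = \<bar>L0\<bar>"
  have L: "\<bar>\<phi>' x - \<phi>' y\<bar> \<le> L * \<bar>x - y\<bar>" if "x \<in> {-R..R}" "y \<in> {-R..R}" for x y
  proof -
    have "L0 * \<bar>x - y\<bar> \<le> L * \<bar>x - y\<bar>" by (intro mult_right_mono) (auto simp: L_def)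
    then show ?thesis using L0 that by force
  qed
  have cphi': "continuous_on UNIV \<phi>'"
  proof (rule continuous_at_imp_continuous_on, rule ballI)
    fix x :: real
    obtain K where K: "\<forall>u\<in>{-(\<bar>x\<bar>+1)..\<bar>x\<bar>+1}. \<forall>y\<in>{-(\<bar>x\<bar>+1)..\<bar>x\<bar>+1}. \<bar>\<phi>' u - \<phi>' y\<bar> \<le> K * \<bar>u - y\<bar>"
      using lip by blast
    have "\<bar>K\<bar>-lipschitz_on {-(\<bar>x\<bar>+1)..\<bar>x\<bar>+1} \<phi>'"
      unfolding lipschitz_on_def dist_real_def
    proof (intro conjI ballI)
      fix u y assume uy: "u \<in> {-(\<bar>x\<bar>+1)..\<bar>x\<bar>+1}" "y \<in> {-(\<bar>x\<bar>+1)..\<bar>x\<bar>+1}"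
      have "K * \<bar>u - y\<bar> \<le> \<bar>K\<bar> * \<bar>u - y\<bar>" by (intro mult_right_mono) auto
      then show "\<bar>\<phi>' u - \<phi>' y\<bar> \<le> \<bar>K\<bar> * \<bar>u - y\<bar>" using K uy by force
    qed simp
    then have "continuous_on {-(\<bar>x\<bar>+1)..\<bar>x\<bar>+1} \<phi>'" by (rule lipschitz_on_continuous_on)
    moreover have "x \<in> interior {-(\<bar>x\<bar>+1)..\<bar>x\<bar>+1}" by (auto simp: interior_atLeastAtMost_real)
    ultimately show "isCont \<phi>' x" by (rule continuous_on_interior)
  qed
  have cphF: "continuous_on {a..b} (\<lambda>t. \<phi>' (F t))"
    by (rule continuous_on_compose2[OF cphi' cF]) auto
  define h where "h = (\<lambda>t. \<phi>' (F t) * f t)"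
  have h: "h integrable_on {a..b}"
    unfolding h_def
    by (rule integrable_continuous_mult_bounded[OF cphF primitive_on_integrable[OF P] M(2)])
  obtain N where N: "N \<ge> 0" "\<And>t. t \<in> {a..b} \<Longrightarrow> \<bar>\<phi>' (F t)\<bar> \<le> N"
    using continuous_on_interval_bound[OF cphF] by metis
  have hb: "\<bar>h t\<bar> \<le> N * M" if "t \<in> {a..b}" for t
    unfolding h_def abs_mult using N M(1,2) that by (intro mult_mono) auto
  define H where "H = (\<lambda>t. \<phi> (F t) - integral {a..t} h)"
  have quad: "\<bar>H t - H s\<bar> \<le> (2 * (L * M * M)) * (t - s)\<^sup>2" if st: "a \<le> s" "s \<le> t" "t \<le> b" for s t
  proof -
    have hst: "h integrable_on {s..t}" "h integrable_on {a..t}"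
      using st by (auto intro: integrable_on_subinterval[OF h])
    have fst: "(f has_integral F t - F s) {s..t}" using primitive_on_has_integral[OF P st] .
    have "integral {a..s} h + integral {s..t} h = integral {a..t} h"
      using st hst by (intro Henstock_Kurzweil_Integration.integral_combine) auto
    then have "H t - H s = \<phi> (F t) - \<phi> (F s) - integral {s..t} h" by (simp add: H_def)
    also have "\<dots> = (\<phi> (F t) - \<phi> (F s) - \<phi>' (F s) * (F t - F s))
        - (integral {s..t} h - \<phi>' (F s) * (F t - F s))" by simp
    finally have eq: "H t - H s = (\<phi> (F t) - \<phi> (F s) - \<phi>' (F s) * (F t - F s))
        - (integral {s..t} h - \<phi>' (F s) * (F t - F s))" .
    have FR: "F s \<in> {-R..R}" "F t \<in> {-R..R}" using R(2)[of s] R(2)[of t] st by auto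
    have L0': "L \<ge> 0" by (simp add: L_def)
    have F1: "\<bar>F t - F s\<bar> \<le> M * (t - s)" using M(3)[of s t] st by auto
    have mvt: "\<exists>z\<in>{-R..R}. \<phi> y - \<phi> x = \<phi>' z * (y - x) \<and> \<bar>z - x\<bar> \<le> \<bar>y - x\<bar>"
      if "x \<in> {-R..R}" "y \<in> {-R..R}" for x y
    proof (cases x y rule: linorder_cases)
      case less
      then obtain z where "x < z" "z < y" "\<phi> y - \<phi> x = (y - x) * \<phi>' z"
        using MVT2[OF less, of \<phi> \<phi>'] \<phi> by blast
      then show ?thesis using that by (intro bexI[of _ z]) (auto simp: algebra_simps)
    next
      case equal then show ?thesis using that by auto
    next
      case greater
      then obtain z where "y < z" "z < x" "\<phi> x - \<phi> y = (x - y) * \<phi>' z"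
        using MVT2[OF greater, of \<phi> \<phi>'] \<phi> by blast
      then show ?thesis using that by (intro bexI[of _ z]) (auto simp: algebra_simps)
    qed
    obtain z where z: "z \<in> {-R..R}" "\<phi> (F t) - \<phi> (F s) = \<phi>' z * (F t - F s)"
      "\<bar>z - F s\<bar> \<le> \<bar>F t - F s\<bar>"
      using mvt[OF FR] by blast
    have "\<bar>\<phi> (F t) - \<phi> (F s) - \<phi>' (F s) * (F t - F s)\<bar> = \<bar>\<phi>' z - \<phi>' (F s)\<bar> * \<bar>F t - F s\<bar>"
      unfolding z(2) by (simp only: abs_mult[symmetric] left_diff_distrib)
    also have "\<dots> \<le> (L * \<bar>F t - F s\<bar>) * \<bar>F t - F s\<bar>"
      using order_trans[OF L[OF z(1) FR(1)] mult_left_mono[OF z(3) L0']]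
      by (intro mult_right_mono) auto
    also have "\<dots> \<le> (L * (M * (t - s))) * (M * (t - s))"
      using F1 L0' M(1) st by (intro mult_mono) auto
    finally have b1: "\<bar>\<phi> (F t) - \<phi> (F s) - \<phi>' (F s) * (F t - F s)\<bar> \<le> (L * M * M) * (t - s)\<^sup>2"
      by (simp add: power2_eq_square mult_ac)
    have hi: "((\<lambda>r. h r - \<phi>' (F s) * f r) has_integral integral {s..t} h - \<phi>' (F s) * (F t - F s)) {s..t}"
      by (intro has_integral_diff has_integral_mult_right fst integrable_integral hst)
    have bd: "norm (h r - \<phi>' (F s) * f r) \<le> L * M * M * (t - s)" if r: "r \<in> {s..t}" for r
    proof -
      have "\<bar>h r - \<phi>' (F s) * f r\<bar> = \<bar>\<phi>' (F r) - \<phi>' (F s)\<bar> * \<bar>f r\<bar>"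
        by (simp only: h_def abs_mult[symmetric] left_diff_distrib)
      also have "\<dots> \<le> (L * \<bar>F r - F s\<bar>) * M"
        using L[of "F r" "F s"] R(2)[of r] R(2)[of s] M(2)[of r] r st L0'
        by (intro mult_mono) (auto simp: abs_le_iff)
      also have "\<dots> \<le> (L * (M * (t - s))) * M"
      proof (intro mult_right_mono mult_left_mono)
        have "M * \<bar>r - s\<bar> \<le> M * (t - s)" using r M(1) by (intro mult_left_mono) auto
        then show "\<bar>F r - F s\<bar> \<le> M * (t - s)" using M(3)[of s r] r st by auto
      qed (use L0' M(1) in auto)
      finally show ?thesis by (simp add: mult_ac)
    qed
    have "0 \<le> L * M * M * (t - s)" using L0' M(1) st by simp
    then have "norm (integral {s..t} h - \<phi>' (F s) * (F t - F s)) \<le> L * M * M * (t - s) * measure lborel {s..t}"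
      by (rule has_integral_bound_real[OF _ finite.emptyI hi]) (use bd in auto)
    then have "\<bar>integral {s..t} h - \<phi>' (F s) * (F t - F s)\<bar> \<le> L * M * M * (t - s) * (t - s)"
      using st by simp
    then have "\<bar>integral {s..t} h - \<phi>' (F s) * (F t - F s)\<bar> \<le> (L * M * M) * (t - s)\<^sup>2"
      by (simp only: power2_eq_square mult.assoc)
    then show ?thesis unfolding eq using b1 by linarith
  qed
  have "H a = H t" if "t \<in> {a..b}" for t
    by (rule constant_of_quadratic_increments[OF quad]) (use that in auto)
  then have "\<phi> (F t) = H a + integral {a..t} h" if "t \<in> {a..b}" for t
    using that by (fastforce simp: H_def)
  then show ?thesis
    using primitive_onI_integral[OF h hb, of "\<lambda>t. \<phi> (F t)" "H a"] by (simp add: h_def)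
qed

lemma primitive_on_sin:
  "primitive_on a b f F \<Longrightarrow> primitive_on a b (\<lambda>t. cos (F t) * f t) (\<lambda>t. sin (F t))"
proof (erule primitive_on_chain[where \<phi>=sin and \<phi>'=cos])
  show "\<exists>L. \<forall>x\<in>{-R..R}. \<forall>y\<in>{-R..R}. \<bar>cos x - cos y\<bar> \<le> L * \<bar>x - y\<bar>" for R :: real
  proof (intro exI ballI)
    fix x y :: real
    have "\<bar>cos x - cos y\<bar> = 2 * \<bar>sin ((x + y) / 2)\<bar> * \<bar>sin ((y - x) / 2)\<bar>"
      by (simp add: cos_diff_cos abs_mult)
    also have "\<dots> \<le> 2 * 1 * \<bar>(y - x) / 2\<bar>"
      by (intro mult_mono abs_sin_x_le_abs_x) auto
    finally show "\<bar>cos x - cos y\<bar> \<le> 1 * \<bar>x - y\<bar>" by (simp add: abs_minus_commute)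
  qed
qed (auto intro!: derivative_eq_intros)

lemma primitive_on_shift: "primitive_on a b f F \<Longrightarrow> primitive_on a b f (\<lambda>t. F t + c)"
  using primitive_on_add[OF _ primitive_on_const, of a b f F c] by simp

lemma primitive_on_cos:
  assumes "primitive_on a b f F"
  shows "primitive_on a b (\<lambda>t. - sin (F t) * f t) (\<lambda>t. cos (F t))"
  using primitive_on_sin[OF primitive_on_shift[OF assms, of "pi/2"]]
  by (simp add: cos_add sin_add)

lemma primitive_on_square:
  "primitive_on a b f F \<Longrightarrow> primitive_on a b (\<lambda>t. 2 * F t * f t) (\<lambda>t. (F t)\<^sup>2)"
proof (erule primitive_on_chain[where \<phi>="\<lambda>x. x\<^sup>2" and \<phi>'="\<lambda>x. 2 * x"])
  show "\<exists>L. \<forall>x\<in>{-R..R}. \<forall>y\<in>{-R..R}. \<bar>2 * x - 2 * y\<bar> \<le> L * \<bar>x - y\<bar>" for R :: real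
    by (intro exI[of _ 2]) (auto simp: abs_if)
qed (auto intro!: derivative_eq_intros)

text \<open>By polarization, \<open>4 * F * G = (F + G)\<^sup>2 - (F - G)\<^sup>2\<close>, so the
  chain rule in one variable suffices.\<close>

lemma primitive_on_mult:
  assumes "primitive_on a b f F" "primitive_on a b g G"
  shows "primitive_on a b (\<lambda>t. f t * G t + F t * g t) (\<lambda>t. F t * G t)"
proof -
  have "primitive_on a b (\<lambda>t. (1/4) * (2 * (F t + G t) * (f t + g t) - 2 * (F t - G t) * (f t - g t)))
      (\<lambda>t. (1/4) * ((F t + G t)\<^sup>2 - (F t - G t)\<^sup>2))"
    by (intro primitive_on_cmult primitive_on_diff primitive_on_square primitive_on_add assms)
  then show ?thesis
    by (rule primitive_on_cong) (auto simp: power2_eq_square algebra_simps)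
qed

lemma primitive_on_exp:
  assumes "primitive_on a b f F"
  shows "primitive_on a b (\<lambda>t. exp (F t) * f t) (\<lambda>t. exp (F t))"
proof (rule primitive_on_chain[OF assms, where \<phi>=exp and \<phi>'=exp])
  show "\<exists>L. \<forall>x\<in>{-R..R}. \<forall>y\<in>{-R..R}. \<bar>exp x - exp y\<bar> \<le> L * \<bar>x - y\<bar>" for R :: real
  proof (intro exI[of _ "exp R"] ballI)
    have *: "exp y - exp x \<le> exp R * (y - x)" if xy: "x < y" "y \<in> {-R..R}" for x y :: real
    proof -
      obtain z where "x < z" "z < y" "exp y - exp x = (y - x) * exp z"
        using MVT2[OF xy(1), of exp exp] by (auto intro: DERIV_exp)
      then show ?thesis using xy by (simp add: mult.commute mult_left_mono)
    qed
    fix x y :: real assume "x \<in> {-R..R}" "y \<in> {-R..R}"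
    then show "\<bar>exp x - exp y\<bar> \<le> exp R * \<bar>x - y\<bar>"
      using *[of x y] *[of y x] by (cases x y rule: linorder_cases) auto
  qed
qed (auto intro!: derivative_eq_intros)

text \<open>The negative part has a corner at 0, but its square has a Lipschitz derivative, as the
  chain rule demands. It serves to turn Gronwall estimates into one-sided comparisons.\<close>

lemma primitive_on_neg_part_square:
  assumes "primitive_on a b f F"
  shows "primitive_on a b (\<lambda>t. 2 * min (F t) 0 * f t) (\<lambda>t. (min (F t) 0)\<^sup>2)"
proof (rule primitive_on_chain[OF assms, where \<phi>="\<lambda>x. (min x 0)\<^sup>2" and \<phi>'="\<lambda>x. 2 * min x 0"])
  show "\<exists>L. \<forall>x\<in>{-R..R}. \<forall>y\<in>{-R..R}. \<bar>2 * min x 0 - 2 * min y 0\<bar> \<le> L * \<bar>x - y\<bar>" for R :: real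
    by (intro exI[of _ 2]) (auto simp: min_def abs_if)
  show "((\<lambda>x. (min x 0)\<^sup>2) has_real_derivative 2 * min x 0) (at x)" for x :: real
  proof (cases x "0::real" rule: linorder_cases)
    case less
    have "((\<lambda>x. x\<^sup>2) has_real_derivative 2 * x) (at x)" by (auto intro!: derivative_eq_intros)
    then have "((\<lambda>x. (min x 0)\<^sup>2) has_real_derivative 2 * x) (at x)"
      by (rule has_field_derivative_transform_within_open[where S="{..<0}"]) (use less in auto)
    then show ?thesis using less by simp
  next
    case greater
    have "((\<lambda>x. 0) has_real_derivative 0) (at x)" by simp
    then have "((\<lambda>x. (min x 0)\<^sup>2) has_real_derivative 0) (at x)"
      by (rule has_field_derivative_transform_within_open[where S="{0<..}"]) (use greater in auto)
    then show ?thesis using greater by simp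
  next
    case equal
    have "((\<lambda>y. ((min y 0)\<^sup>2 - (min 0 0)\<^sup>2) / (y - 0)) \<longlongrightarrow> (0::real)) (at 0)"
    proof (rule Lim_null_comparison)
      show "\<forall>\<^sub>F y in at 0. norm (((min y 0)\<^sup>2 - (min 0 0)\<^sup>2) / (y - 0)) \<le> \<bar>y\<bar>" for y :: real
        by (rule eventually_at_topological[THEN iffD2])
          (auto intro!: exI[of _ UNIV] simp: min_def power2_eq_square abs_mult)
    qed (auto intro!: tendsto_eq_intros)
    then show ?thesis using equal by (simp add: has_field_derivative_iff)
  qed
qed

lemma primitive_on_exp_linear: "primitive_on a b (\<lambda>t. k * exp (k * t)) (\<lambda>t. exp (k * t))"
  by (rule primitive_on_C1) (auto intro!: derivative_eq_intros continuous_intros)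

text \<open>The function \<open>(min \<delta> 0)\<^sup>2 * exp (2 * M * t)\<close> is nondecreasing and vanishes at \<open>b\<close>.\<close>

lemma primitive_on_nonneg_backward:
  assumes P: "primitive_on a b e \<delta>" and "\<delta> b \<ge> 0" and "M \<ge> 0"
    and e: "\<And>t. t \<in> {a..b} \<Longrightarrow> \<delta> t < 0 \<Longrightarrow> e t \<le> M * \<bar>\<delta> t\<bar>" and t: "t \<in> {a..b}"
  shows "\<delta> t \<ge> 0"
proof -
  let ?m = "\<lambda>t. min (\<delta> t) 0"
  have P1: "primitive_on a b (\<lambda>t. 2 * ?m t * e t * exp (2 * M * t) + (?m t)\<^sup>2 * (2 * M * exp (2 * M * t)))
      (\<lambda>t. (?m t)\<^sup>2 * exp (2 * M * t))"
    by (intro primitive_on_mult primitive_on_neg_part_square primitive_on_exp_linear P)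
  have "2 * ?m t * e t * exp (2 * M * t) + (?m t)\<^sup>2 * (2 * M * exp (2 * M * t)) \<ge> 0"
    if t: "t \<in> {a..b}" for t
  proof (cases "\<delta> t < 0")
    case True
    have "(-2 * \<delta> t) * e t \<le> (-2 * \<delta> t) * (M * \<bar>\<delta> t\<bar>)"
      using True by (intro mult_left_mono e t) auto
    then have "0 \<le> (2 * \<delta> t * e t + 2 * M * (\<delta> t)\<^sup>2)"
      using True by (simp add: power2_eq_square algebra_simps)
    then have "0 \<le> (2 * \<delta> t * e t + 2 * M * (\<delta> t)\<^sup>2) * exp (2 * M * t)"
      by (intro mult_nonneg_nonneg) auto
    then show ?thesis using True by (simp add: algebra_simps)
  qed auto
  then have "(?m t)\<^sup>2 * exp (2 * M * t) \<le> (?m b)\<^sup>2 * exp (2 * M * b)"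
    by (intro primitive_on_mono[OF P1]) (use t in auto)
  also have "\<dots> = 0" using assms(2) by simp
  finally show ?thesis by (auto simp: mult_le_0_iff min_def split: if_splits)
qed

lemma primitive_on_zero_backward:
  assumes P: "primitive_on a b e \<delta>" and "\<delta> b = 0" and "M \<ge> 0"
    and e: "\<And>t. t \<in> {a..b} \<Longrightarrow> \<bar>e t\<bar> \<le> M * \<bar>\<delta> t\<bar>" and t: "t \<in> {a..b}"
  shows "\<delta> t = 0"
proof -
  have "\<delta> t \<ge> 0"
    by (rule primitive_on_nonneg_backward[OF P _ \<open>M \<ge> 0\<close> _ t]) (use assms in force)+
  moreover have "- \<delta> t \<ge> 0"
    by (rule primitive_on_nonneg_backward[OF primitive_on_minus[OF P] _ \<open>M \<ge> 0\<close> _ t]) (use assms in force)+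
  ultimately show ?thesis by simp
qed

subsection \<open>Angle equations\<close>

text \<open>Picard iteration in an exponentially weighted norm: substituting
  \<open>exp (k * (b - s)) * z s\<close> for the solution makes the integral operator a contraction
  on all of \<open>{a..b}\<close> at once. The value is prescribed on the right because the angles
  of interest are known far out.\<close>

lemma terminal_value_problem:
  fixes F :: "real \<Rightarrow> real \<Rightarrow> real"
  assumes "a \<le> b" "L \<ge> 0"
    and int: "\<And>y. continuous_on {a..b} y \<Longrightarrow> (\<lambda>t. F t (y t)) integrable_on {a..b}"
    and lip: "\<And>t x y. t \<in> {a..b} \<Longrightarrow> \<bar>F t x - F t y\<bar> \<le> L * \<bar>x - y\<bar>"
    and bnd: "\<And>t. t \<in> {a..b} \<Longrightarrow> \<bar>F t 0\<bar> \<le> M"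
  obtains y where "primitive_on a b (\<lambda>t. F t (y t)) y" "y b = c"
proof -
  \<comment> \<open>The contraction factor is \<open>L / k\<close>, at most 1/2 with this
    \<open>k\<close>; the \<open>+ 1\<close> keeps \<open>k\<close> positive when
    \<open>L = 0\<close>.\<close>
  define k where "k = 2 * (L + 1)"
  have k: "k > 0" "L / k \<le> 1 / 2" using \<open>L \<ge> 0\<close> by (auto simp: k_def field_simps)
  define Y where "Y = (\<lambda>(z::real \<Rightarrow>\<^sub>C real) s. exp (k * (b - s)) * z s)"
  define G where "G = (\<lambda>z t. exp (- (k * (b - t))) * (c - integral {t..b} (\<lambda>s. F s (Y z s))))"
  \<comment> \<open>The fixed point theorem is applied to bounded continuous functions on the whole
    line; \<open>clamp\<close> extends the iterate by constants outside
    \<open>{a..b}\<close>.\<close>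
  define T where "T = (\<lambda>z. Bcontfun (\<lambda>t. G z (clamp a b t)))"
  have cancel: "exp (- x) * (u * exp x) = u" for x u :: real by (simp add: exp_minus field_simps)
  have cY: "continuous_on S (Y z)" for z S
    unfolding Y_def by (intro continuous_intros continuous_on_subset[OF continuous_on_apply_bcontfun]) auto
  have iY: "(\<lambda>s. F s (Y z s)) integrable_on {t..b}" if "t \<ge> a" for z t
    by (rule integrable_on_subinterval[OF int[OF cY]]) (use that in auto)
  have cG: "continuous_on {a..b} (G z)" for z
    unfolding G_def by (intro continuous_intros indefinite_integral_continuous_1' int cY)
  have "(\<lambda>t. G z (clamp a b t)) \<in> bcontfun" for z
    using cG[of z] compact_imp_bounded[OF compact_continuous_image[OF cG[of z] compact_Icc]]
    by (simp add: bcontfun_def clamp_continuous_on clamp_bounded)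
  then have T: "T z t = G z (clamp a b t)" for z t
    by (simp add: T_def Bcontfun_inverse)
  have "dist (T z) (T w) \<le> 1 / 2 * dist z w" for z w
  proof (rule dist_bound)
    fix r
    define t where "t = clamp a b r"
    have t: "a \<le> t" "t \<le> b" using clamp_in_interval[of a b r] \<open>a \<le> b\<close> by (auto simp: t_def)
    have d: "\<bar>Y z s - Y w s\<bar> \<le> exp (k * (b - s)) * dist z w" for s
    proof -
      have "Y z s - Y w s = exp (k * (b - s)) * (z s - w s)" by (simp add: Y_def algebra_simps)
      moreover have "\<bar>z s - w s\<bar> \<le> dist z w" using dist_bounded[of z s w] by (simp add: dist_real_def)
      ultimately show ?thesis by (simp add: abs_mult)
    qed
    have "((\<lambda>s. L * dist z w * exp (k * (b - s))) has_integral
        (- (L * dist z w / k) * exp (k * (b - b))) - (- (L * dist z w / k) * exp (k * (b - t)))) {t..b}"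
      using t k by (intro fundamental_theorem_of_calculus)
        (auto intro!: derivative_eq_intros simp flip: has_real_derivative_iff_has_vector_derivative)
    then have hi: "((\<lambda>s. L * dist z w * exp (k * (b - s))) has_integral
        L * dist z w / k * (exp (k * (b - t)) - 1)) {t..b}"
      by (simp add: algebra_simps)
    have "\<bar>integral {t..b} (\<lambda>s. F s (Y z s)) - integral {t..b} (\<lambda>s. F s (Y w s))\<bar> =
        \<bar>integral {t..b} (\<lambda>s. F s (Y z s) - F s (Y w s))\<bar>"
      by (simp add: Henstock_Kurzweil_Integration.integral_diff[OF iY iY] t)
    also have "\<dots> \<le> integral {t..b} (\<lambda>s. L * dist z w * exp (k * (b - s)))"
      unfolding real_norm_def[symmetric]
    proof (rule integral_norm_bound_integral)
      show "(\<lambda>s. F s (Y z s) - F s (Y w s)) integrable_on {t..b}"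
        using t by (intro integrable_diff iY)
      show "(\<lambda>s. L * dist z w * exp (k * (b - s))) integrable_on {t..b}"
        using hi by (rule has_integral_integrable)
      fix s assume "s \<in> {t..b}"
      then have "\<bar>F s (Y z s) - F s (Y w s)\<bar> \<le> L * \<bar>Y z s - Y w s\<bar>" using t by (intro lip) auto
      also have "\<dots> \<le> L * (exp (k * (b - s)) * dist z w)" by (intro mult_left_mono d \<open>L \<ge> 0\<close>)
      finally show "norm (F s (Y z s) - F s (Y w s)) \<le> L * dist z w * exp (k * (b - s))"
        by (simp add: mult_ac)
    qed
    also have "\<dots> = L * dist z w / k * (exp (k * (b - t)) - 1)" using hi by (rule integral_unique)
    also have "\<dots> \<le> L * dist z w / k * exp (k * (b - t))"
      using k \<open>L \<ge> 0\<close> by (intro mult_left_mono) auto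
    also have "\<dots> \<le> 1 / 2 * dist z w * exp (k * (b - t))"
      using mult_right_mono[OF k(2), of "dist z w * exp (k * (b - t))"] by (simp add: mult_ac)
    finally have "exp (- (k * (b - t))) * \<bar>integral {t..b} (\<lambda>s. F s (Y z s)) - integral {t..b} (\<lambda>s. F s (Y w s))\<bar>
        \<le> exp (- (k * (b - t))) * (1 / 2 * dist z w * exp (k * (b - t)))"
      by (intro mult_left_mono) auto
    also have "\<dots> = 1 / 2 * dist z w" by (rule cancel)
    finally have "\<bar>G z t - G w t\<bar> \<le> 1 / 2 * dist z w"
      by (simp add: G_def abs_mult abs_minus_commute flip: right_diff_distrib)
    then show "dist (T z r) (T w r) \<le> 1 / 2 * dist z w"
      by (simp add: T t_def dist_real_def)
  qed
  then obtain z where z: "T z = z"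
    using banach_fix_type[of "1 / 2" T] by auto
  have Yz: "Y z t = c - integral {t..b} (\<lambda>s. F s (Y z s))" if "t \<in> {a..b}" for t
  proof -
    have "z t = G z t" using T[of z t] z that by simp
    then have "Y z t = exp (k * (b - t)) * G z t" by (simp add: Y_def)
    then show ?thesis by (simp add: G_def exp_minus_inverse flip: mult.assoc)
  qed
  obtain R where R: "R \<ge> 0" "\<And>t. t \<in> {a..b} \<Longrightarrow> \<bar>Y z t\<bar> \<le> R"
    using continuous_on_interval_bound[OF cY] by metis
  have "primitive_on a b (\<lambda>t. F t (Y z t)) (Y z)"
  proof (rule primitive_onI_integral[OF int[OF cY]])
    fix t assume t: "t \<in> {a..b}"
    have "\<bar>F t (Y z t)\<bar> \<le> \<bar>F t 0\<bar> + \<bar>F t (Y z t) - F t 0\<bar>" by simp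
    also have "\<dots> \<le> M + L * R"
      using lip[OF t, of "Y z t" 0] mult_left_mono[OF R(2)[OF t] \<open>L \<ge> 0\<close>] bnd[OF t] by simp
    finally show "\<bar>F t (Y z t)\<bar> \<le> M + L * R" .
    have "integral {a..t} (\<lambda>s. F s (Y z s)) + integral {t..b} (\<lambda>s. F s (Y z s)) = integral {a..b} (\<lambda>s. F s (Y z s))"
      using t by (intro Henstock_Kurzweil_Integration.integral_combine iY) auto
    then show "Y z t = Y z a + integral {a..t} (\<lambda>s. F s (Y z s))"
      using Yz[OF t] Yz[of a] \<open>a \<le> b\<close> by auto
  qed
  moreover have "Y z b = c" using Yz[of b] \<open>a \<le> b\<close> by simp
  ultimately show ?thesis by (rule that)
qed

lemma lipschitz_of_derivative_le_1:
  fixes f :: "real \<Rightarrow> real"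
  assumes "\<And>x. (f has_real_derivative f' x) (at x)" "\<And>x. \<bar>f' x\<bar> \<le> 1"
  shows "\<bar>f x - f y\<bar> \<le> \<bar>x - y\<bar>"
proof -
  have "norm (f x - f y) \<le> 1 * norm (x - y)"
    by (rule field_differentiable_bound[where S=UNIV]) (use assms in auto)
  then show ?thesis by simp
qed

lemma cos_square_lipschitz: "\<bar>(cos x)\<^sup>2 - (cos y)\<^sup>2\<bar> \<le> \<bar>x - (y::real)\<bar>"
proof (rule lipschitz_of_derivative_le_1[where f="\<lambda>x. (cos x)\<^sup>2"])
  show "((\<lambda>x. (cos x)\<^sup>2) has_real_derivative - sin (2 * x)) (at x)" for x :: real
    by (auto intro!: derivative_eq_intros simp: sin_double)
qed simp

lemma sin_square_lipschitz: "\<bar>(sin x)\<^sup>2 - (sin y)\<^sup>2\<bar> \<le> \<bar>x - (y::real)\<bar>"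
  using cos_square_lipschitz[of x y] by (simp add: cos_squared_eq)

lemma sin_cos_lipschitz: "\<bar>sin x * cos x - sin y * cos y\<bar> \<le> \<bar>x - (y::real)\<bar>"
proof (rule lipschitz_of_derivative_le_1[where f="\<lambda>x. sin x * cos x"])
  show "((\<lambda>x. sin x * cos x) has_real_derivative cos (2 * x)) (at x)" for x :: real
    by (auto intro!: derivative_eq_intros simp: cos_double power2_eq_square)
qed simp

text \<open>Every planar linear system makes its direction angle obey an equation of this shape. Its
  right-hand side is globally Lipschitz in the angle, because the three quadratic expressions in sin
  and cos are 1-Lipschitz; so solutions exist on the whole interval.\<close>

lemma angle_equation_solution:
  assumes "a \<le> b"
    and A: "A integrable_on {a..b}" "\<And>t. t \<in> {a..b} \<Longrightarrow> \<bar>A t\<bar> \<le> M"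
    and B: "B integrable_on {a..b}" "\<And>t. t \<in> {a..b} \<Longrightarrow> \<bar>B t\<bar> \<le> M"
    and S: "S integrable_on {a..b}" "\<And>t. t \<in> {a..b} \<Longrightarrow> \<bar>S t\<bar> \<le> M"
  obtains y where
    "primitive_on a b (\<lambda>t. A t * (cos (y t))\<^sup>2 + B t * (sin (y t))\<^sup>2 + S t * (sin (y t) * cos (y t))) y"
    "y b = c"
proof (rule terminal_value_problem[where a=a and b=b and L="3 * M" and M=M and c=c and
      F="\<lambda>t y. A t * (cos y)\<^sup>2 + B t * (sin y)\<^sup>2 + S t * (sin y * cos y)"])
  have M: "M \<ge> 0" using A(2)[of a] \<open>a \<le> b\<close> by fastforce
  then show "3 * M \<ge> 0" by simp
  show "(\<lambda>t. A t * (cos (y t))\<^sup>2 + B t * (sin (y t))\<^sup>2 + S t * (sin (y t) * cos (y t))) integrable_on {a..b}"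
    if "continuous_on {a..b} y" for y
    unfolding mult.commute[of "A _"] mult.commute[of "B _"] mult.commute[of "S _"]
    using A B S that
    by (intro integrable_add integrable_continuous_mult_bounded[where M=M] continuous_intros) auto
  show "\<bar>A t * (cos x)\<^sup>2 + B t * (sin x)\<^sup>2 + S t * (sin x * cos x) -
      (A t * (cos y)\<^sup>2 + B t * (sin y)\<^sup>2 + S t * (sin y * cos y))\<bar> \<le> 3 * M * \<bar>x - y\<bar>"
    if t: "t \<in> {a..b}" for t x y
  proof -
    have "\<bar>A t * ((cos x)\<^sup>2 - (cos y)\<^sup>2)\<bar> \<le> M * \<bar>x - y\<bar>"
      "\<bar>B t * ((sin x)\<^sup>2 - (sin y)\<^sup>2)\<bar> \<le> M * \<bar>x - y\<bar>"
      "\<bar>S t * (sin x * cos x - sin y * cos y)\<bar> \<le> M * \<bar>x - y\<bar>"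
      unfolding abs_mult
      using A(2) B(2) S(2) t M cos_square_lipschitz sin_square_lipschitz
        sin_cos_lipschitz[unfolded abs_mult]
      by (auto intro!: mult_mono)
    then show ?thesis by (simp add: algebra_simps abs_le_iff)
  qed
qed (use assms in auto)

text \<open>The equation satisfied by the angle of \<open>(f, f')\<close> when \<open>f'' = q f\<close>.\<close>

definition prufer_angle :: "(real \<Rightarrow> real) \<Rightarrow> real \<Rightarrow> real \<Rightarrow> (real \<Rightarrow> real) \<Rightarrow> bool" where
  "prufer_angle q a b \<theta> \<longleftrightarrow> primitive_on a b (\<lambda>t. q t * (cos (\<theta> t))\<^sup>2 - (sin (\<theta> t))\<^sup>2) \<theta>"

lemma prufer_angle_exists:
  assumes "a \<le> b" "q integrable_on {a..b}" "\<And>t. t \<in> {a..b} \<Longrightarrow> \<bar>q t\<bar> \<le> M"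
  shows "\<exists>\<theta>. prufer_angle q a b \<theta> \<and> \<theta> b = c"
proof -
  obtain y where "primitive_on a b (\<lambda>t. q t * (cos (y t))\<^sup>2 + (-1) * (sin (y t))\<^sup>2 + 0 * (sin (y t) * cos (y t))) y"
    "y b = c"
  proof (rule angle_equation_solution[OF \<open>a \<le> b\<close> assms(2), where M="max M 1" and B="\<lambda>_. -1" and S="\<lambda>_. 0" and c=c])
    show "\<bar>q t\<bar> \<le> max M 1" if "t \<in> {a..b}" for t using assms(3)[OF that] by simp
  qed auto
  then show ?thesis by (auto simp: prufer_angle_def)
qed

lemma prufer_angle_subinterval:
  "prufer_angle q a b \<theta> \<Longrightarrow> a \<le> a' \<Longrightarrow> b' \<le> b \<Longrightarrow> prufer_angle q a' b' \<theta>"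
  unfolding prufer_angle_def by (rule primitive_on_subinterval)

text \<open>Eliminating the sine squares separates a term with the sign of \<open>q2 - q1\<close>
  from a term that is Lipschitz in the difference of the angles: the form needed for comparison and
  for stability.\<close>

lemma prufer_angle_difference:
  assumes "prufer_angle q1 a b \<theta>1" "prufer_angle q2 a b \<theta>2"
  shows "primitive_on a b (\<lambda>t. (q2 t - q1 t) * (cos (\<theta>2 t))\<^sup>2 +
    (q1 t + 1) * ((cos (\<theta>2 t))\<^sup>2 - (cos (\<theta>1 t))\<^sup>2)) (\<lambda>t. \<theta>2 t - \<theta>1 t)"
  using primitive_on_diff[OF assms(2,1)[unfolded prufer_angle_def]]
  by (rule primitive_on_cong) (auto simp: sin_squared_eq algebra_simps)

text \<open>The order is carried from \<open>b\<close> to the left: a larger potential means a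
  larger rate, hence a smaller angle to the left of a common value.\<close>

lemma prufer_angle_mono:
  assumes "prufer_angle q1 a b \<theta>1" "prufer_angle q2 a b \<theta>2" "\<theta>1 b \<le> \<theta>2 b"
    and q: "\<And>t. t \<in> {a..b} \<Longrightarrow> q2 t \<le> q1 t" "\<And>t. t \<in> {a..b} \<Longrightarrow> \<bar>q1 t\<bar> \<le> M"
    and t: "t \<in> {a..b}"
  shows "\<theta>1 t \<le> \<theta>2 t"
proof -
  have "\<theta>2 t - \<theta>1 t \<ge> 0"
  proof (rule primitive_on_nonneg_backward[OF prufer_angle_difference[OF assms(1,2)] _ _ _ t])
    show "0 \<le> \<bar>M\<bar> + 1" by simp
    fix s assume s: "s \<in> {a..b}"
    have "(q2 s - q1 s) * (cos (\<theta>2 s))\<^sup>2 \<le> 0"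
      using q(1)[OF s] by (intro mult_nonpos_nonneg) auto
    moreover have "\<bar>(q1 s + 1) * ((cos (\<theta>2 s))\<^sup>2 - (cos (\<theta>1 s))\<^sup>2)\<bar> \<le> (\<bar>M\<bar> + 1) * \<bar>\<theta>2 s - \<theta>1 s\<bar>"
      unfolding abs_mult using q(2)[OF s] by (intro mult_mono cos_square_lipschitz) auto
    ultimately show "(q2 s - q1 s) * (cos (\<theta>2 s))\<^sup>2 +
        (q1 s + 1) * ((cos (\<theta>2 s))\<^sup>2 - (cos (\<theta>1 s))\<^sup>2) \<le> (\<bar>M\<bar> + 1) * \<bar>\<theta>2 s - \<theta>1 s\<bar>"
      by linarith
  qed (use assms in auto)
  then show ?thesis by simp
qed

text \<open>At \<open>- pi / 2\<close> the cosine vanishes and the rate is -1 whatever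
  \<open>q\<close> is, so going left the angle can cross this level upwards only.\<close>

lemma prufer_angle_ge:
  assumes \<theta>: "prufer_angle q a b \<theta>" "\<theta> b \<ge> - pi / 2"
    and q: "\<And>t. t \<in> {a..b} \<Longrightarrow> \<bar>q t\<bar> \<le> M" and t: "t \<in> {a..b}"
  shows "\<theta> t \<ge> - pi / 2"
proof -
  have "\<theta> t + pi / 2 \<ge> 0"
  proof (rule primitive_on_nonneg_backward[OF primitive_on_shift[OF \<theta>(1)[unfolded prufer_angle_def]] _ _ _ t])
    show "0 \<le> \<bar>M\<bar>" by simp
    fix s assume s: "s \<in> {a..b}"
    have "q s * (cos (\<theta> s))\<^sup>2 \<le> \<bar>q s * ((cos (\<theta> s))\<^sup>2 - (cos (- pi / 2))\<^sup>2)\<bar>" by simp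
    also have "\<dots> \<le> \<bar>M\<bar> * \<bar>\<theta> s - (- pi / 2)\<bar>"
      unfolding abs_mult using q[OF s] by (intro mult_mono cos_square_lipschitz) auto
    finally show "q s * (cos (\<theta> s))\<^sup>2 - (sin (\<theta> s))\<^sup>2 \<le> \<bar>M\<bar> * \<bar>\<theta> s + pi / 2\<bar>"
      by (simp add: add_increasing2 diff_le_eq)
  qed (use \<theta> in auto)
  then show ?thesis by simp
qed

text \<open>At angle 0 the rate is \<open>q t \<ge> 0\<close>, so going left the angle cannot rise
  above 0. With the lower barrier this traps angles in \<open>[- pi / 2, 0]\<close>.\<close>

lemma prufer_angle_le_0:
  assumes \<theta>: "prufer_angle q a b \<theta>" "\<theta> b \<le> 0"
    and q: "\<And>t. t \<in> {a..b} \<Longrightarrow> q t \<ge> 0" and t: "t \<in> {a..b}"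
  shows "\<theta> t \<le> 0"
proof -
  have "- \<theta> t \<ge> 0"
  proof (rule primitive_on_nonneg_backward[OF primitive_on_minus[OF \<theta>(1)[unfolded prufer_angle_def]] _ _ _ t])
    show "0 \<le> (1::real)" by simp
    fix s assume s: "s \<in> {a..b}"
    have "(sin (\<theta> s))\<^sup>2 \<le> \<bar>\<theta> s\<bar>" using sin_square_lipschitz[of "\<theta> s" 0] by simp
    moreover have "q s * (cos (\<theta> s))\<^sup>2 \<ge> 0" using q[OF s] by simp
    ultimately show "- (q s * (cos (\<theta> s))\<^sup>2 - (sin (\<theta> s))\<^sup>2) \<le> 1 * \<bar>- \<theta> s\<bar>" by simp
  qed (use \<theta> in auto)
  then show ?thesis by simp
qed

text \<open>Backward Gronwall for the square of the difference. In \<open>2 * M + 3\<close>, the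
  part \<open>2 * (M + 1)\<close> is the Lipschitz rate and the remaining 1 pays for \<open>2 *
  \<eta> * \<bar>\<delta>\<bar> \<le> \<eta>\<^sup>2 + \<delta>\<^sup>2\<close>.\<close>

lemma prufer_angle_stability:
  assumes "prufer_angle q1 a b \<theta>1" "prufer_angle q2 a b \<theta>2" "M \<ge> 0" "\<eta> \<ge> 0"
    and q: "\<And>t. t \<in> {a..b} \<Longrightarrow> \<bar>q2 t - q1 t\<bar> \<le> \<eta>" "\<And>t. t \<in> {a..b} \<Longrightarrow> \<bar>q1 t\<bar> \<le> M"
    and t: "t \<in> {a..b}"
  shows "(\<theta>2 t - \<theta>1 t)\<^sup>2 \<le> ((\<theta>2 b - \<theta>1 b)\<^sup>2 + \<eta>\<^sup>2 * (b - a)) * exp ((2 * M + 3) * (b - a))"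
proof -
  define k where "k = 2 * M + 3"
  have k: "k \<ge> 0" using \<open>M \<ge> 0\<close> by (simp add: k_def)
  define \<delta> where "\<delta> = (\<lambda>t. \<theta>2 t - \<theta>1 t)"
  define e where "e = (\<lambda>t. (q2 t - q1 t) * (cos (\<theta>2 t))\<^sup>2 + (q1 t + 1) * ((cos (\<theta>2 t))\<^sup>2 - (cos (\<theta>1 t))\<^sup>2))"
  have P: "primitive_on a b e \<delta>"
    unfolding e_def \<delta>_def by (rule prufer_angle_difference[OF assms(1,2)])
  have P1: "primitive_on a b (\<lambda>t. 2 * \<delta> t * e t * exp (k * t) + (\<delta> t)\<^sup>2 * (k * exp (k * t))) (\<lambda>t. (\<delta> t)\<^sup>2 * exp (k * t))"
    by (intro primitive_on_mult primitive_on_square primitive_on_exp_linear P)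
  have P2: "primitive_on a b (\<lambda>t. - (\<eta>\<^sup>2 * exp (k * b))) (\<lambda>t. - (\<eta>\<^sup>2 * exp (k * b)) * t)"
    by (rule primitive_on_C1) (auto intro!: derivative_eq_intros)
  have "- (\<eta>\<^sup>2 * exp (k * b)) * b - - (\<eta>\<^sup>2 * exp (k * b)) * t \<le> (\<delta> b)\<^sup>2 * exp (k * b) - (\<delta> t)\<^sup>2 * exp (k * t)"
  proof (rule primitive_on_mono_diff[OF P2 P1])
    fix s assume s: "s \<in> {a..b}"
    have "\<bar>(q2 s - q1 s) * (cos (\<theta>2 s))\<^sup>2\<bar> \<le> \<eta> * 1"
      unfolding abs_mult using q(1)[OF s] \<open>\<eta> \<ge> 0\<close>
      by (intro mult_mono) (auto simp: abs_square_le_1)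
    moreover have "\<bar>(q1 s + 1) * ((cos (\<theta>2 s))\<^sup>2 - (cos (\<theta>1 s))\<^sup>2)\<bar> \<le> (M + 1) * \<bar>\<delta> s\<bar>"
      unfolding abs_mult \<delta>_def using q(2)[OF s] \<open>M \<ge> 0\<close> by (intro mult_mono cos_square_lipschitz) auto
    ultimately have "\<bar>e s\<bar> \<le> \<eta> + (M + 1) * \<bar>\<delta> s\<bar>" unfolding e_def by linarith
    then have "2 * \<bar>\<delta> s\<bar> * \<bar>e s\<bar> \<le> 2 * \<bar>\<delta> s\<bar> * (\<eta> + (M + 1) * \<bar>\<delta> s\<bar>)"
      by (intro mult_left_mono) auto
    also have "\<dots> = 2 * \<eta> * \<bar>\<delta> s\<bar> + (2 * M + 2) * (\<delta> s)\<^sup>2"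
      by (simp add: algebra_simps power2_eq_square)
    also have "\<dots> \<le> \<eta>\<^sup>2 + k * (\<delta> s)\<^sup>2"
    proof -
      have "2 * \<eta> * \<bar>\<delta> s\<bar> \<le> \<eta>\<^sup>2 + (\<delta> s)\<^sup>2"
        using sum_squares_bound[of \<eta> "\<bar>\<delta> s\<bar>"] by simp
      moreover have "k * (\<delta> s)\<^sup>2 = (2 * M + 2) * (\<delta> s)\<^sup>2 + (\<delta> s)\<^sup>2"
        by (simp add: k_def distrib_right)
      ultimately show ?thesis by linarith
    qed
    finally have "2 * \<bar>\<delta> s\<bar> * \<bar>e s\<bar> \<le> \<eta>\<^sup>2 + k * (\<delta> s)\<^sup>2" .
    moreover have "- (2 * \<delta> s * e s) \<le> 2 * \<bar>\<delta> s\<bar> * \<bar>e s\<bar>"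
      using abs_ge_minus_self[of "2 * \<delta> s * e s"] by (simp add: abs_mult)
    ultimately have "- (2 * \<delta> s * e s) \<le> \<eta>\<^sup>2 + k * (\<delta> s)\<^sup>2" by linarith
    then have "- \<eta>\<^sup>2 * exp (k * s) \<le> (2 * \<delta> s * e s + k * (\<delta> s)\<^sup>2) * exp (k * s)"
      by (intro mult_right_mono) auto
    moreover have "- \<eta>\<^sup>2 * exp (k * b) \<le> - \<eta>\<^sup>2 * exp (k * s)"
      using s k by (simp add: mult_left_mono)
    ultimately show "- (\<eta>\<^sup>2 * exp (k * b)) \<le> 2 * \<delta> s * e s * exp (k * s) + (\<delta> s)\<^sup>2 * (k * exp (k * s))"
      by (simp add: algebra_simps)
  qed (use t in auto)
  then have "(\<delta> t)\<^sup>2 * exp (k * t) \<le> ((\<delta> b)\<^sup>2 + \<eta>\<^sup>2 * (b - t)) * exp (k * b)"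
    by (simp add: algebra_simps)
  also have "\<dots> = ((\<delta> b)\<^sup>2 + \<eta>\<^sup>2 * (b - t)) * exp (k * (b - t)) * exp (k * t)"
  proof -
    have "exp (k * b) = exp (k * (b - t)) * exp (k * t)"
      by (simp add: algebra_simps flip: exp_add)
    then show ?thesis by simp
  qed
  finally have "(\<delta> t)\<^sup>2 \<le> ((\<delta> b)\<^sup>2 + \<eta>\<^sup>2 * (b - t)) * exp (k * (b - t))" by simp
  also have "\<dots> \<le> ((\<delta> b)\<^sup>2 + \<eta>\<^sup>2 * (b - a)) * exp (k * (b - a))"
    using t k by (intro mult_mono add_mono mult_left_mono) (auto intro!: mult_left_mono)
  finally show ?thesis by (simp add: \<delta>_def k_def)
qed

text \<open>The difference \<open>\<delta>\<close> of the two angles satisfies \<open>\<delta>' \<ge> sin\<^sup>2 \<delta>\<close>, so it cannot stay above \<open>\<epsilon>\<close> for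
  long inside a strip of width \<open>\<pi>/2\<close>.\<close>

lemma prufer_angle_contraction:
  assumes \<theta>: "prufer_angle q a b \<theta>1" "prufer_angle q a b \<theta>2"
    and strip: "\<And>t. t \<in> {a..b} \<Longrightarrow> - pi / 2 \<le> \<theta>1 t \<and> \<theta>1 t \<le> \<theta>2 t \<and> \<theta>2 t \<le> 0"
    and q: "\<And>t. t \<in> {a..b} \<Longrightarrow> q t \<ge> 0" and "a \<le> b"
    and \<epsilon>: "0 < \<epsilon>" "\<epsilon> \<le> pi / 2" "(b - a) * (sin \<epsilon>)\<^sup>2 > pi / 2"
  shows "\<theta>2 a - \<theta>1 a < \<epsilon>"
proof (rule ccontr)
  assume *: "\<not> \<theta>2 a - \<theta>1 a < \<epsilon>"
  define \<delta> where "\<delta> = (\<lambda>t. \<theta>2 t - \<theta>1 t)"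
  define e where "e = (\<lambda>t. (q t - q t) * (cos (\<theta>2 t))\<^sup>2 + (q t + 1) * ((cos (\<theta>2 t))\<^sup>2 - (cos (\<theta>1 t))\<^sup>2))"
  have P: "primitive_on a b e \<delta>"
    unfolding e_def \<delta>_def by (rule prufer_angle_difference[OF \<theta>])
  have e: "e t \<ge> (sin (\<delta> t))\<^sup>2 \<and> 0 \<le> \<delta> t \<and> \<delta> t \<le> pi / 2" if t: "t \<in> {a..b}" for t
  proof -
    have d: "0 \<le> \<delta> t" "\<delta> t \<le> pi / 2" using strip[OF t] by (auto simp: \<delta>_def)
    have "(cos x)\<^sup>2 - (cos y)\<^sup>2 = sin (y + x) * sin (y - x)" for x y :: real
    proof -
      have "sin (y + x) * sin (y - x) = (sin y)\<^sup>2 * (cos x)\<^sup>2 - (cos y)\<^sup>2 * (sin x)\<^sup>2"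
        by (simp add: sin_add sin_diff algebra_simps power2_eq_square)
      then show ?thesis by (simp add: sin_squared_eq algebra_simps)
    qed
    then have "(cos (\<theta>2 t))\<^sup>2 - (cos (\<theta>1 t))\<^sup>2 = sin (\<theta>1 t + \<theta>2 t) * sin (\<theta>1 t - \<theta>2 t)" by simp
    also have "\<dots> = sin (- (\<theta>1 t + \<theta>2 t)) * sin (\<delta> t)"
      unfolding \<delta>_def by (metis minus_diff_eq minus_mult_minus sin_minus)
    finally have c: "(cos (\<theta>2 t))\<^sup>2 - (cos (\<theta>1 t))\<^sup>2 = sin (- (\<theta>1 t + \<theta>2 t)) * sin (\<delta> t)" .
    \<comment> \<open>The strip gives \<open>\<delta> t \<le> - (\<theta>1 t + \<theta>2 t) \<le> pi
      - \<delta> t\<close>: the first from \<open>\<theta>2 t \<le> 0\<close>, the second from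
      \<open>- pi / 2 \<le> \<theta>1 t\<close>. On this interval around \<open>pi / 2\<close> the
      sine is at least \<open>sin (\<delta> t)\<close>.\<close>
    have "sin (- (\<theta>1 t + \<theta>2 t)) \<ge> sin (\<delta> t)"
    proof (cases "- (\<theta>1 t + \<theta>2 t) \<le> pi / 2")
      case True
      then show ?thesis using d strip[OF t] by (intro sin_monotone_2pi_le) (auto simp: \<delta>_def)
    next
      case False
      have "sin (\<delta> t) \<le> sin (pi - (- (\<theta>1 t + \<theta>2 t)))"
        using False d strip[OF t] by (intro sin_monotone_2pi_le) (auto simp: \<delta>_def)
      then show ?thesis by simp
    qed
    moreover have s0: "sin (\<delta> t) \<ge> 0" using d by (intro sin_ge_zero) auto
    ultimately have "(sin (\<delta> t))\<^sup>2 \<le> (cos (\<theta>2 t))\<^sup>2 - (cos (\<theta>1 t))\<^sup>2"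
      unfolding c power2_eq_square[of "sin _"] by (intro mult_right_mono)
    moreover have "(cos (\<theta>2 t))\<^sup>2 - (cos (\<theta>1 t))\<^sup>2 \<le> (q t + 1) * ((cos (\<theta>2 t))\<^sup>2 - (cos (\<theta>1 t))\<^sup>2)"
      using mult_nonneg_nonneg[OF q[OF t] order_trans[OF zero_le_power2 calculation]]
      by (simp add: distrib_right)
    ultimately show ?thesis using d by (simp add: e_def)
  qed
  have \<delta>: "\<delta> t \<ge> \<epsilon>" if t: "t \<in> {a..b}" for t
  proof -
    have "\<delta> a \<le> \<delta> t"
    proof (rule primitive_on_mono[OF P])
      show "0 \<le> e s" if "s \<in> {a..b}" for s
        using e[OF that] order_trans[OF zero_le_power2] by blast
    qed (use t in auto)
    then show ?thesis using * by (simp add: \<delta>_def)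
  qed
  have "primitive_on a b (\<lambda>t. (sin \<epsilon>)\<^sup>2) (\<lambda>t. (sin \<epsilon>)\<^sup>2 * t)"
    by (rule primitive_on_C1) (auto intro!: derivative_eq_intros)
  then have "(sin \<epsilon>)\<^sup>2 * b - (sin \<epsilon>)\<^sup>2 * a \<le> \<delta> b - \<delta> a"
  proof (rule primitive_on_mono_diff[OF _ P])
    fix t assume t: "t \<in> {a..b}"
    have "sin \<epsilon> \<le> sin (\<delta> t)" using \<delta>[OF t] e[OF t] \<epsilon> by (intro sin_monotone_2pi_le) auto
    then have "(sin \<epsilon>)\<^sup>2 \<le> (sin (\<delta> t))\<^sup>2" using \<epsilon> by (intro power_mono sin_ge_zero) auto
    then show "(sin \<epsilon>)\<^sup>2 \<le> e t" using e[OF t] by linarith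
  qed (use \<open>a \<le> b\<close> in auto)
  also have "\<dots> \<le> pi / 2" using e[of a] e[of b] \<open>a \<le> b\<close> by auto
  finally show False using \<epsilon>(3) by (simp add: algebra_simps)
qed

subsection \<open>The angle of the decaying solution\<close>

text \<open>These properties carry the whole identification of eigenvalues with levels of an angle.
  The comparison with \<open>Q0\<close> enters only to verify them and in the asymptotics.\<close>

locale confining_potential =
  fixes V :: "real \<Rightarrow> real" and x0 :: real
  assumes V_integrable: "\<And>b. V integrable_on {x0..b}"
    and V_bounded: "\<And>b. \<exists>M. \<forall>t\<in>{x0..b}. \<bar>V t\<bar> \<le> M"
    and V_at_top: "\<And>\<Lambda>. \<exists>a\<ge>x0. \<forall>t\<ge>a. \<Lambda> \<le> V t"
begin

lemma q_integrable: "(\<lambda>t. V t - \<nu>) integrable_on {x0..b}"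
  by (intro integrable_diff V_integrable integrable_const_ivl)

lemma q_bound:
  obtains M where "M \<ge> 0" "\<And>t \<nu>. t \<in> {x0..b} \<Longrightarrow> \<bar>V t - \<nu>\<bar> \<le> M + \<bar>\<nu>\<bar>"
proof -
  obtain M where M: "\<forall>t\<in>{x0..b}. \<bar>V t\<bar> \<le> M" using V_bounded by blast
  have "\<bar>V t - \<nu>\<bar> \<le> max M 0 + \<bar>\<nu>\<bar>" if "t \<in> {x0..b}" for t \<nu>
    using M that by fastforce
  then show ?thesis by (intro that[of "max M 0"]) auto
qed

text \<open>The angle of the solution that vanishes at \<open>x0 + n\<close>; these angles increase with \<open>n\<close>.\<close>

definition trunc_angle :: "nat \<Rightarrow> real \<Rightarrow> real \<Rightarrow> real" where
  "trunc_angle n \<nu> = (SOME \<theta>. prufer_angle (\<lambda>t. V t - \<nu>) x0 (x0 + real n) \<theta> \<and> \<theta> (x0 + real n) = - pi / 2)"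

lemma trunc_angle: "prufer_angle (\<lambda>t. V t - \<nu>) x0 (x0 + real n) (trunc_angle n \<nu>)"
  and trunc_angle_end: "trunc_angle n \<nu> (x0 + real n) = - pi / 2"
proof -
  obtain M where "M \<ge> 0" "\<And>t \<nu>. t \<in> {x0..x0 + real n} \<Longrightarrow> \<bar>V t - \<nu>\<bar> \<le> M + \<bar>\<nu>\<bar>"
    using q_bound by blast
  then have "\<exists>\<theta>. prufer_angle (\<lambda>t. V t - \<nu>) x0 (x0 + real n) \<theta> \<and> \<theta> (x0 + real n) = - pi / 2"
    by (intro prufer_angle_exists[where M="M + \<bar>\<nu>\<bar>"] q_integrable) auto
  then have "prufer_angle (\<lambda>t. V t - \<nu>) x0 (x0 + real n) (trunc_angle n \<nu>) \<and>
      trunc_angle n \<nu> (x0 + real n) = - pi / 2"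
    unfolding trunc_angle_def by (rule someI_ex)
  then show "prufer_angle (\<lambda>t. V t - \<nu>) x0 (x0 + real n) (trunc_angle n \<nu>)"
    "trunc_angle n \<nu> (x0 + real n) = - pi / 2" by auto
qed

lemma trunc_angle_ge: "t \<in> {x0..x0 + real n} \<Longrightarrow> - pi / 2 \<le> trunc_angle n \<nu> t"
proof -
  assume t: "t \<in> {x0..x0 + real n}"
  obtain M where "M \<ge> 0" "\<And>t \<nu>. t \<in> {x0..x0 + real n} \<Longrightarrow> \<bar>V t - \<nu>\<bar> \<le> M + \<bar>\<nu>\<bar>"
    using q_bound by blast
  then show ?thesis
    by (intro prufer_angle_ge[OF trunc_angle _ _ t, where M="M + \<bar>\<nu>\<bar>"]) (auto simp: trunc_angle_end)
qed

lemma trunc_angle_le_0: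
  assumes "x0 \<le> a" "\<And>t. t \<ge> a \<Longrightarrow> \<nu> \<le> V t" "t \<in> {a..x0 + real n}"
  shows "trunc_angle n \<nu> t \<le> 0"
  by (rule prufer_angle_le_0[OF prufer_angle_subinterval[OF trunc_angle] _ _ assms(3)])
    (use assms in \<open>auto simp: trunc_angle_end\<close>)

text \<open>At \<open>x0 + real n\<close> the earlier angle has the barrier value
  \<open>- pi / 2\<close>, and the later one lies above the barrier; comparison carries this order
  to the left.\<close>

lemma trunc_angle_mono_index:
  assumes "n \<le> m" "t \<in> {x0..x0 + real n}"
  shows "trunc_angle n \<nu> t \<le> trunc_angle m \<nu> t"
proof -
  obtain M where M: "M \<ge> 0" "\<And>t \<nu>. t \<in> {x0..x0 + real n} \<Longrightarrow> \<bar>V t - \<nu>\<bar> \<le> M + \<bar>\<nu>\<bar>"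
    using q_bound by blast
  show ?thesis
    by (rule prufer_angle_mono[OF trunc_angle prufer_angle_subinterval[OF trunc_angle] _ _ M(2) assms(2)])
      (use assms trunc_angle_ge[of "x0 + real n" m \<nu>] in \<open>auto simp: trunc_angle_end\<close>)
qed

lemma trunc_angle_mono:
  assumes "\<nu> \<le> \<mu>" "t \<in> {x0..x0 + real n}"
  shows "trunc_angle n \<nu> t \<le> trunc_angle n \<mu> t"
proof -
  obtain M where M: "M \<ge> 0" "\<And>t \<nu>. t \<in> {x0..x0 + real n} \<Longrightarrow> \<bar>V t - \<nu>\<bar> \<le> M + \<bar>\<nu>\<bar>"
    using q_bound by blast
  show ?thesis
    by (rule prufer_angle_mono[OF trunc_angle trunc_angle _ _ M(2) assms(2)])
      (use assms in \<open>auto simp: trunc_angle_end\<close>)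
qed

text \<open>The contraction rate \<open>(sin \<epsilon>)\<^sup>2\<close> does not involve the
  potential, so one \<open>N\<close> serves all \<open>\<nu> \<le> \<Lambda>\<close>. This
  uniformity is what later makes the limit continuous in \<open>\<nu>\<close>.\<close>

lemma trunc_angle_Cauchy:
  assumes a: "x0 \<le> a" "\<And>t. t \<ge> a \<Longrightarrow> \<Lambda> \<le> V t" and \<epsilon>: "0 < \<epsilon>" "\<epsilon> \<le> pi / 2"
  obtains N where "\<And>n. n \<ge> N \<Longrightarrow> a \<le> x0 + real n"
    "\<And>n m \<nu>. n \<ge> N \<Longrightarrow> m \<ge> n \<Longrightarrow> \<nu> \<le> \<Lambda> \<Longrightarrow> \<bar>trunc_angle m \<nu> a - trunc_angle n \<nu> a\<bar> < \<epsilon>"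
proof -
  have s: "sin \<epsilon> > 0" using \<epsilon> by (intro sin_gt_zero) auto
  \<comment> \<open>Two angles in the strip can stay \<open>\<epsilon>\<close> apart over a length
    of at most \<open>(pi / 2) / (sin \<epsilon>)\<^sup>2\<close>; the extra 1 makes the required
    inequality strict.\<close>
  define R where "R = a - x0 + (pi / 2 + 1) / (sin \<epsilon>)\<^sup>2"
  obtain N where N: "real N \<ge> R" using real_arch_simple by blast
  have pos: "(pi / 2 + 1) / (sin \<epsilon>)\<^sup>2 > 0" using s by (intro divide_pos_pos) (auto simp: add_pos_pos)
  have an: "a \<le> x0 + real n" if "n \<ge> N" for n
    using N that pos unfolding R_def by (smt (verit) of_nat_mono)
  show ?thesis
  proof (rule that[of N])
    show "a \<le> x0 + real n" if "n \<ge> N" for n using an that .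
    fix n m \<nu> assume n: "n \<ge> N" "m \<ge> n" "\<nu> \<le> \<Lambda>"
    have strip: "- pi / 2 \<le> trunc_angle n \<nu> t \<and> trunc_angle n \<nu> t \<le> trunc_angle m \<nu> t \<and> trunc_angle m \<nu> t \<le> 0"
      if t: "t \<in> {a..x0 + real n}" for t
    proof (intro conjI)
      show "- pi / 2 \<le> trunc_angle n \<nu> t" using t a by (intro trunc_angle_ge) auto
      show "trunc_angle n \<nu> t \<le> trunc_angle m \<nu> t" using t a n by (intro trunc_angle_mono_index) auto
      show "trunc_angle m \<nu> t \<le> 0"
        by (rule trunc_angle_le_0[OF a(1)]) (use t a n in \<open>auto intro: order_trans\<close>)
    qed
    have p1: "prufer_angle (\<lambda>t. V t - \<nu>) a (x0 + real n) (trunc_angle n \<nu>)"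
      by (rule prufer_angle_subinterval[OF trunc_angle]) (use a in auto)
    have p2: "prufer_angle (\<lambda>t. V t - \<nu>) a (x0 + real n) (trunc_angle m \<nu>)"
      by (rule prufer_angle_subinterval[OF trunc_angle]) (use a n in auto)
    have q0: "0 \<le> V t - \<nu>" if "t \<in> {a..x0 + real n}" for t using a n that by force
    have "(pi / 2 + 1) / (sin \<epsilon>)\<^sup>2 \<le> x0 + real n - a" using N n(1) by (simp add: R_def)
    then have "pi / 2 + 1 \<le> (x0 + real n - a) * (sin \<epsilon>)\<^sup>2" using s by (simp add: pos_divide_le_eq)
    then have "pi / 2 < (x0 + real n - a) * (sin \<epsilon>)\<^sup>2" by simp
    then have "trunc_angle m \<nu> a - trunc_angle n \<nu> a < \<epsilon>"
      by (intro prufer_angle_contraction[OF p1 p2 strip q0 an[OF n(1)] \<epsilon>])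
    then show "\<bar>trunc_angle m \<nu> a - trunc_angle n \<nu> a\<bar> < \<epsilon>"
      using strip[of a] an[OF n(1)] by auto
  qed
qed

definition decaying_angle :: "real \<Rightarrow> real \<Rightarrow> real" where
  "decaying_angle \<nu> t = lim (\<lambda>n. trunc_angle n \<nu> t)"

lemma trunc_angle_tendsto_far:
  assumes a: "x0 \<le> a" "\<And>t. t \<ge> a \<Longrightarrow> \<nu> \<le> V t"
  shows "(\<lambda>n. trunc_angle n \<nu> a) \<longlonglongrightarrow> decaying_angle \<nu> a"
proof -
  have "Cauchy (\<lambda>n. trunc_angle n \<nu> a)"
    unfolding Cauchy_altdef
  proof (intro allI impI)
    fix e :: real assume "e > 0"
    then have e: "0 < min e (pi / 2)" "min e (pi / 2) \<le> pi / 2" by auto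
    show "\<exists>M. \<forall>m\<ge>M. \<forall>n>m. dist (trunc_angle m \<nu> a) (trunc_angle n \<nu> a) < e"
    proof (rule trunc_angle_Cauchy[OF a e])
      fix N assume "\<And>n m \<nu>'. n \<ge> N \<Longrightarrow> m \<ge> n \<Longrightarrow> \<nu>' \<le> \<nu> \<Longrightarrow>
        \<bar>trunc_angle m \<nu>' a - trunc_angle n \<nu>' a\<bar> < min e (pi / 2)"
      then show ?thesis
        by (intro exI[of _ N]) (auto simp: dist_real_def abs_minus_commute less_imp_le)
    qed
  qed
  then show ?thesis
    unfolding decaying_angle_def by (simp add: Cauchy_convergent_iff convergent_LIMSEQ_iff)
qed

lemma decaying_angle_approx:
  assumes a: "x0 \<le> a" "\<And>t. t \<ge> a \<Longrightarrow> \<Lambda> \<le> V t" and \<epsilon>: "0 < \<epsilon>" "\<epsilon> \<le> pi / 2"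
  obtains N where "\<And>n. n \<ge> N \<Longrightarrow> a \<le> x0 + real n"
    "\<And>n \<nu>. n \<ge> N \<Longrightarrow> \<nu> \<le> \<Lambda> \<Longrightarrow> \<bar>decaying_angle \<nu> a - trunc_angle n \<nu> a\<bar> \<le> \<epsilon>"
proof (rule trunc_angle_Cauchy[OF a \<epsilon>])
  fix N assume N: "\<And>n. n \<ge> N \<Longrightarrow> a \<le> x0 + real n"
    "\<And>n m \<nu>. n \<ge> N \<Longrightarrow> m \<ge> n \<Longrightarrow> \<nu> \<le> \<Lambda> \<Longrightarrow> \<bar>trunc_angle m \<nu> a - trunc_angle n \<nu> a\<bar> < \<epsilon>"
  show ?thesis
  proof (rule that[of N])
    fix n \<nu> assume n: "n \<ge> N" "\<nu> \<le> \<Lambda>"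
    have "(\<lambda>m. \<bar>trunc_angle m \<nu> a - trunc_angle n \<nu> a\<bar>) \<longlonglongrightarrow> \<bar>decaying_angle \<nu> a - trunc_angle n \<nu> a\<bar>"
      by (intro tendsto_intros trunc_angle_tendsto_far) (use a n in \<open>auto intro: order_trans\<close>)
    then show "\<bar>decaying_angle \<nu> a - trunc_angle n \<nu> a\<bar> \<le> \<epsilon>"
      by (rule LIMSEQ_le_const2) (use N(2)[OF n(1) _ n(2)] in \<open>auto intro!: exI[of _ n] less_imp_le\<close>)
  qed (use N in auto)
qed

text \<open>Convergence is known at a far point \<open>a\<close>. Stability with
  \<open>\<eta> = 0\<close> transports it to the left, and the limit is identified with the solution
  \<open>\<theta>\<close> that starts from the limiting value at \<open>a\<close>; so the limit
  satisfies the angle equation and \<open>lim\<close> in \<open>decaying_angle\<close> is a true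
  limit.\<close>

lemma trunc_angle_tendsto: "t \<ge> x0 \<Longrightarrow> (\<lambda>n. trunc_angle n \<nu> t) \<longlonglongrightarrow> decaying_angle \<nu> t"
  and decaying_angle: "prufer_angle (\<lambda>t. V t - \<nu>) x0 b (decaying_angle \<nu>)"
proof -
  have *: "(\<forall>t\<in>{x0..b}. (\<lambda>n. trunc_angle n \<nu> t) \<longlonglongrightarrow> decaying_angle \<nu> t) \<and>
      prufer_angle (\<lambda>t. V t - \<nu>) x0 b (decaying_angle \<nu>)" for b
  proof -
    obtain a0 where a0: "a0 \<ge> x0" "\<And>t. t \<ge> a0 \<Longrightarrow> \<nu> \<le> V t" using V_at_top by blast
    define a where "a = max a0 b"
    have a: "x0 \<le> a" "\<And>t. t \<ge> a \<Longrightarrow> \<nu> \<le> V t" "b \<le> a" using a0 by (auto simp: a_def)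
    obtain M where M: "M \<ge> 0" "\<And>t \<nu>. t \<in> {x0..a} \<Longrightarrow> \<bar>V t - \<nu>\<bar> \<le> M + \<bar>\<nu>\<bar>"
      using q_bound by blast
    obtain \<theta> where \<theta>: "prufer_angle (\<lambda>t. V t - \<nu>) x0 a \<theta>" "\<theta> a = decaying_angle \<nu> a"
      using prufer_angle_exists[OF a(1) q_integrable M(2)] by blast
    define K where "K = exp ((2 * (M + \<bar>\<nu>\<bar>) + 3) * (a - x0))"
    have lim: "(\<lambda>n. trunc_angle n \<nu> t) \<longlonglongrightarrow> \<theta> t" if t: "t \<in> {x0..a}" for t
    proof -
      obtain N where N: "real N \<ge> a - x0" using real_arch_simple by blast
      have "(\<theta> t - trunc_angle n \<nu> t)\<^sup>2 \<le> (decaying_angle \<nu> a - trunc_angle n \<nu> a)\<^sup>2 * K" if "n \<ge> N" for n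
      proof -
        have "a \<le> x0 + real n" using N that by (smt (verit) of_nat_mono)
        then show ?thesis
          using prufer_angle_stability[OF prufer_angle_subinterval[OF trunc_angle[of \<nu> n], of x0 a] \<theta>(1),
              of "M + \<bar>\<nu>\<bar>" 0 t] M t \<theta>(2) by (simp add: K_def)
      qed
      then have ev: "\<forall>\<^sub>F n in sequentially. norm ((\<theta> t - trunc_angle n \<nu> t)\<^sup>2) \<le>
          (decaying_angle \<nu> a - trunc_angle n \<nu> a)\<^sup>2 * K"
        by (auto simp: eventually_sequentially)
      have "(\<lambda>n. (decaying_angle \<nu> a - trunc_angle n \<nu> a)\<^sup>2 * K) \<longlonglongrightarrow> (decaying_angle \<nu> a - decaying_angle \<nu> a)\<^sup>2 * K"
        by (intro tendsto_intros trunc_angle_tendsto_far a)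
      then have "(\<lambda>n. (\<theta> t - trunc_angle n \<nu> t)\<^sup>2) \<longlonglongrightarrow> 0"
        by (intro Lim_null_comparison[OF ev]) simp
      then have "(\<lambda>n. sqrt ((\<theta> t - trunc_angle n \<nu> t)\<^sup>2)) \<longlonglongrightarrow> sqrt 0" by (rule tendsto_real_sqrt)
      then have "(\<lambda>n. \<theta> t - trunc_angle n \<nu> t) \<longlonglongrightarrow> 0" by (simp add: tendsto_rabs_zero_iff)
      then have "(\<lambda>n. trunc_angle n \<nu> t - \<theta> t) \<longlonglongrightarrow> 0"
        using tendsto_minus by fastforce
      then show ?thesis by (rule LIM_zero_cancel)
    qed
    then have eq: "decaying_angle \<nu> t = \<theta> t" if "t \<in> {x0..a}" for t
      using that by (simp add: decaying_angle_def limI)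
    have "prufer_angle (\<lambda>t. V t - \<nu>) x0 a (decaying_angle \<nu>)"
      using \<theta>(1) unfolding prufer_angle_def by (rule primitive_on_cong) (auto simp: eq)
    then show ?thesis
      using lim eq a(3) by (auto intro: prufer_angle_subinterval)
  qed
  show "t \<ge> x0 \<Longrightarrow> (\<lambda>n. trunc_angle n \<nu> t) \<longlonglongrightarrow> decaying_angle \<nu> t" using *[of t] by auto
  show "prufer_angle (\<lambda>t. V t - \<nu>) x0 b (decaying_angle \<nu>)" using * by blast
qed

lemma decaying_angle_ge: "x0 \<le> t \<Longrightarrow> - pi / 2 \<le> decaying_angle \<nu> t"
proof (rule LIMSEQ_le_const[OF trunc_angle_tendsto])
  obtain N where N: "real N \<ge> t - x0" using real_arch_simple by blast
  then show "\<exists>N. \<forall>n\<ge>N. - pi / 2 \<le> trunc_angle n \<nu> t" if "x0 \<le> t"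
    using that by (intro exI[of _ N] allI impI trunc_angle_ge) (auto intro: order_trans)
qed

lemma decaying_angle_le_0:
  assumes "x0 \<le> a" "\<And>t. t \<ge> a \<Longrightarrow> \<nu> \<le> V t" "t \<ge> a"
  shows "decaying_angle \<nu> t \<le> 0"
proof (rule LIMSEQ_le_const2[OF trunc_angle_tendsto])
  obtain N where N: "real N \<ge> t - x0" using real_arch_simple by blast
  have "trunc_angle n \<nu> t \<le> 0" if "n \<ge> N" for n
  proof (rule trunc_angle_le_0[OF assms(1,2)])
    have "real n \<ge> real N" using that by simp
    then show "t \<in> {a..x0 + real n}" using N assms by auto
  qed
  then show "\<exists>N. \<forall>n\<ge>N. trunc_angle n \<nu> t \<le> 0" by blast
qed (use assms in auto)

lemma decaying_angle_mono:
  assumes "\<nu> \<le> \<mu>" "x0 \<le> t"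
  shows "decaying_angle \<nu> t \<le> decaying_angle \<mu> t"
proof (rule LIMSEQ_le[OF trunc_angle_tendsto trunc_angle_tendsto])
  obtain N where N: "real N \<ge> t - x0" using real_arch_simple by blast
  have "trunc_angle n \<nu> t \<le> trunc_angle n \<mu> t" if "n \<ge> N" for n
  proof (rule trunc_angle_mono[OF assms(1)])
    have "real n \<ge> real N" using that by simp
    then show "t \<in> {x0..x0 + real n}" using N assms by auto
  qed
  then show "\<exists>N. \<forall>n\<ge>N. trunc_angle n \<nu> t \<le> trunc_angle n \<mu> t" by blast
qed (use assms in auto)

text \<open>If the angles agreed at \<open>x0\<close>, the difference, which is nonnegative, would
  vanish on a whole interval by a forward Gronwall estimate. Subtracting the two equations then
  leaves \<open>(\<nu> - \<mu>) * (cos (\<theta> t))\<^sup>2 = 0\<close> there, so the cosine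
  vanishes identically although the angle moves.\<close>

lemma decaying_angle_strict_mono:
  assumes "\<nu> < \<mu>"
  shows "decaying_angle \<nu> x0 < decaying_angle \<mu> x0"
proof (rule ccontr)
  assume "\<not> decaying_angle \<nu> x0 < decaying_angle \<mu> x0"
  then have eq0: "decaying_angle \<mu> x0 - decaying_angle \<nu> x0 = 0"
    using decaying_angle_mono[of \<nu> \<mu> x0] assms by simp
  define b where "b = x0 + 1"
  define \<delta> where "\<delta> = (\<lambda>t. decaying_angle \<mu> t - decaying_angle \<nu> t)"
  define e where "e = (\<lambda>t. (V t - \<mu> - (V t - \<nu>)) * (cos (decaying_angle \<mu> t))\<^sup>2 +
    (V t - \<nu> + 1) * ((cos (decaying_angle \<mu> t))\<^sup>2 - (cos (decaying_angle \<nu> t))\<^sup>2))"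
  have P: "primitive_on x0 b e \<delta>"
    unfolding e_def \<delta>_def by (rule prufer_angle_difference[OF decaying_angle decaying_angle])
  obtain M where M: "M \<ge> 0" "\<And>t \<nu>. t \<in> {x0..b} \<Longrightarrow> \<bar>V t - \<nu>\<bar> \<le> M + \<bar>\<nu>\<bar>"
    using q_bound by blast
  define L where "L = M + \<bar>\<nu>\<bar> + 1"
  have \<delta>_ge: "\<delta> t \<ge> 0" if "t \<in> {x0..b}" for t
    using decaying_angle_mono[of \<nu> \<mu> t] assms that by (simp add: \<delta>_def)
  have e_le: "e t \<le> L * \<delta> t" if t: "t \<in> {x0..b}" for t
  proof -
    have "(V t - \<mu> - (V t - \<nu>)) * (cos (decaying_angle \<mu> t))\<^sup>2 \<le> 0"
      using assms by (intro mult_nonpos_nonneg) auto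
    moreover have "\<bar>(V t - \<nu> + 1) * ((cos (decaying_angle \<mu> t))\<^sup>2 - (cos (decaying_angle \<nu> t))\<^sup>2)\<bar>
        \<le> L * \<bar>decaying_angle \<mu> t - decaying_angle \<nu> t\<bar>"
      unfolding abs_mult using M(2)[OF t, of \<nu>] by (intro mult_mono cos_square_lipschitz) (auto simp: L_def)
    ultimately show ?thesis using \<delta>_ge[OF t] unfolding e_def \<delta>_def by (simp add: abs_le_iff)
  qed
  have P2: "primitive_on x0 b (\<lambda>t. - (e t * exp (- L * t) + \<delta> t * (- L * exp (- L * t)))) (\<lambda>t. - (\<delta> t * exp (- L * t)))"
    by (intro primitive_on_minus primitive_on_mult P primitive_on_exp_linear)
  have \<delta>0: "\<delta> t = 0" if t: "t \<in> {x0..b}" for t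
  proof -
    have "- (\<delta> x0 * exp (- L * x0)) \<le> - (\<delta> t * exp (- L * t))"
    proof (rule primitive_on_mono[OF P2])
      fix s assume "s \<in> {x0..b}"
      then have "(e s - L * \<delta> s) * exp (- L * s) \<le> 0"
        using e_le by (intro mult_nonpos_nonneg) auto
      then show "0 \<le> - (e s * exp (- L * s) + \<delta> s * (- L * exp (- L * s)))" by (simp add: algebra_simps)
    qed (use t in auto)
    moreover have "\<delta> x0 = 0" using eq0 by (simp add: \<delta>_def)
    ultimately have "\<delta> t \<le> 0" by (simp add: mult_le_0_iff)
    then show ?thesis using \<delta>_ge[OF t] by simp
  qed
  define \<theta> where "\<theta> = decaying_angle \<mu>"
  have \<theta>: "prufer_angle (\<lambda>t. V t - \<mu>) x0 b \<theta>" unfolding \<theta>_def by (rule decaying_angle)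
  have "e t = (\<nu> - \<mu>) * (cos (\<theta> t))\<^sup>2" if "t \<in> {x0..b}" for t
    using \<delta>0[OF that] by (simp add: e_def \<delta>_def \<theta>_def)
  then have "primitive_on x0 b (\<lambda>t. (\<nu> - \<mu>) * (cos (\<theta> t))\<^sup>2) (\<lambda>t. 0)"
    by (intro primitive_on_cong[OF P]) (auto simp: \<delta>0)
  then have "primitive_on x0 b (\<lambda>t. 1 / (\<nu> - \<mu>) * ((\<nu> - \<mu>) * (cos (\<theta> t))\<^sup>2)) (\<lambda>t. 1 / (\<nu> - \<mu>) * 0)"
    by (rule primitive_on_cmult)
  then have "primitive_on x0 b (\<lambda>t. (cos (\<theta> t))\<^sup>2) (\<lambda>t. 0)"
    using assms by simp
  then have "((\<lambda>t. (cos (\<theta> t))\<^sup>2) has_integral 0) {x0..b}"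
    using primitive_on_has_integral[of x0 b _ _ x0 b] by (fastforce simp: b_def)
  moreover have "continuous_on {x0..b} (\<lambda>t. (cos (\<theta> t))\<^sup>2)"
    using \<theta> unfolding prufer_angle_def by (intro continuous_intros primitive_on_continuous)
  ultimately have cos0: "cos (\<theta> t) = 0" if "t \<in> {x0..b}" for t
    using has_integral_0_cbox_imp_0[of x0 b "\<lambda>t. (cos (\<theta> t))\<^sup>2" t] that
    by (auto simp: b_def)
  \<comment> \<open>With vanishing cosine the equation reads \<open>\<theta>' = -1\<close>, so the
    angle drops by exactly 1 over the unit interval; but zeros of the cosine differ by multiples of
    pi.\<close>
  have "primitive_on x0 b (\<lambda>t. -1) \<theta>"
    using \<theta> unfolding prufer_angle_def
    by (rule primitive_on_cong) (use cos0 in \<open>auto simp: sin_squared_eq\<close>)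
  then have "((\<lambda>t. -1) has_integral \<theta> b - \<theta> x0) {x0..b}"
    by (rule primitive_on_has_integral) (auto simp: b_def)
  moreover have "((\<lambda>t. -1) has_integral (b - x0) * (-1)) {x0..b}"
    using has_integral_const_real[of "-1::real" x0 b] by (simp add: b_def)
  ultimately have "\<theta> b - \<theta> x0 = (b - x0) * (-1)" by (rule has_integral_unique)
  then have "\<theta> b = \<theta> x0 - 1" by (simp add: b_def)
  then have "cos (\<theta> b) = cos (\<theta> x0 - 1)" by simp
  then have "sin (\<theta> x0) * sin 1 = 0" using cos0[of x0] cos0[of b] by (simp add: cos_diff b_def)
  moreover have "sin (1::real) > 0" using pi_gt3 by (intro sin_gt_zero) auto
  ultimately have "sin (\<theta> x0) = 0" by simp
  then show False using cos0[of x0] sin_cos_squared_add[of "\<theta> x0"] by (simp add: b_def)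
qed

text \<open>All these angles share the end value \<open>- pi / 2\<close>, so stability gives a
  Lipschitz bound in \<open>\<nu>\<close>.\<close>

lemma continuous_on_trunc_angle: "continuous_on {\<Lambda>0..\<Lambda>} (\<lambda>\<nu>. trunc_angle n \<nu> x0)"
proof -
  obtain M where M: "M \<ge> 0" "\<And>t \<nu>. t \<in> {x0..x0 + real n} \<Longrightarrow> \<bar>V t - \<nu>\<bar> \<le> M + \<bar>\<nu>\<bar>"
    using q_bound by blast
  define K where "K = M + \<bar>\<Lambda>0\<bar> + \<bar>\<Lambda>\<bar>"
  define C where "C = sqrt (real n * exp ((2 * K + 3) * real n))"
  have "C-lipschitz_on {\<Lambda>0..\<Lambda>} (\<lambda>\<nu>. trunc_angle n \<nu> x0)"
    unfolding lipschitz_on_def dist_real_def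
  proof (intro conjI ballI)
    fix \<nu> \<mu> assume l: "\<nu> \<in> {\<Lambda>0..\<Lambda>}" "\<mu> \<in> {\<Lambda>0..\<Lambda>}"
    have "(trunc_angle n \<nu> x0 - trunc_angle n \<mu> x0)\<^sup>2 \<le>
      ((trunc_angle n \<nu> (x0 + real n) - trunc_angle n \<mu> (x0 + real n))\<^sup>2 + \<bar>\<nu> - \<mu>\<bar>\<^sup>2 * (x0 + real n - x0))
        * exp ((2 * K + 3) * (x0 + real n - x0))"
    proof (rule prufer_angle_stability[OF trunc_angle trunc_angle])
      show "\<bar>V t - \<mu>\<bar> \<le> K" if "t \<in> {x0..x0 + real n}" for t
        using M(2)[OF that, of \<mu>] l by (auto simp: K_def)
    qed (use M l in \<open>auto simp: K_def\<close>)
    also have "\<dots> = (C * \<bar>\<nu> - \<mu>\<bar>)\<^sup>2"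
      by (simp add: trunc_angle_end C_def power_mult_distrib)
    finally show "\<bar>trunc_angle n \<nu> x0 - trunc_angle n \<mu> x0\<bar> \<le> C * \<bar>\<nu> - \<mu>\<bar>"
      by (subst (asm) abs_le_square_iff[symmetric]) (auto simp: C_def abs_mult)
  qed (auto simp: C_def)
  then show ?thesis by (rule lipschitz_on_continuous_on)
qed

text \<open>A uniform limit of continuous functions: the approximation at a far point is uniform for
  \<open>\<nu> \<le> \<Lambda>\<close>, and stability back to \<open>x0\<close> loses a factor that
  is common to the whole parameter interval.\<close>

lemma continuous_on_decaying_angle: "continuous_on {\<Lambda>0..\<Lambda>} (\<lambda>\<nu>. decaying_angle \<nu> x0)"
proof (rule uniform_limit_theorem[where F=sequentially and f="\<lambda>n \<nu>. trunc_angle n \<nu> x0"])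
  obtain a where a: "x0 \<le> a" "\<And>t. t \<ge> a \<Longrightarrow> \<Lambda> \<le> V t" using V_at_top by blast
  obtain M where M: "M \<ge> 0" "\<And>t \<nu>. t \<in> {x0..a} \<Longrightarrow> \<bar>V t - \<nu>\<bar> \<le> M + \<bar>\<nu>\<bar>"
    using q_bound by blast
  define K where "K = M + \<bar>\<Lambda>0\<bar> + \<bar>\<Lambda>\<bar>"
  define E where "E = exp ((2 * K + 3) * (a - x0))"
  have E: "E \<ge> 1" using M a by (simp add: E_def K_def)
  show "uniform_limit {\<Lambda>0..\<Lambda>} (\<lambda>n \<nu>. trunc_angle n \<nu> x0) (\<lambda>\<nu>. decaying_angle \<nu> x0) sequentially"
    unfolding uniform_limit_sequentially_iff
  proof (intro allI impI)
    fix e :: real assume e: "e > 0"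
    \<comment> \<open>The contraction estimate requires \<open>\<epsilon> \<le> pi / 2\<close>; the
      other bound absorbs the stability loss, whose root is at most \<open>E\<close> because
      \<open>E \<ge> 1\<close>.\<close>
    define \<epsilon> where "\<epsilon> = min (pi / 2) (e / (2 * E))"
    have \<epsilon>: "0 < \<epsilon>" "\<epsilon> \<le> pi / 2" "\<epsilon> * E < e"
    proof -
      show "0 < \<epsilon>" "\<epsilon> \<le> pi / 2" using e E by (auto simp: \<epsilon>_def)
      have "\<epsilon> * E \<le> e / (2 * E) * E" using E by (intro mult_right_mono) (auto simp: \<epsilon>_def)
      also have "\<dots> < e" using E e by simp
      finally show "\<epsilon> * E < e" .
    qed
    show "\<exists>N. \<forall>n\<ge>N. \<forall>\<nu>\<in>{\<Lambda>0..\<Lambda>}. dist (trunc_angle n \<nu> x0) (decaying_angle \<nu> x0) < e"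
    proof (rule decaying_angle_approx[OF a \<epsilon>(1,2)])
      fix N assume N: "\<And>n. n \<ge> N \<Longrightarrow> a \<le> x0 + real n"
        "\<And>n \<nu>. n \<ge> N \<Longrightarrow> \<nu> \<le> \<Lambda> \<Longrightarrow> \<bar>decaying_angle \<nu> a - trunc_angle n \<nu> a\<bar> \<le> \<epsilon>"
      have "dist (trunc_angle n \<nu> x0) (decaying_angle \<nu> x0) < e" if n: "n \<ge> N" and l: "\<nu> \<in> {\<Lambda>0..\<Lambda>}" for n \<nu>
      proof -
        have "(trunc_angle n \<nu> x0 - decaying_angle \<nu> x0)\<^sup>2 \<le>
          ((trunc_angle n \<nu> a - decaying_angle \<nu> a)\<^sup>2 + 0\<^sup>2 * (a - x0)) * exp ((2 * K + 3) * (a - x0))"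
        proof (rule prufer_angle_stability[OF decaying_angle prufer_angle_subinterval[OF trunc_angle]])
          show "\<bar>V t - \<nu>\<bar> \<le> K" if "t \<in> {x0..a}" for t
            using M(2)[OF that, of \<nu>] l by (auto simp: K_def)
        qed (use M l N(1)[OF n] a in \<open>auto simp: K_def\<close>)
        also have "\<dots> = (trunc_angle n \<nu> a - decaying_angle \<nu> a)\<^sup>2 * E" by (simp add: E_def)
        also have "\<dots> \<le> \<epsilon>\<^sup>2 * E\<^sup>2"
        proof (rule mult_mono)
          show "(trunc_angle n \<nu> a - decaying_angle \<nu> a)\<^sup>2 \<le> \<epsilon>\<^sup>2"
            using N(2)[OF n, of \<nu>] l \<epsilon> by (subst abs_le_square_iff[symmetric]) auto
          show "E \<le> E\<^sup>2" using E by (simp add: power2_eq_square)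
        qed (use E in auto)
        also have "\<dots> = (\<epsilon> * E)\<^sup>2" by (simp add: power_mult_distrib)
        finally have "\<bar>trunc_angle n \<nu> x0 - decaying_angle \<nu> x0\<bar> \<le> \<bar>\<epsilon> * E\<bar>"
          by (subst (asm) abs_le_square_iff[symmetric])
        then show ?thesis using \<epsilon> E by (simp add: dist_real_def)
      qed
      then show ?thesis by blast
    qed
  qed
qed (use continuous_on_trunc_angle in auto)

end

subsection \<open>Eigenvalues as levels of the decaying angle\<close>

text \<open>The equation \<open>u'' = q * u\<close> as a first-order system with
  \<open>v = u'\<close>, so that both components fit \<open>primitive_on\<close>.\<close>

definition solves_from :: "(real \<Rightarrow> real) \<Rightarrow> real \<Rightarrow> (real \<Rightarrow> real) \<Rightarrow> (real \<Rightarrow> real) \<Rightarrow> bool" where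
  "solves_from q x0 u v \<longleftrightarrow> (\<forall>b. primitive_on x0 b v u \<and> primitive_on x0 b (\<lambda>t. q t * u t) v)"

lemma solves_fromD:
  assumes "solves_from q x0 u v"
  shows "primitive_on x0 b v u" "primitive_on x0 b (\<lambda>t. q t * u t) v"
    "continuous_on {x0..b} u" "continuous_on {x0..b} v"
  using assms primitive_on_continuous unfolding solves_from_def by blast+

text \<open>Since \<open>(u * v)' = v\<^sup>2 + q * u\<^sup>2 \<ge> u\<^sup>2 + v\<^sup>2\<close>
  and the product is at most 0 at \<open>b\<close>, its value at \<open>a\<close> controls the
  integral uniformly in \<open>b\<close>. In particular the derivative \<open>v\<close> is
  controlled.\<close>

lemma solves_from_energy:
  assumes sol: "solves_from q x0 u v" and "x0 \<le> a" and q: "\<And>t. t \<ge> a \<Longrightarrow> q t \<ge> 1"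
    and neg: "\<And>t. t \<ge> a \<Longrightarrow> u t * v t \<le> 0" and "a \<le> b"
  shows "integral {a..b} (\<lambda>t. (u t)\<^sup>2 + (v t)\<^sup>2) \<le> - (u a * v a)"
proof -
  have P: "primitive_on x0 b (\<lambda>t. v t * v t + u t * (q t * u t)) (\<lambda>t. u t * v t)"
    by (intro primitive_on_mult solves_fromD[OF sol])
  have "continuous_on {a..b} u" "continuous_on {a..b} v"
    by (rule continuous_on_subset[OF solves_fromD(3)[OF sol, of b]],
        use \<open>x0 \<le> a\<close> in force, rule continuous_on_subset[OF solves_fromD(4)[OF sol, of b]],
        use \<open>x0 \<le> a\<close> in force)
  then have "(\<lambda>t. (u t)\<^sup>2 + (v t)\<^sup>2) integrable_on {a..b}"
    by (intro integrable_continuous_interval continuous_intros)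
  then have "integral {a..b} (\<lambda>t. (u t)\<^sup>2 + (v t)\<^sup>2) \<le> u b * v b - u a * v a"
  proof (rule has_integral_le[OF integrable_integral primitive_on_has_integral[OF P]])
    fix t assume "t \<in> {a..b}"
    then have "1 * (u t)\<^sup>2 \<le> q t * (u t)\<^sup>2" using q by (intro mult_right_mono) auto
    then show "(u t)\<^sup>2 + (v t)\<^sup>2 \<le> v t * v t + u t * (q t * u t)"
      by (simp add: power2_eq_square mult_ac)
  qed (use assms in auto)
  then show ?thesis using neg[of b] \<open>a \<le> b\<close> by simp
qed

text \<open>The product \<open>u * v\<close> is half the derivative of \<open>u\<^sup>2\<close> and
  is nondecreasing. If it were positive once, \<open>u\<^sup>2\<close> would grow at least linearly
  from there on, and its integral quadratically, past any bound \<open>K\<close>.\<close>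

lemma square_integrable_solution_decreasing:
  assumes sol: "solves_from q x0 u v" and "x0 \<le> a" and q: "\<And>t. t \<ge> a \<Longrightarrow> q t \<ge> 1"
    and L2: "\<And>b. integral {x0..b} (\<lambda>t. (u t)\<^sup>2) \<le> K" and t0: "t0 \<ge> a"
  shows "u t0 * v t0 \<le> 0"
proof (rule ccontr)
  define g where "g = u t0 * v t0"
  assume "\<not> u t0 * v t0 \<le> 0"
  then have g: "g > 0" by (simp add: g_def)
  have g_le: "g \<le> u t * v t" if t: "t \<ge> t0" for t
    unfolding g_def
  proof (rule primitive_on_mono[where a=a and b=t and F="\<lambda>t. u t * v t"])
    show "primitive_on a t (\<lambda>t. v t * v t + u t * (q t * u t)) (\<lambda>t. u t * v t)"
      by (rule primitive_on_subinterval[of x0 t])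
        (use \<open>x0 \<le> a\<close> in \<open>auto intro!: primitive_on_mult solves_fromD[OF sol]\<close>)
    fix s assume "s \<in> {a..t}"
    then have "0 \<le> q s * (u s)\<^sup>2" using q[of s] by (intro mult_nonneg_nonneg) auto
    then show "0 \<le> v s * v s + u s * (q s * u s)" by (simp add: power2_eq_square mult_ac)
  qed (use t t0 in auto)
  have u_ge: "2 * g * (t - t0) \<le> (u t)\<^sup>2" if t: "t \<ge> t0" for t
  proof -
    have P1: "primitive_on t0 t (\<lambda>t. 2 * u t * v t) (\<lambda>t. (u t)\<^sup>2)"
      by (rule primitive_on_subinterval[of x0 t])
        (use \<open>x0 \<le> a\<close> t0 in \<open>auto intro!: primitive_on_square solves_fromD[OF sol]\<close>)
    have P2: "primitive_on t0 t (\<lambda>t. 2 * g) (\<lambda>t. 2 * g * t)"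
      by (rule primitive_on_C1) (auto intro!: derivative_eq_intros)
    have "2 * g * t - 2 * g * t0 \<le> (u t)\<^sup>2 - (u t0)\<^sup>2"
      by (rule primitive_on_mono_diff[OF P2 P1]) (use g_le t in auto)
    then show ?thesis
      using zero_le_power2[of "u t0"] right_diff_distrib[of "2 * g" t t0] by linarith
  qed
  have bound: "g * (b - t0)\<^sup>2 \<le> K" if b: "b \<ge> t0" for b
  proof -
    have cu: "continuous_on {x0..b} (\<lambda>t. (u t)\<^sup>2)"
      by (intro continuous_intros solves_fromD[OF sol])
    have "((\<lambda>t. 2 * g * (t - t0)) has_integral g * (b - t0)\<^sup>2 - g * (t0 - t0)\<^sup>2) {t0..b}"
      using b by (intro fundamental_theorem_of_calculus)
        (auto intro!: derivative_eq_intros simp flip: has_real_derivative_iff_has_vector_derivative)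
    then have "g * (b - t0)\<^sup>2 - g * (t0 - t0)\<^sup>2 \<le> integral {t0..b} (\<lambda>t. (u t)\<^sup>2)"
    proof (rule has_integral_le[OF _ integrable_integral])
      show "(\<lambda>t. (u t)\<^sup>2) integrable_on {t0..b}"
        by (rule integrable_continuous_interval, rule continuous_on_subset[OF cu])
          (use t0 \<open>x0 \<le> a\<close> in auto)
    qed (use u_ge in auto)
    also have "\<dots> \<le> integral {x0..b} (\<lambda>t. (u t)\<^sup>2)"
      by (rule integral_subset_le) (use t0 \<open>x0 \<le> a\<close> cu in
          \<open>auto intro!: integrable_continuous_interval intro: continuous_on_subset\<close>)
    also have "\<dots> \<le> K" by (rule L2)
    finally show ?thesis by simp
  qed
  \<comment> \<open>With \<open>s \<ge> 1\<close> this gives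
    \<open>g * s\<^sup>2 \<ge> g * s = g + \<bar>K\<bar> > K\<close>.\<close>
  define s where "s = 1 + \<bar>K\<bar> / g"
  have s: "s \<ge> 1" using g by (simp add: s_def)
  have "\<bar>K\<bar> < g * s" using g by (simp add: s_def algebra_simps)
  also have "\<dots> \<le> g * s\<^sup>2" using s g by (intro mult_left_mono) (auto simp: power2_eq_square)
  also have "\<dots> \<le> K" using bound[of "t0 + s"] s by simp
  finally show False by simp
qed

text \<open>The Wronskian is constant, and it is integrable near infinity because the derivatives of
  square-integrable solutions are square-integrable there.\<close>

lemma square_integrable_solutions_dependent:
  assumes u: "solves_from q x0 u1 v1" "\<And>b. integral {x0..b} (\<lambda>t. (u1 t)\<^sup>2) \<le> K1"
    and w: "solves_from q x0 u2 v2" "\<And>b. integral {x0..b} (\<lambda>t. (u2 t)\<^sup>2) \<le> K2"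
    and a: "x0 \<le> a" and q: "\<And>t. t \<ge> a \<Longrightarrow> q t \<ge> 1"
  shows "u1 x0 * v2 x0 = v1 x0 * u2 x0"
proof (rule ccontr)
  define c where "c = u1 x0 * v2 x0 - v1 x0 * u2 x0"
  assume "u1 x0 * v2 x0 \<noteq> v1 x0 * u2 x0"
  then have c: "\<bar>c\<bar> > 0" by (simp add: c_def)
  have wronskian: "u1 t * v2 t - v1 t * u2 t = c" if t: "t \<ge> x0" for t
  proof -
    have "primitive_on x0 t (\<lambda>t. v1 t * v2 t + u1 t * (q t * u2 t) - (q t * u1 t * u2 t + v1 t * v2 t))
        (\<lambda>t. u1 t * v2 t - v1 t * u2 t)"
      by (intro primitive_on_diff primitive_on_mult solves_fromD[OF u(1)] solves_fromD[OF w(1)])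
    then have "((\<lambda>t. v1 t * v2 t + u1 t * (q t * u2 t) - (q t * u1 t * u2 t + v1 t * v2 t)) has_integral
        u1 t * v2 t - v1 t * u2 t - (u1 x0 * v2 x0 - v1 x0 * u2 x0)) {x0..t}"
      by (rule primitive_on_has_integral) (use t in auto)
    then have "((\<lambda>t. 0) has_integral u1 t * v2 t - v1 t * u2 t - c) {x0..t}"
      unfolding c_def by (rule has_integral_eq[rotated]) (simp add: algebra_simps)
    then show ?thesis by simp
  qed
  define K where "K = \<bar>u1 a * v1 a\<bar> + \<bar>u2 a * v2 a\<bar>"
  have bound: "\<bar>c\<bar> * (b - a) \<le> K" if b: "b \<ge> a" for b
  proof -
    have neg: "u1 t * v1 t \<le> 0" "u2 t * v2 t \<le> 0" if "t \<ge> a" for t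
      using square_integrable_solution_decreasing[OF u(1) a q u(2)]
        square_integrable_solution_decreasing[OF w(1) a q w(2)] that by auto
    have "{a..b} \<subseteq> {x0..b}" using a by auto
    then have cont: "continuous_on {a..b} u1" "continuous_on {a..b} v1" "continuous_on {a..b} u2" "continuous_on {a..b} v2"
      using continuous_on_subset solves_fromD(3,4)[OF u(1)] solves_fromD(3,4)[OF w(1)] by blast+
    have i1: "(\<lambda>t. (u1 t)\<^sup>2 + (v1 t)\<^sup>2) integrable_on {a..b}"
      and i2: "(\<lambda>t. (u2 t)\<^sup>2 + (v2 t)\<^sup>2) integrable_on {a..b}"
      by (intro integrable_continuous_interval continuous_intros cont)+
    have "((\<lambda>t. \<bar>c\<bar>) has_integral \<bar>c\<bar> * (b - a)) {a..b}"
      using has_integral_const_real[of "\<bar>c\<bar>" a b] b by (simp add: mult.commute)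
    then have "\<bar>c\<bar> * (b - a) \<le> integral {a..b} (\<lambda>t. (u1 t)\<^sup>2 + (v1 t)\<^sup>2) + integral {a..b} (\<lambda>t. (u2 t)\<^sup>2 + (v2 t)\<^sup>2)"
    proof (rule has_integral_le[OF _ has_integral_add[OF integrable_integral[OF i1] integrable_integral[OF i2]]])
      fix t assume t: "t \<in> {a..b}"
      have *: "\<bar>x * y\<bar> \<le> x\<^sup>2 + y\<^sup>2" for x y :: real
      proof -
        have "2 * (\<bar>x\<bar> * \<bar>y\<bar>) \<le> x\<^sup>2 + y\<^sup>2" using sum_squares_bound[of "\<bar>x\<bar>" "\<bar>y\<bar>"] by simp
        moreover have "0 \<le> \<bar>x\<bar> * \<bar>y\<bar>" by simp
        ultimately show ?thesis unfolding abs_mult by linarith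
      qed
      have "\<bar>c\<bar> \<le> \<bar>u1 t * v2 t\<bar> + \<bar>v1 t * u2 t\<bar>"
      proof -
        have "c = u1 t * v2 t - v1 t * u2 t" using wronskian[of t] t a by simp
        then show ?thesis by simp
      qed
      also have "\<dots> \<le> ((u1 t)\<^sup>2 + (v2 t)\<^sup>2) + ((v1 t)\<^sup>2 + (u2 t)\<^sup>2)" by (intro add_mono *)
      finally show "\<bar>c\<bar> \<le> (u1 t)\<^sup>2 + (v1 t)\<^sup>2 + ((u2 t)\<^sup>2 + (v2 t)\<^sup>2)" by simp
    qed
    also have "\<dots> \<le> - (u1 a * v1 a) + - (u2 a * v2 a)"
      by (intro add_mono solves_from_energy[OF u(1) a q] solves_from_energy[OF w(1) a q] neg b)
    also have "\<dots> \<le> K" by (simp add: K_def)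
    finally show ?thesis .
  qed
  have "\<bar>c\<bar> * ((K + 1) / \<bar>c\<bar>) \<le> K"
    using bound[of "a + (K + 1) / \<bar>c\<bar>"] c by (simp add: K_def)
  then show False using c by simp
qed

text \<open>Forward Gronwall: the derivative of \<open>u\<^sup>2 + v\<^sup>2\<close> is
  \<open>2 * u * v * (1 + q)\<close>, at most
  \<open>(1 + M) * (u\<^sup>2 + v\<^sup>2)\<close>.\<close>

lemma solves_from_zero:
  assumes sol: "solves_from q x0 u v" and q: "\<And>b. \<exists>M. \<forall>t\<in>{x0..b}. \<bar>q t\<bar> \<le> M"
    and "u x0 = 0" "v x0 = 0" "t \<ge> x0"
  shows "u t = 0"
proof -
  obtain M where M: "\<And>t'. t' \<in> {x0..t} \<Longrightarrow> \<bar>q t'\<bar> \<le> M" using q by meson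
  define k where "k = 1 + M"
  have P: "primitive_on x0 t (\<lambda>t. - ((2 * u t * v t + 2 * v t * (q t * u t)) * exp (- k * t) +
      ((u t)\<^sup>2 + (v t)\<^sup>2) * (- k * exp (- k * t)))) (\<lambda>t. - (((u t)\<^sup>2 + (v t)\<^sup>2) * exp (- k * t)))"
    by (intro primitive_on_minus primitive_on_mult primitive_on_exp_linear primitive_on_add primitive_on_square solves_fromD[OF sol])
  have "- (((u x0)\<^sup>2 + (v x0)\<^sup>2) * exp (- k * x0)) \<le> - (((u t)\<^sup>2 + (v t)\<^sup>2) * exp (- k * t))"
  proof (rule primitive_on_mono[OF P])
    fix s assume s: "s \<in> {x0..t}"
    have "2 * u s * v s + 2 * v s * (q s * u s) = (2 * u s * v s) * (1 + q s)" by (simp add: algebra_simps)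
    also have "\<dots> \<le> \<bar>2 * u s * v s\<bar> * \<bar>1 + q s\<bar>" 
      using abs_ge_self[of "2 * u s * v s * (1 + q s)"] by (simp only: abs_mult[of _ "1 + q s"])
    also have "\<dots> \<le> ((u s)\<^sup>2 + (v s)\<^sup>2) * k"
      using M[OF s] sum_squares_bound[of "\<bar>u s\<bar>" "\<bar>v s\<bar>"]
      by (intro mult_mono) (auto simp: k_def abs_mult)
    finally have "(2 * u s * v s + 2 * v s * (q s * u s) - ((u s)\<^sup>2 + (v s)\<^sup>2) * k) * exp (- k * s) \<le> 0"
      by (intro mult_nonpos_nonneg) auto
    then show "0 \<le> - ((2 * u s * v s + 2 * v s * (q s * u s)) * exp (- k * s) +
      ((u s)\<^sup>2 + (v s)\<^sup>2) * (- k * exp (- k * s)))" by (simp add: algebra_simps)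
  qed (use assms in auto)
  then have "(u t)\<^sup>2 + (v t)\<^sup>2 \<le> 0" using assms by (simp add: mult_le_0_iff)
  then show ?thesis by (simp add: sum_power2_le_zero_iff)
qed

text \<open>Once the angle is known, the amplitude obeys the scalar linear equation
  \<open>r' = r * sin \<theta> * cos \<theta> * (q + 1)\<close> and is an exponential, hence
  positive.\<close>

lemma prufer_angle_solves:
  assumes \<theta>: "\<And>b. prufer_angle q x0 b \<theta>"
    and q: "\<And>b. q integrable_on {x0..b}" "\<And>b. \<exists>M. \<forall>t\<in>{x0..b}. \<bar>q t\<bar> \<le> M"
  obtains r where "solves_from q x0 (\<lambda>t. r t * cos (\<theta> t)) (\<lambda>t. r t * sin (\<theta> t))" "r x0 = 1" "\<And>t. r t > 0"
proof -
  define h where "h = (\<lambda>t. sin (\<theta> t) * cos (\<theta> t) * (q t + 1))"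
  define r where "r = (\<lambda>t. exp (integral {x0..t} h))"
  \<comment> \<open>The factor \<open>C\<^sup>2 + S\<^sup>2\<close> is left standing: in this form
    both are polynomial identities, and it becomes 1 when \<open>S\<close> and \<open>C\<close> are
    a sine and a cosine.\<close>
  have alg1: "R * (S * C * (Q + 1)) * C + R * (- S * (Q * C\<^sup>2 - S\<^sup>2)) = R * S * (C\<^sup>2 + S\<^sup>2)"
    and alg2: "R * (S * C * (Q + 1)) * S + R * (C * (Q * C\<^sup>2 - S\<^sup>2)) = Q * (R * C) * (C\<^sup>2 + S\<^sup>2)"
    for R S C Q :: real
    by (simp_all add: algebra_simps power2_eq_square)
  have "solves_from q x0 (\<lambda>t. r t * cos (\<theta> t)) (\<lambda>t. r t * sin (\<theta> t))"
    unfolding solves_from_def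
  proof
    fix b
    have P\<theta>: "primitive_on x0 b (\<lambda>t. q t * (cos (\<theta> t))\<^sup>2 - (sin (\<theta> t))\<^sup>2) \<theta>"
      using \<theta> by (simp add: prufer_angle_def)
    obtain M where M: "\<And>t. t \<in> {x0..b} \<Longrightarrow> \<bar>q t\<bar> \<le> M" using q(2) by meson
    have hb: "\<bar>h t\<bar> \<le> 1 * 1 * (M + 1)" if "t \<in> {x0..b}" for t
      unfolding h_def abs_mult using M[OF that] by (intro mult_mono) auto
    have "h integrable_on {x0..b}"
      unfolding h_def using M
      by (intro integrable_continuous_mult_bounded[where M="M + 1"] continuous_intros
          primitive_on_continuous[OF P\<theta>] integrable_add q integrable_const_ivl) fastforce
    then have "primitive_on x0 b h (\<lambda>t. integral {x0..t} h)"
      using hb by (intro primitive_onI_integral[where c=0]) auto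
    then have Pr: "primitive_on x0 b (\<lambda>t. r t * h t) r"
      unfolding r_def by (rule primitive_on_exp)
    have "primitive_on x0 b (\<lambda>t. r t * h t * cos (\<theta> t) +
        r t * (- sin (\<theta> t) * (q t * (cos (\<theta> t))\<^sup>2 - (sin (\<theta> t))\<^sup>2))) (\<lambda>t. r t * cos (\<theta> t))"
      by (intro primitive_on_mult Pr primitive_on_cos P\<theta>)
    then have "primitive_on x0 b (\<lambda>t. r t * sin (\<theta> t)) (\<lambda>t. r t * cos (\<theta> t))"
    proof (rule primitive_on_cong)
      fix t
      have "r t * h t * cos (\<theta> t) + r t * (- sin (\<theta> t) * (q t * (cos (\<theta> t))\<^sup>2 - (sin (\<theta> t))\<^sup>2))
          = r t * sin (\<theta> t) * ((cos (\<theta> t))\<^sup>2 + (sin (\<theta> t))\<^sup>2)"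
        unfolding h_def by (rule alg1)
      then show "r t * h t * cos (\<theta> t) + r t * (- sin (\<theta> t) * (q t * (cos (\<theta> t))\<^sup>2 - (sin (\<theta> t))\<^sup>2)) = r t * sin (\<theta> t)"
        by (simp only: sin_cos_squared_add2 mult_1_right)
    qed simp
    moreover have "primitive_on x0 b (\<lambda>t. r t * h t * sin (\<theta> t) +
        r t * (cos (\<theta> t) * (q t * (cos (\<theta> t))\<^sup>2 - (sin (\<theta> t))\<^sup>2))) (\<lambda>t. r t * sin (\<theta> t))"
      by (intro primitive_on_mult Pr primitive_on_sin P\<theta>)
    then have "primitive_on x0 b (\<lambda>t. q t * (r t * cos (\<theta> t))) (\<lambda>t. r t * sin (\<theta> t))"
    proof (rule primitive_on_cong)
      fix t
      have "r t * h t * sin (\<theta> t) + r t * (cos (\<theta> t) * (q t * (cos (\<theta> t))\<^sup>2 - (sin (\<theta> t))\<^sup>2))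
          = q t * (r t * cos (\<theta> t)) * ((cos (\<theta> t))\<^sup>2 + (sin (\<theta> t))\<^sup>2)"
        unfolding h_def by (rule alg2)
      then show "r t * h t * sin (\<theta> t) + r t * (cos (\<theta> t) * (q t * (cos (\<theta> t))\<^sup>2 - (sin (\<theta> t))\<^sup>2)) = q t * (r t * cos (\<theta> t))"
        by (simp only: sin_cos_squared_add2 mult_1_right)
    qed simp
    ultimately show "primitive_on x0 b (\<lambda>t. r t * sin (\<theta> t)) (\<lambda>t. r t * cos (\<theta> t)) \<and>
      primitive_on x0 b (\<lambda>t. q t * (r t * cos (\<theta> t))) (\<lambda>t. r t * sin (\<theta> t))" ..
  qed
  then show ?thesis by (rule that) (auto simp: r_def)
qed

context confining_potential
begin

lemma V_minus_bounded: "\<exists>M. \<forall>t\<in>{x0..b}. \<bar>V t - \<nu>\<bar> \<le> M"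
  by (rule q_bound[of b]) blast

text \<open>Far out the angle lies in \<open>[- pi / 2, 0]\<close>, where cosine and sine have
  opposite signs. So \<open>u * v \<le> 0\<close>, and the energy estimate bounds the integral of
  \<open>u\<^sup>2\<close> uniformly.\<close>

lemma decaying_solution:
  obtains r K where
    "solves_from (\<lambda>t. V t - \<nu>) x0 (\<lambda>t. r t * cos (decaying_angle \<nu> t)) (\<lambda>t. r t * sin (decaying_angle \<nu> t))"
    "r x0 = 1" "\<And>t. r t > 0" "\<And>b. integral {x0..b} (\<lambda>t. (r t * cos (decaying_angle \<nu> t))\<^sup>2) \<le> K"
proof -
  obtain r where r: "solves_from (\<lambda>t. V t - \<nu>) x0 (\<lambda>t. r t * cos (decaying_angle \<nu> t)) (\<lambda>t. r t * sin (decaying_angle \<nu> t))"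
    "r x0 = 1" "\<And>t. r t > 0"
    by (rule prufer_angle_solves[OF decaying_angle[of \<nu>] q_integrable V_minus_bounded]) (rule that)
  define u where "u = (\<lambda>t. r t * cos (decaying_angle \<nu> t))"
  define v where "v = (\<lambda>t. r t * sin (decaying_angle \<nu> t))"
  have sol: "solves_from (\<lambda>t. V t - \<nu>) x0 u v" using r(1) by (simp add: u_def v_def)
  obtain a where a: "x0 \<le> a" "\<And>t. t \<ge> a \<Longrightarrow> \<nu> + 1 \<le> V t" using V_at_top by blast
  have neg: "u t * v t \<le> 0" if t: "t \<ge> a" for t
  proof -
    have "- pi / 2 \<le> decaying_angle \<nu> t" using t a by (intro decaying_angle_ge) auto
    moreover have "decaying_angle \<nu> t \<le> 0"
      using a(2) t by (intro decaying_angle_le_0[OF a(1)]) force+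
    ultimately have "cos (decaying_angle \<nu> t) \<ge> 0" "sin (decaying_angle \<nu> t) \<le> 0"
      using sin_ge_zero[of "- decaying_angle \<nu> t"] by (auto intro!: cos_ge_zero)
    then show ?thesis unfolding u_def v_def using r(3)[of t]
      by (intro mult_nonneg_nonpos mult_nonneg_nonneg) auto
  qed
  define K where "K = integral {x0..a} (\<lambda>t. (u t)\<^sup>2) - u a * v a"
  have cu: "continuous_on {x0..b} (\<lambda>t. (u t)\<^sup>2)" for b
    by (intro continuous_intros solves_fromD[OF sol])
  have iu: "(\<lambda>t. (u t)\<^sup>2) integrable_on {x0..b}" for b
    by (intro integrable_continuous_interval cu)
  have far: "integral {x0..b} (\<lambda>t. (u t)\<^sup>2) \<le> K" if b: "b \<ge> a" for b
  proof -
    have sub: "{a..b} \<subseteq> {x0..b}" using a by auto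
    have c: "continuous_on {a..b} u" "continuous_on {a..b} v"
      using continuous_on_subset[OF _ sub] solves_fromD(3,4)[OF sol] by blast+
    have "integral {x0..a} (\<lambda>t. (u t)\<^sup>2) + integral {a..b} (\<lambda>t. (u t)\<^sup>2) = integral {x0..b} (\<lambda>t. (u t)\<^sup>2)"
      using a b iu by (intro Henstock_Kurzweil_Integration.integral_combine) auto
    moreover have "integral {a..b} (\<lambda>t. (u t)\<^sup>2) \<le> integral {a..b} (\<lambda>t. (u t)\<^sup>2 + (v t)\<^sup>2)"
      by (intro integral_le integrable_continuous_interval continuous_intros c) auto
    moreover have "integral {a..b} (\<lambda>t. (u t)\<^sup>2 + (v t)\<^sup>2) \<le> - (u a * v a)"
      using a(2) by (intro solves_from_energy[OF sol a(1) _ neg b]) force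
    ultimately show ?thesis by (simp add: K_def)
  qed
  have "integral {x0..b} (\<lambda>t. (u t)\<^sup>2) \<le> K" for b
  proof -
    have "integral {x0..b} (\<lambda>t. (u t)\<^sup>2) \<le> integral {x0..max a b} (\<lambda>t. (u t)\<^sup>2)"
      by (intro integral_subset_le iu) auto
    also have "\<dots> \<le> K" by (rule far) simp
    finally show ?thesis .
  qed
  then show ?thesis unfolding u_def by (rule that[OF r])
qed

end

section \<open>Square integrability and almost-everywhere identities in terms of integrals over
  bounded intervals\<close>

lemma AE_lebesgue_on_negligible:
  assumes "AE t in lebesgue_on S. P t" "S \<in> sets lebesgue"
  obtains N where "negligible N" "\<And>t. t \<in> S - N \<Longrightarrow> P t"
proof -
  have "AE t in lebesgue. t \<in> S \<longrightarrow> P t"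
    using assms by (subst (asm) AE_restrict_space_iff) auto
  then obtain N where "N \<in> null_sets lebesgue" "{t \<in> space lebesgue. \<not> (t \<in> S \<longrightarrow> P t)} \<subseteq> N"
    unfolding eventually_ae_filter by blast
  then show ?thesis by (intro that[of N]) (auto simp: negligible_iff_null_sets)
qed

lemma integrable_lebesgue_on_iff_nonneg:
  fixes g :: "real \<Rightarrow> real"
  assumes "\<And>t. t \<in> S \<Longrightarrow> g t \<ge> 0" "S \<in> sets lebesgue"
  shows "integrable (lebesgue_on S) g \<longleftrightarrow> g integrable_on S"
proof -
  have "integrable (lebesgue_on S) g \<longleftrightarrow> g absolutely_integrable_on S"
    using assms(2) by (simp add: integrable_restrict_space set_integrable_def)
  also have "\<dots> \<longleftrightarrow> g integrable_on S"
    using nonnegative_absolutely_integrable_1[of g S] assms(1) set_lebesgue_integral_eq_integral(1) by blast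
  finally show ?thesis .
qed

lemma integrable_on_half_line:
  fixes g :: "real \<Rightarrow> real"
  assumes g: "\<And>b. g integrable_on {x0..b}" "\<And>t. t \<ge> x0 \<Longrightarrow> g t \<ge> 0"
    and K: "\<And>b. integral {x0..b} g \<le> K"
  shows "g integrable_on {x0..}"
proof -
  define f where "f = (\<lambda>k::nat. \<lambda>t. if t \<in> {x0..x0 + real k} then g t else 0)"
  have int: "f k integrable_on {x0..}" "integral {x0..} (f k) = integral {x0..x0 + real k} g" for k
  proof -
    have "(f k has_integral integral {x0..x0 + real k} g) {x0..}"
      unfolding f_def by (subst has_integral_restrict) (auto intro: integrable_integral g)
    then show "f k integrable_on {x0..}" "integral {x0..} (f k) = integral {x0..x0 + real k} g"
      by (auto simp: has_integral_iff)
  qed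
  have "g integrable_on {x0..} \<and> (\<lambda>k. integral {x0..} (f k)) \<longlonglongrightarrow> integral {x0..} g"
  proof (rule monotone_convergence_increasing)
    show "f k integrable_on {x0..}" for k by (rule int)
    show "f k t \<le> f (Suc k) t" if "t \<in> {x0..}" for k t using g(2)[of t] that by (auto simp: f_def)
    show "(\<lambda>k. f k t) \<longlonglongrightarrow> g t" if "t \<in> {x0..}" for t
    proof (rule tendsto_eventually)
      obtain k0 where k0: "real k0 \<ge> t - x0" using real_arch_simple by blast
      have "f k t = g t" if "k \<ge> k0" for k
      proof -
        have "real k \<ge> real k0" using that by simp
        then show ?thesis using k0 \<open>t \<in> {x0..}\<close> by (auto simp: f_def)
      qed
      then show "\<forall>\<^sub>F k in sequentially. f k t = g t" by (auto simp: eventually_sequentially)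
    qed
    have "0 \<le> integral {x0..x0 + real k} g" for k
      by (rule integral_nonneg[OF g(1)]) (use g(2) in auto)
    then show "bounded (range (\<lambda>k. integral {x0..} (f k)))"
      using K by (auto simp: int bounded_iff intro!: exI[of _ K])
  qed
  then show ?thesis by blast
qed

text \<open>The integrand \<open>v\<close> is continuous, so \<open>u\<close> has a derivative at
  every point, one-sided at \<open>x0\<close>, as membership in \<open>schrodinger_graph\<close>
  demands.\<close>

lemma solves_from_has_derivative:
  assumes sol: "solves_from q x0 u v" and t: "t \<ge> x0"
  shows "(u has_vector_derivative v t) (at t within {x0..})"
proof -
  have P: "primitive_on x0 (t + 1) v u" by (rule solves_fromD[OF sol])
  have "((\<lambda>s. integral {x0..s} v) has_vector_derivative v t) (at t within {x0..t + 1})"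
    by (rule integral_has_vector_derivative[OF solves_fromD(4)[OF sol]]) (use t in auto)
  then have "((\<lambda>s. u x0 + integral {x0..s} v) has_vector_derivative 0 + v t) (at t within {x0..t + 1})"
    by (intro has_vector_derivative_add) auto
  then have "(u has_vector_derivative 0 + v t) (at t within {x0..t + 1})"
  proof (rule has_vector_derivative_transform[rotated 2])
    show "t \<in> {x0..t + 1}" using t by simp
    show "u s = u x0 + integral {x0..s} v" if "s \<in> {x0..t + 1}" for s
      using primitive_on_has_integral[OF P, of x0 s] that by (simp add: has_integral_iff)
  qed
  moreover have "at t within {x0..t + 1} = at t within {x0..}"
    by (rule at_within_nhd[where S="{..<t + 1}"]) auto
  ultimately show ?thesis by simp
qed

lemma square_integrable_from_of_real:
  assumes u: "continuous_on {x0..} u" and K: "\<And>b. integral {x0..b} (\<lambda>t. (u t)\<^sup>2) \<le> K"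
  shows "square_integrable_from x0 (\<lambda>t. complex_of_real (u t))"
  unfolding square_integrable_from_def
proof
  show "(\<lambda>t. complex_of_real (u t)) \<in> borel_measurable (lebesgue_on {x0..})"
    by (intro continuous_imp_measurable_on_sets_lebesgue continuous_intros u) auto
  have "(\<lambda>t. (u t)\<^sup>2) integrable_on {x0..}"
  proof (rule integrable_on_half_line[OF _ _ K])
    show "(\<lambda>t. (u t)\<^sup>2) integrable_on {x0..b}" for b
      by (intro integrable_continuous_interval continuous_intros continuous_on_subset[OF u]) auto
  qed simp
  then show "integrable (lebesgue_on {x0..}) (\<lambda>t. (norm (complex_of_real (u t)))\<^sup>2)"
    by (subst integrable_lebesgue_on_iff_nonneg) auto
qed

lemma square_integrable_from_bound:
  assumes "square_integrable_from x0 f" and u: "\<And>b. continuous_on {x0..b} u"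
    and le: "\<And>t. \<bar>u t\<bar> \<le> norm (f t)"
  obtains K where "\<And>b. integral {x0..b} (\<lambda>t. (u t)\<^sup>2) \<le> K"
proof
  have f: "(\<lambda>t. (norm (f t))\<^sup>2) integrable_on {x0..}"
    using assms(1) by (subst (asm) square_integrable_from_def, subst (asm) integrable_lebesgue_on_iff_nonneg) auto
  fix b
  have fb: "(\<lambda>t. (norm (f t))\<^sup>2) integrable_on {x0..b}"
    by (rule integrable_on_subinterval[OF f]) auto
  have "integral {x0..b} (\<lambda>t. (u t)\<^sup>2) \<le> integral {x0..b} (\<lambda>t. (norm (f t))\<^sup>2)"
  proof (rule integral_le[OF _ fb])
    show "(\<lambda>t. (u t)\<^sup>2) integrable_on {x0..b}"
      by (intro integrable_continuous_interval continuous_intros u)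
    show "(u t)\<^sup>2 \<le> (norm (f t))\<^sup>2" for t
      using le[of t] by (subst abs_le_square_iff[symmetric]) auto
  qed
  also have "\<dots> \<le> integral {x0..} (\<lambda>t. (norm (f t))\<^sup>2)"
    by (rule integral_subset_le[OF _ fb f]) auto
  finally show "integral {x0..b} (\<lambda>t. (u t)\<^sup>2) \<le> integral {x0..} (\<lambda>t. (norm (f t))\<^sup>2)" .
qed

section \<open>The boundary condition as a condition on the decaying angle\<close>

context confining_potential
begin

text \<open>\<open>L\<close> is meant to be \<open>Re\<close> or \<open>Im\<close>; potential and
  spectral parameter are real, so each part solves the equation separately. The equation for
  \<open>f2\<close> holds only almost everywhere, which is enough because it is used under an
  integral.\<close>

lemma eigenfunction_part_solves:
  assumes f1: "\<forall>t\<ge>x0. (f has_vector_derivative f1 t) (at t within {x0..})"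
    and AC: "locally_AC_with_deriv x0 f1 f2"
    and AE: "AE t in lebesgue_on {x0..}. complex_of_real \<nu> * f t = - f2 t + complex_of_real (V t) * f t"
    and L: "bounded_linear L" "\<And>c z. L (complex_of_real c * z) = c * L z"
  shows "solves_from (\<lambda>t. V t - \<nu>) x0 (\<lambda>t. L (f t)) (\<lambda>t. L (f1 t))"
  unfolding solves_from_def
proof
  fix b
  interpret L: bounded_linear L by (rule L)
  have f2: "f2 integrable_on {x0..t}" for t
  proof -
    have "f2 absolutely_integrable_on {x0..t}"
      using AC unfolding locally_AC_with_deriv_def locally_integrable_from_def by blast
    then show ?thesis by (rule set_lebesgue_integral_eq_integral(1))
  qed
  have f1_eq: "f1 t = f1 x0 + integral {x0..t} f2" if "t \<ge> x0" for t
    using AC that unfolding locally_AC_with_deriv_def by blast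
  have "continuous_on {x0..b} (\<lambda>t. f1 x0 + integral {x0..t} f2)"
    by (intro continuous_intros indefinite_integral_continuous_1 f2)
  then have "continuous_on {x0..b} f1"
    by (rule continuous_on_eq) (rule f1_eq[symmetric], simp)
  then have cf1: "continuous_on {x0..b} (\<lambda>t. L (f1 t))"
    by (rule L.continuous_on)
  have d: "((\<lambda>t. L (f t)) has_real_derivative L (f1 t)) (at t within {x0..b})" if "t \<in> {x0..b}" for t
  proof -
    have "(f has_vector_derivative f1 t) (at t within {x0..b})"
      by (rule has_vector_derivative_within_subset) (use f1 that in auto)
    then show ?thesis
      by (simp add: has_real_derivative_iff_has_vector_derivative L.has_vector_derivative)
  qed
  have cf: "continuous_on {x0..b} (\<lambda>t. L (f t))"
    by (rule DERIV_continuous_on[OF d])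
  obtain N where N: "negligible N" "\<And>t. t \<in> {x0..} - N \<Longrightarrow>
      complex_of_real \<nu> * f t = - f2 t + complex_of_real (V t) * f t"
    using AE_lebesgue_on_negligible[OF AE] by auto
  have Lf2: "(V t - \<nu>) * L (f t) = L (f2 t)" if "t \<in> {x0..} - N" for t
  proof -
    have "f2 t = complex_of_real (V t - \<nu>) * f t" using N(2)[OF that] by (simp add: algebra_simps)
    then show ?thesis by (simp only: L(2))
  qed
  obtain M where M: "\<And>t. t \<in> {x0..b} \<Longrightarrow> \<bar>V t - \<nu>\<bar> \<le> M" using V_minus_bounded by meson
  obtain R where R: "\<And>t. t \<in> {x0..b} \<Longrightarrow> \<bar>L (f t)\<bar> \<le> R"
    using continuous_on_interval_bound[OF cf] by metis
  have "(\<lambda>t. L (f t) * (V t - \<nu>)) integrable_on {x0..b}"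
    by (rule integrable_continuous_mult_bounded[OF cf q_integrable M])
  then have int: "(\<lambda>t. (V t - \<nu>) * L (f t)) integrable_on {x0..b}" by (simp add: mult.commute)
  have "primitive_on x0 b (\<lambda>t. (V t - \<nu>) * L (f t)) (\<lambda>t. L (f1 t))"
  proof (rule primitive_onI_integral[OF int])
    show "\<bar>(V t - \<nu>) * L (f t)\<bar> \<le> M * R" if "t \<in> {x0..b}" for t
      unfolding abs_mult using M[OF that] R[OF that] by (intro mult_mono) auto
    show "L (f1 t) = L (f1 x0) + integral {x0..t} (\<lambda>t. (V t - \<nu>) * L (f t))" if "t \<in> {x0..b}" for t
    proof -
      have "integral {x0..t} (\<lambda>t. (V t - \<nu>) * L (f t)) = integral {x0..t} (L \<circ> f2)"
        by (rule integral_spike[OF N(1)]) (simp add: Lf2)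
      also have "\<dots> = L (integral {x0..t} f2)" by (rule integral_linear[OF f2 L(1)])
      finally show ?thesis using f1_eq[of t] that by (simp add: L.add)
    qed
  qed
  moreover have "primitive_on x0 b (\<lambda>t. L (f1 t)) (\<lambda>t. L (f t))"
    by (rule primitive_on_C1[OF d cf1])
  ultimately show "primitive_on x0 b (\<lambda>t. L (f1 t)) (\<lambda>t. L (f t)) \<and>
      primitive_on x0 b (\<lambda>t. (V t - \<nu>) * L (f t)) (\<lambda>t. L (f1 t))" by simp
qed

text \<open>The Wronskian with the decaying solution vanishes, so the initial vector of each real
  part is a multiple of \<open>(c, s)\<close>, the direction of the decaying angle. The boundary
  condition makes it orthogonal to \<open>(cos \<alpha>, sin \<alpha>)\<close>, and the scalar
  product of these two unit vectors is the cosine in question. If that is nonzero, all initial data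
  vanish and \<open>f\<close> is zero.\<close>

lemma eigenvalue_imp_angle:
  assumes "schrodinger_eigenvalue V x0 \<alpha> (complex_of_real \<nu>)"
  shows "cos (\<alpha> - decaying_angle \<nu> x0) = 0"
proof (rule ccontr)
  assume nz: "cos (\<alpha> - decaying_angle \<nu> x0) \<noteq> 0"
  obtain f where f: "(f, \<lambda>t. complex_of_real \<nu> * f t) \<in> schrodinger_graph V x0 \<alpha>"
    "\<not> (AE t in lebesgue_on {x0..}. f t = 0)"
    using assms unfolding schrodinger_eigenvalue_def by blast
  obtain f1 f2 where sq: "square_integrable_from x0 f"
    and f1: "\<forall>t\<ge>x0. (f has_vector_derivative f1 t) (at t within {x0..})"
    and AC: "locally_AC_with_deriv x0 f1 f2"
    and bc: "complex_of_real (cos \<alpha>) * f x0 + complex_of_real (sin \<alpha>) * f1 x0 = 0"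
    and AE: "AE t in lebesgue_on {x0..}. complex_of_real \<nu> * f t = - f2 t + complex_of_real (V t) * f t"
    using f(1) unfolding schrodinger_graph_def mem_Collect_eq prod.case
    by (elim conjE exE) (rule that)
  obtain r K where r: "solves_from (\<lambda>t. V t - \<nu>) x0 (\<lambda>t. r t * cos (decaying_angle \<nu> t)) (\<lambda>t. r t * sin (decaying_angle \<nu> t))"
    "r x0 = 1" "\<And>b. integral {x0..b} (\<lambda>t. (r t * cos (decaying_angle \<nu> t))\<^sup>2) \<le> K"
    by (rule decaying_solution[of \<nu>]) (rule that)
  obtain a where a: "x0 \<le> a" "\<And>t. t \<ge> a \<Longrightarrow> \<nu> + 1 \<le> V t" using V_at_top by blast
  have a': "\<And>t. t \<ge> a \<Longrightarrow> 1 \<le> V t - \<nu>" using a(2) by force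
  define c where "c = cos (decaying_angle \<nu> x0)"
  define s where "s = sin (decaying_angle \<nu> x0)"
  have part: "L (f x0) * s = L (f1 x0) * c \<and> solves_from (\<lambda>t. V t - \<nu>) x0 (\<lambda>t. L (f t)) (\<lambda>t. L (f1 t))"
    if L: "bounded_linear L" "\<And>c z. L (complex_of_real c * z) = c * L z" "\<And>z. \<bar>L z\<bar> \<le> norm z" for L
  proof -
    have sol: "solves_from (\<lambda>t. V t - \<nu>) x0 (\<lambda>t. L (f t)) (\<lambda>t. L (f1 t))"
      by (rule eigenfunction_part_solves[OF f1 AC AE L(1,2)])
    obtain K' where "\<And>b. integral {x0..b} (\<lambda>t. (L (f t))\<^sup>2) \<le> K'"
      using square_integrable_from_bound[OF sq solves_fromD(3)[OF sol] L(3)] by blast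
    from square_integrable_solutions_dependent[OF sol this r(1,3) a(1) a'] r(2) sol
    show ?thesis by (simp add: c_def s_def)
  qed
  have Re: "Re (f x0) * s = Re (f1 x0) * c" "solves_from (\<lambda>t. V t - \<nu>) x0 (\<lambda>t. Re (f t)) (\<lambda>t. Re (f1 t))"
    using part[OF bounded_linear_Re] abs_Re_le_cmod by auto
  have Im: "Im (f x0) * s = Im (f1 x0) * c" "solves_from (\<lambda>t. V t - \<nu>) x0 (\<lambda>t. Im (f t)) (\<lambda>t. Im (f1 t))"
    using part[OF bounded_linear_Im] abs_Im_le_cmod by auto
  have real: "x = 0 \<and> y = 0" if "x * s = y * c" "cos \<alpha> * x + sin \<alpha> * y = 0" for x y :: real
  proof -
    have cs: "c * c + s * s = 1" by (simp add: c_def s_def flip: power2_eq_square)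
    \<comment> \<open>The coefficient of \<open>(x, y)\<close> along the unit vector
      \<open>(c, s)\<close>; by parallelism \<open>(x, y)\<close> equals \<open>\<kappa>\<close>
      times that vector.\<close>
    define \<kappa> where "\<kappa> = x * c + y * s"
    have "c * \<kappa> = x * (c * c) + (y * c) * s" by (simp add: \<kappa>_def algebra_simps)
    also have "\<dots> = x * (c * c + s * s)" by (simp flip: that(1)) (simp add: algebra_simps)
    finally have x: "x = c * \<kappa>" by (simp add: cs)
    have "s * \<kappa> = (x * s) * c + y * (s * s)" by (simp add: \<kappa>_def algebra_simps)
    also have "\<dots> = y * (c * c + s * s)" by (simp add: that(1)) (simp add: algebra_simps)
    finally have y: "y = s * \<kappa>" by (simp add: cs)
    have "cos (\<alpha> - decaying_angle \<nu> x0) * \<kappa> = cos \<alpha> * x + sin \<alpha> * y"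
      by (simp add: x y cos_diff c_def s_def algebra_simps)
    then have "\<kappa> = 0" using that(2) nz by simp
    then show ?thesis using x y by simp
  qed
  have "Re (f x0) = 0 \<and> Re (f1 x0) = 0" using arg_cong[OF bc, of Re] by (intro real Re) simp
  then have "Re (f t) = 0" if "t \<ge> x0" for t
    using solves_from_zero[OF Re(2) V_minus_bounded _ _ that] by simp
  moreover have "Im (f x0) = 0 \<and> Im (f1 x0) = 0" using arg_cong[OF bc, of Im] by (intro real Im) simp
  then have "Im (f t) = 0" if "t \<ge> x0" for t
    using solves_from_zero[OF Im(2) V_minus_bounded _ _ that] by simp
  ultimately have "f t = 0" if "t \<ge> x0" for t using that by (simp add: complex_eq_iff)
  then have "AE t in lebesgue_on {x0..}. f t = 0" by (intro AE_I2) simp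
  then show False using f(2) by contradiction
qed

text \<open>The decaying solution itself is the eigenfunction: with \<open>r x0 = 1\<close> its
  initial vector is the unit vector of the angle, and the hypothesis is exactly its orthogonality to
  \<open>(cos \<alpha>, sin \<alpha>)\<close>.\<close>

lemma angle_imp_eigenvalue:
  assumes bc: "cos (\<alpha> - decaying_angle \<nu> x0) = 0"
  shows "schrodinger_eigenvalue V x0 \<alpha> (complex_of_real \<nu>)"
proof -
  obtain r K where r: "solves_from (\<lambda>t. V t - \<nu>) x0 (\<lambda>t. r t * cos (decaying_angle \<nu> t)) (\<lambda>t. r t * sin (decaying_angle \<nu> t))"
    "r x0 = 1" "\<And>t. r t > 0" "\<And>b. integral {x0..b} (\<lambda>t. (r t * cos (decaying_angle \<nu> t))\<^sup>2) \<le> K"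
    by (rule decaying_solution[of \<nu>]) (rule that)
  define u where "u = (\<lambda>t. r t * cos (decaying_angle \<nu> t))"
  define v where "v = (\<lambda>t. r t * sin (decaying_angle \<nu> t))"
  have sol: "solves_from (\<lambda>t. V t - \<nu>) x0 u v" and K: "\<And>b. integral {x0..b} (\<lambda>t. (u t)\<^sup>2) \<le> K"
    using r by (auto simp: u_def v_def)
  define f where "f = (\<lambda>t. complex_of_real (u t))"
  define f1 where "f1 = (\<lambda>t. complex_of_real (v t))"
  define f2 where "f2 = (\<lambda>t. complex_of_real ((V t - \<nu>) * u t))"
  note du = solves_from_has_derivative[OF sol]
  have cu: "continuous_on {x0..} u"
    using du has_vector_derivative_continuous by (force simp: continuous_on_eq_continuous_within)
  have h1: "square_integrable_from x0 f"
    unfolding f_def by (rule square_integrable_from_of_real[OF cu K])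
  have h2: "square_integrable_from x0 (\<lambda>t. complex_of_real \<nu> * f t)"
  proof -
    have "square_integrable_from x0 (\<lambda>t. complex_of_real (\<nu> * u t))"
    proof (rule square_integrable_from_of_real)
      fix b
      have "integral {x0..b} (\<lambda>t. (\<nu> * u t)\<^sup>2) = \<nu>\<^sup>2 * integral {x0..b} (\<lambda>t. (u t)\<^sup>2)"
        by (simp add: power_mult_distrib)
      also have "\<dots> \<le> \<nu>\<^sup>2 * K" by (intro mult_left_mono K) simp
      finally show "integral {x0..b} (\<lambda>t. (\<nu> * u t)\<^sup>2) \<le> \<nu>\<^sup>2 * K" .
    qed (intro continuous_intros cu)
    then show ?thesis by (simp add: f_def)
  qed
  have h3: "\<forall>t\<ge>x0. (f has_vector_derivative f1 t) (at t within {x0..})"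
    unfolding f_def f1_def using du bounded_linear.has_vector_derivative[OF bounded_linear_of_real] by blast
  have h4: "locally_AC_with_deriv x0 f1 f2"
    unfolding locally_AC_with_deriv_def locally_integrable_from_def
  proof (intro conjI allI impI)
    fix b
    have P: "primitive_on x0 b (\<lambda>t. (V t - \<nu>) * u t) v" by (rule solves_fromD[OF sol])
    obtain M where M: "\<And>t. t \<in> {x0..b} \<Longrightarrow> \<bar>(V t - \<nu>) * u t\<bar> \<le> M" using primitive_on_bound[OF P] by metis
    have "(\<lambda>t. (V t - \<nu>) * u t) absolutely_integrable_on {x0..b}"
      by (rule absolutely_integrable_integrable_bound[where g="\<lambda>_. M", OF _ primitive_on_integrable[OF P]])
        (use M in auto)
    then have "(complex_of_real \<circ> (\<lambda>t. (V t - \<nu>) * u t)) absolutely_integrable_on {x0..b}"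
      by (rule absolutely_integrable_linear) (rule bounded_linear_of_real)
    then show "f2 absolutely_integrable_on {x0..b}" by (simp add: f2_def o_def)
  next
    fix t assume t: "x0 \<le> t"
    have "((\<lambda>t. (V t - \<nu>) * u t) has_integral v t - v x0) {x0..t}"
      by (rule primitive_on_has_integral[OF solves_fromD(2)[OF sol]]) (use t in auto)
    then have "((complex_of_real \<circ> (\<lambda>t. (V t - \<nu>) * u t)) has_integral complex_of_real (v t - v x0)) {x0..t}"
      by (rule has_integral_linear) (rule bounded_linear_of_real)
    then have "integral {x0..t} f2 = complex_of_real (v t - v x0)"
      by (simp add: f2_def o_def integral_unique)
    then show "f1 t = f1 x0 + integral {x0..t} f2" by (simp add: f1_def)
  qed
  have h5: "complex_of_real (cos \<alpha>) * f x0 + complex_of_real (sin \<alpha>) * f1 x0 = 0"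
  proof -
    have "cos \<alpha> * u x0 + sin \<alpha> * v x0 = 0" using bc by (simp add: u_def v_def r(2) cos_diff)
    then have "complex_of_real (cos \<alpha> * u x0 + sin \<alpha> * v x0) = 0" by simp
    then show ?thesis by (simp add: f_def f1_def)
  qed
  have h6: "AE t in lebesgue_on {x0..}. complex_of_real \<nu> * f t = - f2 t + complex_of_real (V t) * f t"
    by (rule AE_I2) (simp add: f_def f2_def algebra_simps)
  have "\<exists>f1 f2. (\<forall>t\<ge>x0. (f has_vector_derivative f1 t) (at t within {x0..})) \<and>
        locally_AC_with_deriv x0 f1 f2 \<and>
        complex_of_real (cos \<alpha>) * f x0 + complex_of_real (sin \<alpha>) * f1 x0 = 0 \<and>
        (AE t in lebesgue_on {x0..}. complex_of_real \<nu> * f t = - f2 t + complex_of_real (V t) * f t)"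
    by (rule exI[of _ f1], rule exI[of _ f2], rule conjI[OF h3 conjI[OF h4 conjI[OF h5 h6]]])
  then have graph: "(f, \<lambda>t. complex_of_real \<nu> * f t) \<in> schrodinger_graph V x0 \<alpha>"
    unfolding schrodinger_graph_def mem_Collect_eq prod.case by (rule conjI[OF h1 conjI[OF h2]])
  \<comment> \<open>If \<open>u\<close> vanished almost everywhere it would vanish on
    \<open>{x0..b}\<close> by continuity; then the identity for \<open>u * v\<close> makes the
    integral of \<open>v\<^sup>2\<close> zero, so \<open>v x0 = 0\<close> as well, against
    \<open>r x0 = 1\<close>.\<close>
  have "\<not> (AE t in lebesgue_on {x0..}. f t = 0)"
  proof
    assume AE0: "AE t in lebesgue_on {x0..}. f t = 0"
    obtain N where N: "negligible N" "\<And>t. t \<in> {x0..} - N \<Longrightarrow> f t = 0"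
      using AE_lebesgue_on_negligible[OF AE0] by auto
    define b where "b = x0 + 1"
    have "((\<lambda>t. (u t)\<^sup>2) has_integral 0) {x0..b}"
      by (rule has_integral_spike[OF N(1), where f="\<lambda>_. 0"]) (use N(2) in \<open>auto simp: f_def\<close>)
    then have u0: "u t = 0" if "t \<in> {x0..b}" for t
      using has_integral_0_cbox_imp_0[of x0 b "\<lambda>t. (u t)\<^sup>2" t] that
        continuous_on_power[OF solves_fromD(3)[OF sol], of b 2] by (auto simp: b_def)
    have "primitive_on x0 b (\<lambda>t. v t * v t + u t * ((V t - \<nu>) * u t)) (\<lambda>t. u t * v t)"
      by (intro primitive_on_mult solves_fromD[OF sol])
    then have "((\<lambda>t. v t * v t + u t * ((V t - \<nu>) * u t)) has_integral u b * v b - u x0 * v x0) {x0..b}"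
      by (rule primitive_on_has_integral) (auto simp: b_def)
    then have "((\<lambda>t. (v t)\<^sup>2) has_integral u b * v b - u x0 * v x0) {x0..b}"
      by (rule has_integral_eq[rotated]) (simp add: u0 power2_eq_square)
    then have "((\<lambda>t. (v t)\<^sup>2) has_integral 0) {x0..b}" using u0[of b] u0[of x0] by (simp add: b_def)
    then have "v x0 = 0"
      using has_integral_0_cbox_imp_0[of x0 b "\<lambda>t. (v t)\<^sup>2" x0]
        continuous_on_power[OF solves_fromD(4)[OF sol], of b 2] by (auto simp: b_def)
    then have "cos (decaying_angle \<nu> x0) = 0" "sin (decaying_angle \<nu> x0) = 0"
      using u0[of x0] r(2) by (auto simp: u_def v_def b_def)
    then show False using sin_cos_squared_add[of "decaying_angle \<nu> x0"] by simp
  qed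
  then show ?thesis using graph unfolding schrodinger_eigenvalue_def by blast
qed

lemma eigenvalues_below_eq: "eigenvalues_below T V x0 \<alpha> = {\<nu>. \<nu> < T \<and> cos (\<alpha> - decaying_angle \<nu> x0) = 0}"
  unfolding eigenvalues_below_def using eigenvalue_imp_angle angle_imp_eigenvalue by blast

end

section \<open>Counting the levels of an increasing angle\<close>

lemma cos_eq_0_iff_int: "cos (\<alpha> - x) = 0 \<longleftrightarrow> (x - \<alpha> - pi / 2) / pi \<in> \<int>"
proof -
  have "sin (x - \<alpha> - pi / 2) = - cos (x - \<alpha>)"
    by (simp add: sin_diff[of "x - \<alpha>"])
  moreover have "cos (x - \<alpha>) = cos (\<alpha> - x)" using cos_minus[of "\<alpha> - x"] by simp
  ultimately have "cos (\<alpha> - x) = 0 \<longleftrightarrow> sin (x - \<alpha> - pi / 2) = 0" by simp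
  also have "\<dots> \<longleftrightarrow> (x - \<alpha> - pi / 2) / pi \<in> \<int>"
    unfolding sin_zero_iff_int2 Ints_def by (auto simp: field_simps)
  finally show ?thesis .
qed

text \<open>Each point of \<open>S T \<alpha>\<close> is labelled injectively by the integer
  \<open>(\<Theta> x - c) / pi\<close>. The lower bound \<open>- pi / 2\<close> confines the labels;
  continuity realizes all labels with levels between 0 and \<open>\<Theta> T\<close>.
  \<open>\<alpha>\<close> only translates the range of labels, which affects the count boundedly.
  The bound 3 is generous: the excess is at most 3/2, the deficit at most 1.\<close>

lemma count_angle_levels:
  fixes \<Theta> :: "real \<Rightarrow> real"
  assumes mono: "\<And>x y. x < y \<Longrightarrow> \<Theta> x < \<Theta> y" and cont: "\<And>a b. continuous_on {a..b} \<Theta>"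
    and low: "\<And>x. \<Theta> x \<ge> - pi / 2"
  defines "S \<equiv> \<lambda>T \<alpha>. {x. x < T \<and> cos (\<alpha> - \<Theta> x) = 0}"
  shows "finite (S T \<alpha>)"
    and "\<Theta> x1 \<le> 0 \<Longrightarrow> x1 \<le> T \<Longrightarrow> \<bar>real (card (S T \<alpha>)) - \<Theta> T / pi\<bar> \<le> 3"
proof -
  define c where "c = \<alpha> + pi / 2"
  define g where "g = (\<lambda>x. \<lfloor>(\<Theta> x - c) / pi\<rfloor>)"
  have g: "real_of_int (g x) = (\<Theta> x - c) / pi" if "x \<in> S T \<alpha>" for x
  proof -
    have "(\<Theta> x - c) / pi \<in> \<int>" using that by (simp add: S_def cos_eq_0_iff_int c_def algebra_simps)
    then show ?thesis by (simp add: g_def)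
  qed
  have inj: "inj_on g (S T \<alpha>)"
  proof (rule inj_onI)
    fix x y assume "x \<in> S T \<alpha>" "y \<in> S T \<alpha>" "g x = g y"
    then have "\<Theta> x = \<Theta> y" using g[of x] g[of y] by simp
    then show "x = y" using mono[of x y] mono[of y x] by (cases x y rule: linorder_cases) auto
  qed
  define lo where "lo = (- pi / 2 - c) / pi"
  define hi where "hi = (\<Theta> T - c) / pi"
  have sub: "g ` S T \<alpha> \<subseteq> {\<lceil>lo\<rceil>..\<lfloor>hi\<rfloor>}"
  proof
    fix k assume "k \<in> g ` S T \<alpha>"
    then obtain x where x: "x \<in> S T \<alpha>" "k = g x" by blast
    then have "\<Theta> x < \<Theta> T" using mono by (auto simp: S_def)
    then have "lo \<le> real_of_int k" "real_of_int k \<le> hi"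
      unfolding x(2) g[OF x(1)] lo_def hi_def using low[of x] by (auto intro!: divide_right_mono)
    then show "k \<in> {\<lceil>lo\<rceil>..\<lfloor>hi\<rfloor>}" by (auto simp: ceiling_le_iff le_floor_iff)
  qed
  show fin: "finite (S T \<alpha>)"
    using inj finite_subset[OF sub] by (auto intro: finite_imageD)
  assume x1: "\<Theta> x1 \<le> 0" "x1 \<le> T"
  have "lo \<le> hi" using low[of T] by (auto simp: lo_def hi_def intro!: divide_right_mono)
  have "card (S T \<alpha>) = card (g ` S T \<alpha>)" using card_image[OF inj] by simp
  also have "\<dots> \<le> card {\<lceil>lo\<rceil>..\<lfloor>hi\<rfloor>}" by (rule card_mono[OF _ sub]) simp
  finally have "real (card (S T \<alpha>)) \<le> hi - lo + 1" using \<open>lo \<le> hi\<close> by (simp, linarith)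
  also have "hi - lo = \<Theta> T / pi + 1 / 2" by (simp add: hi_def lo_def diff_divide_distrib)
  finally have up: "real (card (S T \<alpha>)) \<le> \<Theta> T / pi + 3" by simp
  \<comment> \<open>The end points encode strict inequalities: the levels \<open>c + pi * k\<close>
    must exceed 0, hence \<open>\<Theta> x1\<close>, and lie below \<open>\<Theta> T\<close>,
    because only points \<open>x < T\<close> are counted.\<close>
  have sup: "{\<lfloor>- c / pi\<rfloor> + 1..\<lceil>hi\<rceil> - 1} \<subseteq> g ` S T \<alpha>"
  proof
    fix k assume k: "k \<in> {\<lfloor>- c / pi\<rfloor> + 1..\<lceil>hi\<rceil> - 1}"
    have "- c / pi < real_of_int k" using k by (simp add: floor_less_iff) linarith
    then have k1: "0 < c + pi * real_of_int k" by (simp add: field_simps)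
    have "real_of_int k < hi" using k by (simp add: less_ceiling_iff)
    then have k2: "c + pi * real_of_int k < \<Theta> T" by (simp add: hi_def field_simps)
    obtain x where x: "x1 \<le> x" "x \<le> T" "\<Theta> x = c + pi * real_of_int k"
      using IVT'[of \<Theta> x1 "c + pi * real_of_int k" T] k1 k2 x1 cont by auto
    then have "x < T" using k2 by (cases "x = T") auto
    moreover have gx: "(\<Theta> x - c) / pi = real_of_int k" by (simp add: x)
    ultimately have "x \<in> S T \<alpha>"
      by (simp add: S_def cos_eq_0_iff_int c_def algebra_simps)
    moreover have "g x = k" by (simp add: g_def gx)
    ultimately show "k \<in> g ` S T \<alpha>" by blast
  qed
  have "card {\<lfloor>- c / pi\<rfloor> + 1..\<lceil>hi\<rceil> - 1} \<le> card (g ` S T \<alpha>)"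
    by (rule card_mono[OF _ sup]) (use fin in simp)
  also have "\<dots> = card (S T \<alpha>)" by (rule card_image[OF inj])
  finally have "card {\<lfloor>- c / pi\<rfloor> + 1..\<lceil>hi\<rceil> - 1} \<le> card (S T \<alpha>)" .
  moreover have "real_of_int (\<lceil>hi\<rceil> - 1 - \<lfloor>- c / pi\<rfloor>) \<le> real (card {\<lfloor>- c / pi\<rfloor> + 1..\<lceil>hi\<rceil> - 1})"
    by simp
  moreover have "hi - 1 - (- c / pi) \<le> real_of_int (\<lceil>hi\<rceil> - 1 - \<lfloor>- c / pi\<rfloor>)"
    using le_of_int_ceiling[of hi] of_int_floor_le[of "- c / pi"] by linarith
  ultimately have "hi - (- c / pi) - 1 \<le> real (card (S T \<alpha>))" by linarith
  moreover have "hi - (- c / pi) = \<Theta> T / pi" by (simp add: hi_def diff_divide_distrib)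
  ultimately show "\<bar>real (card (S T \<alpha>)) - \<Theta> T / pi\<bar> \<le> 3" using up by linarith
qed

context confining_potential
begin

lemma eigenvalue_count_angle:
  "finite (eigenvalues_below T V x0 \<alpha>)"
  "\<exists>T0. \<forall>T\<ge>T0. \<forall>\<alpha>. \<bar>real (eigenvalue_count T V x0 \<alpha>) - decaying_angle T x0 / pi\<bar> \<le> 3"
proof -
  note levels = count_angle_levels[of "\<lambda>\<nu>. decaying_angle \<nu> x0", OF decaying_angle_strict_mono
      continuous_on_decaying_angle decaying_angle_ge]
  show "finite (eigenvalues_below T V x0 \<alpha>)"
    unfolding eigenvalues_below_eq by (rule levels(1)) auto
  obtain a where a: "a \<ge> x0" "\<forall>t\<ge>a. 0 \<le> V t" using V_at_top by blast
  obtain M where M: "\<forall>t\<in>{x0..a}. \<bar>V t\<bar> \<le> M" using V_bounded by blast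
  have "- \<bar>M\<bar> \<le> V t" if "t \<ge> x0" for t
  proof (cases "t \<le> a")
    case True
    then have "\<bar>V t\<bar> \<le> M" using M that by simp
    then show ?thesis by linarith
  next
    case False
    then have "0 \<le> V t" using a(2) by simp
    then show ?thesis by linarith
  qed
  \<comment> \<open>The number \<open>- \<bar>M\<bar>\<close> lies below the potential on the whole
    half-line, so the angle is in the strip already at \<open>x0\<close>. This provides the starting
    point \<open>x1\<close> for the count.\<close>
  then have "decaying_angle (- \<bar>M\<bar>) x0 \<le> 0"
    by (intro decaying_angle_le_0[of x0]) auto
  then show "\<exists>T0. \<forall>T\<ge>T0. \<forall>\<alpha>. \<bar>real (eigenvalue_count T V x0 \<alpha>) - decaying_angle T x0 / pi\<bar> \<le> 3"
    unfolding eigenvalue_count_def eigenvalues_below_eq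
    using levels(2) by (intro exI[of _ "- \<bar>M\<bar>"] allI impI) auto
qed

end

subsection \<open>Change of frame\<close>

lemma continuous_positive_of_nonzero:
  fixes h :: "real \<Rightarrow> real"
  assumes "continuous_on {a..b} h" "\<And>t. t \<in> {a..b} \<Longrightarrow> h t \<noteq> 0" "h b > 0" "t \<in> {a..b}"
  shows "h t > 0"
proof (rule ccontr)
  assume "\<not> h t > 0"
  then have "\<exists>z\<ge>t. z \<le> b \<and> h z = 0"
    using assms by (intro IVT' continuous_on_subset[OF assms(1)]) auto
  then show False using assms(2,4) by auto
qed

lemma primitive_on_increment_le:
  assumes F: "primitive_on a b f F" and B: "\<And>t. t \<in> {a..b} \<Longrightarrow> \<bar>f t\<bar> \<le> B" and st: "a \<le> s" "s \<le> t" "t \<le> b"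
  shows "\<bar>F t - F s\<bar> \<le> B * (t - s)"
proof -
  have P: "primitive_on a b (\<lambda>t. B) (\<lambda>t. B * t)"
    by (rule primitive_on_C1) (auto intro!: derivative_eq_intros)
  have "F t - F s \<le> B * t - B * s"
    by (rule primitive_on_mono_diff[OF F P _ st]) (use B in fastforce)
  moreover have "(- F t) - (- F s) \<le> B * t - B * s"
    by (rule primitive_on_mono_diff[OF primitive_on_minus[OF F] P _ st]) (use B in fastforce)
  ultimately show ?thesis by (simp add: right_diff_distrib abs_le_iff)
qed

text \<open>The angle \<open>x\<close> is the direction of the sheared and scaled vector
  \<open>(cos \<theta>, (sin \<theta> + \<beta> * cos \<theta>) / P)\<close>. The last two
  conditions say that \<open>(cos x, P * sin x - \<beta> * cos x)\<close> is parallel to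
  \<open>(cos \<theta>, sin \<theta>)\<close>, with the same orientation. \<open>Arg\<close> of the
  quotient of the directions picks the branch nearest to \<open>\<theta>\<close>.\<close>

lemma shear_angle_exists:
  assumes "P > (0::real)"
  obtains x where "\<bar>x - \<theta>\<bar> < pi"
    "cos \<theta> * (P * sin x - \<beta> * cos x) - sin \<theta> * cos x = 0"
    "cos \<theta> * cos x + sin \<theta> * (P * sin x - \<beta> * cos x) > 0"
proof -
  define c where "c = cos \<theta>"
  define s where "s = sin \<theta>"
  have cs: "c * c + s * s = 1" by (simp add: c_def s_def flip: power2_eq_square)
  define u where "u = Complex c ((s + \<beta> * c) / P)"
  have u0: "u \<noteq> 0"
  proof
    assume "u = 0"
    then have "c = 0" "s = 0" using assms by (auto simp: u_def complex_eq_iff)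
    then show False using cs by simp
  qed
  define w where "w = Arg (u * cnj (cis \<theta>))"
  define x where "x = \<theta> + w"
  have w: "- pi < w" "w \<le> pi" "cis w = sgn (u * cnj (cis \<theta>))"
    using Arg_correct[of "u * cnj (cis \<theta>)"] u0 by (auto simp: w_def)
  define \<rho> where "\<rho> = inverse (norm u)"
  have \<rho>: "\<rho> > 0" using u0 by (simp add: \<rho>_def)
  have "cis x = cis \<theta> * (u * cnj (cis \<theta>) / complex_of_real (norm u))"
    by (simp add: x_def w(3) sgn_eq norm_mult flip: cis_mult)
  also have "\<dots> = (cis \<theta> * cnj (cis \<theta>)) * (complex_of_real \<rho> * u)"
    by (simp add: \<rho>_def field_simps)
  also have "cis \<theta> * cnj (cis \<theta>) = 1"
    by (simp add: cis_cnj cis_mult)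
  finally have "cis x = complex_of_real \<rho> * u" by simp
  then have cx: "cos x = \<rho> * c" and sx: "P * sin x = \<rho> * (s + \<beta> * c)"
    using assms by (auto simp: complex_eq_iff u_def)
  have px: "P * sin x - \<beta> * cos x = \<rho> * s" by (simp add: cx sx algebra_simps)
  \<comment> \<open>An image antipodal to its vector would be an eigenvector with negative
    eigenvalue, but this triangular map has the eigenvalues 1 and \<open>1 / P\<close>.\<close>
  have "w \<noteq> pi"
  proof
    assume "w = pi"
    then have "cos x = - c" "sin x = - s" by (simp_all add: x_def c_def s_def)
    then have c1: "(1 + \<rho>) * c = 0" and s1: "P * (- s) = \<rho> * (s + \<beta> * c)"
      using cx sx by (simp_all add: distrib_right)
    from c1 \<rho> have "c = 0" by simp
    with s1 have "(P + \<rho>) * s = 0" by (simp add: distrib_right)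
    then show False using cs \<rho> assms \<open>c = 0\<close> by auto
  qed
  show ?thesis
  proof (rule that[of x])
    show "\<bar>x - \<theta>\<bar> < pi" using w \<open>w \<noteq> pi\<close> by (auto simp: x_def)
    show "cos \<theta> * (P * sin x - \<beta> * cos x) - sin \<theta> * cos x = 0"
      unfolding px unfolding cx by (simp add: c_def s_def)
    have "cos \<theta> * cos x + sin \<theta> * (P * sin x - \<beta> * cos x) = \<rho> * (c * c + s * s)"
    proof -
      have "y * (\<rho> * y) + z * (\<rho> * z) = \<rho> * (y * y + z * z)" for y z by algebra
      then show ?thesis unfolding px unfolding cx c_def s_def .
    qed
    then show "cos \<theta> * cos x + sin \<theta> * (P * sin x - \<beta> * cos x) > 0" using \<rho> cs by simp
  qed
qed

text \<open>With \<open>a = P * S - \<beta> * C\<close>, the vectors \<open>(c, s)\<close> and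
  \<open>(C, a)\<close> both follow the system \<open>f' = g\<close>, \<open>g' = q * f\<close> up
  to a scalar drift: \<open>(c, s)' = (s, q * c) - \<mu> * (c, s)\<close> and
  \<open>(C, a)' = (a, q * C) - \<nu> * (C, a)\<close>. The system is trace-free, so their
  determinant \<open>c * a - s * C\<close> has logarithmic derivative
  \<open>- (\<mu> + \<nu>)\<close>.\<close>

lemma frame_identity:
  fixes c s C S P P' \<beta> \<beta>' q E G :: real
  assumes "c * c + s * s = 1" "C * C + S * S = 1" "P * E = q + \<beta>' - \<beta> * \<beta>" "P * G = 2 * \<beta> * P - P'"
  defines "\<theta>' \<equiv> q * (c * c) - s * s" and "\<phi>' \<equiv> E * (C * C) - P * (S * S) + G * (S * C)"
  shows "- s * \<theta>' * (P * S - \<beta> * C) + c * ((P' * S + P * (C * \<phi>')) - (\<beta>' * C + \<beta> * (- S * \<phi>'))) -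
      (c * \<theta>' * C + s * (- S * \<phi>'))
    = - (s * c * (1 + q) + (P * S * C - \<beta> + E * S * C + G * S * S)) * (c * (P * S - \<beta> * C) - s * C)"
proof -
  define a where "a = P * S - \<beta> * C"
  define \<mu> where "\<mu> = s * c * (1 + q)"
  define \<nu> where "\<nu> = P * S * C - \<beta> + E * S * C + G * S * S"
  have 1: "- s * \<theta>' = s - \<mu> * c" unfolding \<theta>'_def \<mu>_def using assms(1) by algebra
  have 2: "c * \<theta>' = q * c - \<mu> * s" unfolding \<theta>'_def \<mu>_def using assms(1) by algebra
  have 3: "- S * \<phi>' = a - \<nu> * C" unfolding \<phi>'_def \<nu>_def a_def using assms(2) by algebra
  have 4: "(P' * S + P * (C * \<phi>')) - (\<beta>' * C + \<beta> * (- S * \<phi>')) = q * C - \<nu> * a"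
    unfolding \<phi>'_def \<nu>_def a_def using assms(2,3,4) by algebra
  show ?thesis
    unfolding a_def[symmetric] \<mu>_def[symmetric] \<nu>_def[symmetric] 1 2 3 4[unfolded 3] by algebra
qed

text \<open>Here \<open>tan \<phi> = (tan \<theta> + \<beta>) / P\<close>.  The angle \<open>\<phi>\<close> is obtained from its own equation; the
  determinant of the two directions solves a linear homogeneous equation and so vanishes.  The two
  directions are never antipodal, hence the angles stay within \<open>\<pi>\<close> of each other.\<close>

lemma prufer_angle_change_frame:
  assumes \<theta>: "prufer_angle q a b \<theta>" and "a \<le> b"
    and q: "q integrable_on {a..b}" "\<And>t. t \<in> {a..b} \<Longrightarrow> \<bar>q t\<bar> \<le> Mq"
    and P: "\<And>t. t \<in> {a..b} \<Longrightarrow> (P has_real_derivative P' t) (at t within {a..b})" "continuous_on {a..b} P'"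
      "\<And>t. t \<in> {a..b} \<Longrightarrow> P t > 0"
    and \<beta>: "\<And>t. t \<in> {a..b} \<Longrightarrow> (\<beta> has_real_derivative \<beta>' t) (at t within {a..b})" "continuous_on {a..b} \<beta>'"
  obtains \<phi> where "primitive_on a b (\<lambda>t. (q t + \<beta>' t - \<beta> t * \<beta> t) / P t * (cos (\<phi> t))\<^sup>2 +
      (- P t) * (sin (\<phi> t))\<^sup>2 + (2 * \<beta> t - P' t / P t) * (sin (\<phi> t) * cos (\<phi> t))) \<phi>"
    "\<And>t. t \<in> {a..b} \<Longrightarrow> \<bar>\<phi> t - \<theta> t\<bar> < pi"
proof -
  define E where "E = (\<lambda>t. (q t + \<beta>' t - \<beta> t * \<beta> t) / P t)"
  define G where "G = (\<lambda>t. 2 * \<beta> t - P' t / P t)"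
  have cP: "continuous_on {a..b} P" and c\<beta>: "continuous_on {a..b} \<beta>"
    using DERIV_continuous_on P(1) \<beta>(1) by blast+
  have nP: "P t \<noteq> 0" if "t \<in> {a..b}" for t using P(3)[OF that] by simp
  have cG: "continuous_on {a..b} G" unfolding G_def
    by (intro continuous_intros cP c\<beta> P) (use nP in auto)
  have ciP: "continuous_on {a..b} (\<lambda>t. 1 / P t)"
    by (intro continuous_intros cP) (use nP in auto)
  have ce: "continuous_on {a..b} (\<lambda>t. (\<beta>' t - \<beta> t * \<beta> t) / P t)"
    by (intro continuous_intros cP c\<beta> \<beta>) (use nP in auto)
  have E_eq: "E = (\<lambda>t. 1 / P t * q t + (\<beta>' t - \<beta> t * \<beta> t) / P t)"
    by (auto simp: E_def add_divide_distrib diff_divide_distrib)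
  have iE: "E integrable_on {a..b}"
    unfolding E_eq
    by (intro integrable_add integrable_continuous_mult_bounded[OF ciP q] integrable_continuous_interval ce)
  obtain M1 where M1: "M1 \<ge> 0" "\<And>t. t \<in> {a..b} \<Longrightarrow> \<bar>1 / P t\<bar> \<le> M1"
    using continuous_on_interval_bound[OF ciP] by metis
  obtain M2 where M2: "M2 \<ge> 0" "\<And>t. t \<in> {a..b} \<Longrightarrow> \<bar>(\<beta>' t - \<beta> t * \<beta> t) / P t\<bar> \<le> M2"
    using continuous_on_interval_bound[OF ce] by metis
  obtain M3 where M3: "M3 \<ge> 0" "\<And>t. t \<in> {a..b} \<Longrightarrow> \<bar>P t\<bar> \<le> M3"
    using continuous_on_interval_bound[OF cP] by metis
  obtain M4 where M4: "M4 \<ge> 0" "\<And>t. t \<in> {a..b} \<Longrightarrow> \<bar>G t\<bar> \<le> M4"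
    using continuous_on_interval_bound[OF cG] by metis
  obtain M5 where M5: "M5 \<ge> 0" "\<And>t. t \<in> {a..b} \<Longrightarrow> \<bar>\<beta> t\<bar> \<le> M5"
    using continuous_on_interval_bound[OF c\<beta>] by metis
  define ME where "ME = M1 * Mq + M2"
  have ME: "\<bar>E t\<bar> \<le> ME" if "t \<in> {a..b}" for t
  proof -
    have "\<bar>E t\<bar> \<le> \<bar>1 / P t\<bar> * \<bar>q t\<bar> + \<bar>(\<beta>' t - \<beta> t * \<beta> t) / P t\<bar>"
      unfolding E_eq abs_mult[symmetric] by (rule abs_triangle_ineq)
    also have "\<dots> \<le> M1 * Mq + M2"
      using M1 M2 q(2) that by (intro add_mono mult_mono) auto
    finally show ?thesis by (simp add: ME_def)
  qed
  have ME0: "ME \<ge> 0" using ME[of a] \<open>a \<le> b\<close> by fastforce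
  obtain x where x: "\<bar>x - \<theta> b\<bar> < pi"
    "cos (\<theta> b) * (P b * sin x - \<beta> b * cos x) - sin (\<theta> b) * cos x = 0"
    "cos (\<theta> b) * cos x + sin (\<theta> b) * (P b * sin x - \<beta> b * cos x) > 0"
    using shear_angle_exists[of "P b" "\<theta> b" "\<beta> b"] P(3)[of b] \<open>a \<le> b\<close> by auto
  obtain \<phi> where \<phi>: "primitive_on a b (\<lambda>t. E t * (cos (\<phi> t))\<^sup>2 + (- P t) * (sin (\<phi> t))\<^sup>2 + G t * (sin (\<phi> t) * cos (\<phi> t))) \<phi>"
    "\<phi> b = x"
  proof (rule angle_equation_solution[OF \<open>a \<le> b\<close> iE, where M="ME + M3 + M4" and B="\<lambda>t. - P t" and S=G and c=x])
    fix t assume t: "t \<in> {a..b}"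
    show "\<bar>E t\<bar> \<le> ME + M3 + M4" "\<bar>- P t\<bar> \<le> ME + M3 + M4" "\<bar>G t\<bar> \<le> ME + M3 + M4"
      using ME[OF t] M3(2)[OF t] M4(2)[OF t] ME0 M3(1) M4(1) by auto
  qed (intro integrable_continuous_interval continuous_intros cP cG)+
  define \<phi>' where "\<phi>' = (\<lambda>t. E t * (cos (\<phi> t))\<^sup>2 + (- P t) * (sin (\<phi> t))\<^sup>2 + G t * (sin (\<phi> t) * cos (\<phi> t)))"
  define \<theta>' where "\<theta>' = (\<lambda>t. q t * (cos (\<theta> t))\<^sup>2 - (sin (\<theta> t))\<^sup>2)"
  have p\<phi>: "primitive_on a b \<phi>' \<phi>" using \<phi>(1) by (simp add: \<phi>'_def)
  have p\<theta>: "primitive_on a b \<theta>' \<theta>" using \<theta> by (simp add: \<theta>'_def prufer_angle_def)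
  have pP: "primitive_on a b P' P" by (rule primitive_on_C1[OF P(1,2)])
  have p\<beta>: "primitive_on a b \<beta>' \<beta>" by (rule primitive_on_C1[OF \<beta>])
  have pyth: "cos x * cos x + sin x * sin x = 1" for x :: real
    by (simp flip: power2_eq_square)
  \<comment> \<open>The determinant of the direction of \<open>\<theta>\<close> and of the direction
    that \<open>\<phi>\<close> describes in the original coordinates.\<close>
  define D where "D = (\<lambda>t. cos (\<theta> t) * (P t * sin (\<phi> t) - \<beta> t * cos (\<phi> t)) - sin (\<theta> t) * cos (\<phi> t))"
  define h where "h = (\<lambda>t. - (sin (\<theta> t) * cos (\<theta> t) * (1 + q t) + (P t * sin (\<phi> t) * cos (\<phi> t) - \<beta> t +
      E t * sin (\<phi> t) * cos (\<phi> t) + G t * sin (\<phi> t) * sin (\<phi> t))))"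
  have "primitive_on a b (\<lambda>t. - sin (\<theta> t) * \<theta>' t * (P t * sin (\<phi> t) - \<beta> t * cos (\<phi> t)) +
      cos (\<theta> t) * ((P' t * sin (\<phi> t) + P t * (cos (\<phi> t) * \<phi>' t)) - (\<beta>' t * cos (\<phi> t) + \<beta> t * (- sin (\<phi> t) * \<phi>' t))) -
      (cos (\<theta> t) * \<theta>' t * cos (\<phi> t) + sin (\<theta> t) * (- sin (\<phi> t) * \<phi>' t))) D"
    unfolding D_def
    by (intro primitive_on_diff primitive_on_mult primitive_on_sin primitive_on_cos p\<phi> p\<theta> pP p\<beta>)
  then have "primitive_on a b (\<lambda>t. h t * D t) D"
  proof (rule primitive_on_cong)
    fix t assume t: "t \<in> {a..b}"
    have "P t * E t = q t + \<beta>' t - \<beta> t * \<beta> t" "P t * G t = 2 * \<beta> t * P t - P' t"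
      using nP[OF t] by (simp_all add: E_def G_def field_simps)
    moreover have "\<theta>' t = q t * (cos (\<theta> t) * cos (\<theta> t)) - sin (\<theta> t) * sin (\<theta> t)"
      "\<phi>' t = E t * (cos (\<phi> t) * cos (\<phi> t)) - P t * (sin (\<phi> t) * sin (\<phi> t)) + G t * (sin (\<phi> t) * cos (\<phi> t))"
      by (simp_all add: \<theta>'_def \<phi>'_def power2_eq_square)
    moreover note frame_identity[OF pyth[of "\<theta> t"] pyth[of "\<phi> t"] calculation(1,2)]
    ultimately
    show "- sin (\<theta> t) * \<theta>' t * (P t * sin (\<phi> t) - \<beta> t * cos (\<phi> t)) +
        cos (\<theta> t) * ((P' t * sin (\<phi> t) + P t * (cos (\<phi> t) * \<phi>' t)) - (\<beta>' t * cos (\<phi> t) + \<beta> t * (- sin (\<phi> t) * \<phi>' t))) -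
        (cos (\<theta> t) * \<theta>' t * cos (\<phi> t) + sin (\<theta> t) * (- sin (\<phi> t) * \<phi>' t)) = h t * D t"
      by (simp only: h_def D_def)
  qed simp
  then have D0: "D t = 0" if t: "t \<in> {a..b}" for t
  proof (rule primitive_on_zero_backward[OF _ _ _ _ t])
    show "D b = 0" using x(2) by (simp add: D_def \<phi>(2))
    define Mh where "Mh = (1 + \<bar>Mq\<bar>) + (M3 + M5 + ME + M4)"
    show "0 \<le> Mh" using M3(1) M5(1) ME0 M4(1) by (simp add: Mh_def)
    fix t assume t: "t \<in> {a..b}"
    have sc: "\<bar>sin x * cos x\<bar> \<le> 1" "\<bar>sin x * sin x\<bar> \<le> 1" for x :: real
      using mult_mono[of "\<bar>sin x\<bar>" 1 "\<bar>cos x\<bar>" 1] mult_mono[of "\<bar>sin x\<bar>" 1 "\<bar>sin x\<bar>" 1]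
      by (simp_all add: abs_mult)
    have "\<bar>sin (\<theta> t) * cos (\<theta> t) * (1 + q t)\<bar> \<le> 1 * (1 + \<bar>Mq\<bar>)"
      unfolding abs_mult[of _ "1 + q t"] using q(2)[OF t] by (intro mult_mono sc) auto
    moreover have "\<bar>P t * (sin (\<phi> t) * cos (\<phi> t))\<bar> \<le> M3 * 1"
      unfolding abs_mult[of "P t"] using M3 t by (intro mult_mono sc) auto
    moreover have "\<bar>E t * (sin (\<phi> t) * cos (\<phi> t))\<bar> \<le> ME * 1"
      unfolding abs_mult[of "E t"] using ME ME0 t by (intro mult_mono sc) auto
    moreover have "\<bar>G t * (sin (\<phi> t) * sin (\<phi> t))\<bar> \<le> M4 * 1"
      unfolding abs_mult[of "G t"] using M4 t by (intro mult_mono sc) auto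
    moreover have "\<bar>x\<bar> \<le> A \<Longrightarrow> \<bar>y\<bar> \<le> B \<Longrightarrow> \<bar>e\<bar> \<le> E' \<Longrightarrow> \<bar>g\<bar> \<le> G' \<Longrightarrow> \<bar>z\<bar> \<le> Z \<Longrightarrow>
        \<bar>- (x + (y - z + e + g))\<bar> \<le> A + (B + Z + E' + G')" for x y z e g A B E' G' Z :: real
      by linarith
    ultimately have "\<bar>h t\<bar> \<le> Mh"
      using M5(2)[OF t] unfolding h_def Mh_def mult.assoc mult_1_right mult_1 by blast
    then show "\<bar>h t * D t\<bar> \<le> Mh * \<bar>D t\<bar>" by (simp add: abs_mult mult_right_mono)
  qed
  have c\<phi>: "continuous_on {a..b} \<phi>" and c\<theta>: "continuous_on {a..b} \<theta>"
    using primitive_on_continuous p\<phi> p\<theta> by blast+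
  \<comment> \<open>The scalar product of the same two vectors. Since \<open>D\<close> vanishes, a
    zero of \<open>\<kappa>\<close> would annihilate the second vector, so \<open>\<kappa>\<close>
    keeps its sign and the orientation is preserved.\<close>
  define \<kappa> where "\<kappa> = (\<lambda>t. cos (\<theta> t) * cos (\<phi> t) + sin (\<theta> t) * (P t * sin (\<phi> t) - \<beta> t * cos (\<phi> t)))"
  have \<kappa>: "\<kappa> t > 0" if t: "t \<in> {a..b}" for t
  proof (rule continuous_positive_of_nonzero[OF _ _ _ t])
    show "continuous_on {a..b} \<kappa>"
      unfolding \<kappa>_def by (intro continuous_intros c\<phi> c\<theta> cP c\<beta>)
    show "\<kappa> b > 0" using x(3) by (simp add: \<kappa>_def \<phi>(2))
    fix t assume t: "t \<in> {a..b}"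
    show "\<kappa> t \<noteq> 0"
    proof
      assume 0: "\<kappa> t = 0"
      have "cos (\<phi> t) = cos (\<theta> t) * \<kappa> t - sin (\<theta> t) * D t"
        unfolding \<kappa>_def D_def using pyth[of "\<theta> t"] by algebra
      moreover have "P t * sin (\<phi> t) - \<beta> t * cos (\<phi> t) = sin (\<theta> t) * \<kappa> t + cos (\<theta> t) * D t"
        unfolding \<kappa>_def D_def using pyth[of "\<theta> t"] by algebra
      ultimately have "cos (\<phi> t) = 0" "P t * sin (\<phi> t) = 0" using 0 D0[OF t] by simp_all
      then show False using nP[OF t] pyth[of "\<phi> t"] by simp
    qed
  qed
  have antipodal: False if t: "t \<in> {a..b}" and "cos (\<phi> t) = - cos (\<theta> t)" "sin (\<phi> t) = - sin (\<theta> t)" for t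
  proof (cases "cos (\<theta> t) = 0")
    case True
    then have "\<kappa> t = - (P t * (sin (\<theta> t) * sin (\<theta> t)))" by (simp add: \<kappa>_def that)
    moreover have "P t * (sin (\<theta> t) * sin (\<theta> t)) \<ge> 0" using P(3)[OF t] by simp
    ultimately show False using \<kappa>[OF t] by linarith
  next
    case False
    have "cos (\<theta> t) * (P t * sin (\<phi> t) - \<beta> t * cos (\<phi> t) + sin (\<theta> t)) = 0"
      using D0[OF t] by (simp add: D_def that algebra_simps)
    then have e: "P t * sin (\<phi> t) - \<beta> t * cos (\<phi> t) = - sin (\<theta> t)" using False by simp
    have "\<kappa> t = cos (\<theta> t) * (- cos (\<theta> t)) + sin (\<theta> t) * (- sin (\<theta> t))"
      unfolding \<kappa>_def e unfolding that(2) ..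
    also have "\<dots> = - 1" using pyth[of "\<theta> t"] by algebra
    finally show False using \<kappa>[OF t] by simp
  qed
  have "\<bar>\<phi> t - \<theta> t\<bar> < pi" if t: "t \<in> {a..b}" for t
  proof -
    have "pi - (\<phi> t - \<theta> t) > 0"
    proof (rule continuous_positive_of_nonzero[OF _ _ _ t])
      show "pi - (\<phi> t - \<theta> t) \<noteq> 0" if t: "t \<in> {a..b}" for t
      proof
        assume "pi - (\<phi> t - \<theta> t) = 0"
        then have "\<phi> t = \<theta> t + pi" by simp
        then show False using antipodal[OF t] by simp
      qed
    qed (use x(1) in \<open>auto intro!: continuous_intros c\<phi> c\<theta> simp: \<phi>(2)\<close>)
    moreover have "pi + (\<phi> t - \<theta> t) > 0"
    proof (rule continuous_positive_of_nonzero[OF _ _ _ t])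
      show "pi + (\<phi> t - \<theta> t) \<noteq> 0" if t: "t \<in> {a..b}" for t
      proof
        assume "pi + (\<phi> t - \<theta> t) = 0"
        then have "\<theta> t = \<phi> t + pi" by simp
        then show False using antipodal[OF t] by simp
      qed
    qed (use x(1) in \<open>auto intro!: continuous_intros c\<phi> c\<theta> simp: \<phi>(2)\<close>)
    ultimately show ?thesis by (simp add: abs_less_iff)
  qed
  with \<phi>(1) show ?thesis unfolding E_def G_def by (rule that)
qed

subsection \<open>Asymptotics of the decaying angle\<close>

text \<open>With \<open>T = m\<^sup>6\<close> all scales near the turning point are powers of \<open>m\<close>.\<close>

lemma wkb_phase_at_left:
  fixes d x0 :: real
  assumes "d > 0"
  shows "((\<lambda>m. m^3 * (ln (m^3 + sqrt (m^6 - d)) + ln 2 - x0) - sqrt (m^6 - d) -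
    (m^3 * ln (m^3) + (2 * ln 2 - 1 - x0) * m^3)) \<longlongrightarrow> 0) at_top"
  by real_asymp

text \<open>The phase still to be gained between the cut-off, where \<open>P = m^2\<close>, and the
  turning point, where the primitive of the phase vanishes. Since \<open>P^2\<close> is nearly
  linear there with slope \<open>- 2 * m^6\<close>, it is close to
  \<open>P^3 / (3 * m^6) = 1 / 3\<close>.\<close>

lemma wkb_phase_at_turning_point:
  "((\<lambda>m::real. m^3 * (ln (m^3 + m^2) + ln 2 - (ln 2 + ln (m^6 - m^4) / 2)) - m^2) \<longlongrightarrow> 1 / 3) at_top"
  by real_asymp

text \<open>To the left of the turning point the window has width about
  \<open>m^4 / (2 * m^6)\<close>, which gives the limit 1/2; the part to the right is about
  \<open>2 * C / m^3\<close> and negligible.\<close>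

lemma window_width:
  fixes C :: real assumes "C > 0"
  shows "((\<lambda>m::real. m^2 * (ln (2 * m^3 + 4 * C) - (ln 2 + ln (m^6 - m^4) / 2))) \<longlongrightarrow> 1 / 2) at_top"
  by real_asymp

text \<open>With \<open>T = R\<^sup>2\<close> and turning point \<open>exp t = 2 * R\<close>, the
  second function is the frame shift \<open>P' / (2 * P)\<close> and the third a primitive of
  \<open>- P\<close> that vanishes at the turning point. The fourth is a primitive of the error
  bound: \<open>exp t / P\<close> is twice the derivative of the arcsine, and
  \<open>1 / P ^ 3\<close> has derivative \<open>3 * Q0 / P ^ 5\<close>, whence
  \<open>5 / 12\<close> for \<open>5 / 4\<close>.\<close>

lemma wkb_derivatives:
  fixes R :: real
  assumes R: "R > 0" and lt: "Q0 t < R\<^sup>2"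
  defines "P \<equiv> \<lambda>t. sqrt (R\<^sup>2 - Q0 t)"
  shows "(P has_real_derivative - Q0 t / P t) (at t within S)"
    and "((\<lambda>t. - Q0 t / (2 * (R\<^sup>2 - Q0 t))) has_real_derivative - (R\<^sup>2 * Q0 t) / (R\<^sup>2 - Q0 t)\<^sup>2) (at t within S)"
    and "((\<lambda>t. R * (ln (R + P t) + ln 2 - t) - P t) has_real_derivative - P t) (at t within S)"
    and "((\<lambda>t. 2 * C * arcsin (exp t / (2 * R)) + 5 / 12 * (R\<^sup>2 / (P t) ^ 3)) has_real_derivative
      (C * exp t + 5 / 4 * (R\<^sup>2 * Q0 t) / (R\<^sup>2 - Q0 t)\<^sup>2) / P t) (at t within S)"
proof -
  have P: "P t > 0" "(P t)\<^sup>2 = R\<^sup>2 - Q0 t" using lt by (auto simp: P_def)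
  have Q: "Q0 t = (R - P t) * (R + P t)" using P(2) by (simp add: algebra_simps power2_eq_square)
  have dQ: "(Q0 has_real_derivative 2 * Q0 t) (at t within S)"
    unfolding Q0_def by (auto intro!: derivative_eq_intros)
  show dP: "(P has_real_derivative - Q0 t / P t) (at t within S)"
    unfolding P_def using lt by (auto intro!: derivative_eq_intros dQ simp: field_simps)
  show "((\<lambda>t. - Q0 t / (2 * (R\<^sup>2 - Q0 t))) has_real_derivative - (R\<^sup>2 * Q0 t) / (R\<^sup>2 - Q0 t)\<^sup>2) (at t within S)"
  proof -
    define X where "X = R\<^sup>2 - Q0 t"
    have X: "X \<noteq> 0" "R\<^sup>2 = X + Q0 t" using lt by (auto simp: X_def)
    have "((\<lambda>t. - Q0 t / (2 * (R\<^sup>2 - Q0 t))) has_real_derivative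
        (- (2 * Q0 t) * (2 * X) - - Q0 t * (2 * (0 - 2 * Q0 t))) / (2 * X * (2 * X))) (at t within S)"
      unfolding X_def by (intro DERIV_divide DERIV_minus DERIV_cmult DERIV_diff DERIV_const dQ) (use lt in auto)
    moreover have "(- (2 * Q0 t) * (2 * X) - - Q0 t * (2 * (0 - 2 * Q0 t))) / (2 * X * (2 * X)) =
        - (R\<^sup>2 * Q0 t) / X\<^sup>2"
      unfolding X(2) using X(1) by (simp add: divide_simps power2_eq_square) (simp add: algebra_simps)
    ultimately show ?thesis by (simp add: X_def)
  qed
  show "((\<lambda>t. R * (ln (R + P t) + ln 2 - t) - P t) has_real_derivative - P t) (at t within S)"
  proof -
    have "((\<lambda>t. R * (ln (R + P t) + ln 2 - t) - P t) has_real_derivative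
        R * (- Q0 t / P t / (R + P t) - 1) - (- Q0 t / P t)) (at t within S)"
      using P R by (auto intro!: derivative_eq_intros dP)
    moreover have "R * (- Q0 t / P t / (R + P t) - 1) - (- Q0 t / P t) = - P t"
      using P(1) R add_pos_pos[OF R P(1)] unfolding Q by (simp add: divide_simps) (simp add: algebra_simps)
    ultimately show ?thesis by simp
  qed
  have x: "sqrt (1 - (exp t / (2 * R))\<^sup>2) = P t / R"
  proof -
    have "1 - (exp t / (2 * R))\<^sup>2 = (R\<^sup>2 - Q0 t) / R\<^sup>2"
      unfolding Q0_def exp_double using R by (simp add: field_simps power2_eq_square)
    then show ?thesis using R by (simp add: real_sqrt_divide P_def)
  qed
  have x1: "-1 < exp t / (2 * R)" "exp t / (2 * R) < 1"
  proof -
    have "0 < exp t / (2 * R)" using R by simp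
    then show "-1 < exp t / (2 * R)" by linarith
    have "(exp t / 2)\<^sup>2 < R\<^sup>2" using lt by (simp add: Q0_def exp_double power_divide)
    then have "exp t / 2 < R" by (rule power_less_imp_less_base) (use R in simp)
    then show "exp t / (2 * R) < 1" using R by simp
  qed
  have d1: "((\<lambda>t. 2 * C * arcsin (exp t / (2 * R))) has_real_derivative 2 * C * (exp t / (2 * R) / (P t / R))) (at t within S)"
    unfolding x[symmetric] using x1 R
    by (auto intro!: derivative_eq_intros simp: field_simps)
  have eq1: "2 * C * (exp t / (2 * R) / (P t / R)) = C * exp t / P t" using R P by (simp add: field_simps)
  have d2: "((\<lambda>t. 5 / 12 * (R\<^sup>2 / (P t) ^ 3)) has_real_derivative
      5 / 12 * (- (R\<^sup>2 * (3 * (P t)\<^sup>2 * (- Q0 t / P t))) / ((P t) ^ 3)\<^sup>2)) (at t within S)"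
    using P(1) by (auto intro!: derivative_eq_intros dP simp: power2_eq_square)
  have eq2: "5 / 12 * (- (R\<^sup>2 * (3 * (P t)\<^sup>2 * (- Q0 t / P t))) / ((P t) ^ 3)\<^sup>2) =
      5 / 4 * (R\<^sup>2 * Q0 t) / (R\<^sup>2 - Q0 t)\<^sup>2 / P t"
    unfolding P(2)[symmetric] using P(1) by (simp add: field_simps power2_eq_square power3_eq_cube)
  show "((\<lambda>t. 2 * C * arcsin (exp t / (2 * R)) + 5 / 12 * (R\<^sup>2 / (P t) ^ 3)) has_real_derivative
      (C * exp t + 5 / 4 * (R\<^sup>2 * Q0 t) / (R\<^sup>2 - Q0 t)\<^sup>2) / P t) (at t within S)"
    using DERIV_add[OF d1[unfolded eq1] d2[unfolded eq2]] by (simp only: add_divide_distrib)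
qed

text \<open>The shift \<open>\<beta> = P' / (2 * P)\<close> cancels the mixed term and leaves
  \<open>\<phi>' = - P + e\<close> with \<open>e\<close> dominated by \<open>B'\<close>. In the
  bound, \<open>2 * pi\<close> pays for the change of frame at both ends, \<open>C * pi\<close> for
  the full range of the arcsine, and the rest is \<open>5 / 12 * (R\<^sup>2 / P ^ 3)\<close> at
  \<open>b\<close>.\<close>

lemma wkb_region:
  assumes \<theta>: "prufer_angle (\<lambda>t. V t - R\<^sup>2) x0 b \<theta>" and "x0 \<le> b"
    and V: "V integrable_on {x0..b}" "\<And>t. t \<in> {x0..b} \<Longrightarrow> \<bar>V t\<bar> \<le> M"
    and C: "C > 0" "\<And>t. t \<in> {x0..b} \<Longrightarrow> \<bar>V t - Q0 t\<bar> \<le> C * exp t"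
    and R: "R > 0" "Q0 b < R\<^sup>2"
  defines "P \<equiv> \<lambda>t. sqrt (R\<^sup>2 - Q0 t)"
  defines "H \<equiv> \<lambda>t. R * (ln (R + P t) + ln 2 - t) - P t"
  shows "\<bar>\<theta> x0 - \<theta> b - (H x0 - H b)\<bar> \<le> 2 * pi + C * pi + 5 / 12 * (R\<^sup>2 / (P b) ^ 3)"
proof -
  define \<beta> where "\<beta> = (\<lambda>t. - Q0 t / (2 * (R\<^sup>2 - Q0 t)))"
  define \<beta>' where "\<beta>' = (\<lambda>t. - (R\<^sup>2 * Q0 t) / (R\<^sup>2 - Q0 t)\<^sup>2)"
  define P' where "P' = (\<lambda>t. - Q0 t / P t)"
  have lt: "Q0 t < R\<^sup>2" if "t \<in> {x0..b}" for t
  proof -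
    have "Q0 t \<le> Q0 b" using that by (simp add: Q0_def)
    then show ?thesis using R by simp
  qed
  have P: "P t > 0" "(P t)\<^sup>2 = R\<^sup>2 - Q0 t" if "t \<in> {x0..b}" for t using lt[OF that] by (auto simp: P_def)
  have Q0_pos: "Q0 t > 0" for t by (simp add: Q0_def)
  have cQ: "continuous_on {x0..b} Q0" unfolding Q0_def by (intro continuous_intros) auto
  have cP: "continuous_on {x0..b} P" unfolding P_def by (intro continuous_intros cQ)
  have nz: "R\<^sup>2 - Q0 t \<noteq> 0" "P t \<noteq> 0" if "t \<in> {x0..b}" for t using lt[OF that] P(1)[OF that] by auto
  have cP': "continuous_on {x0..b} P'" unfolding P'_def
    by (intro continuous_intros cQ cP) (use nz in auto)
  have c\<beta>': "continuous_on {x0..b} \<beta>'" unfolding \<beta>'_def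
    by (intro continuous_intros cQ) (use nz in auto)
  have dP: "(P has_real_derivative P' t) (at t within {x0..b})"
    and d\<beta>: "(\<beta> has_real_derivative \<beta>' t) (at t within {x0..b})" if "t \<in> {x0..b}" for t
    using wkb_derivatives(1,2)[OF R(1) lt[OF that]] by (simp_all add: P_def P'_def \<beta>_def \<beta>'_def)
  have iq: "(\<lambda>t. V t - R\<^sup>2) integrable_on {x0..b}" by (intro integrable_diff V integrable_const_ivl)
  have bq: "\<bar>V t - R\<^sup>2\<bar> \<le> M + R\<^sup>2" if "t \<in> {x0..b}" for t
    using abs_triangle_ineq4[of "V t" "R\<^sup>2"] V(2)[OF that] by simp
  obtain \<phi> where \<phi>0: "primitive_on x0 b (\<lambda>t. (V t - R\<^sup>2 + \<beta>' t - \<beta> t * \<beta> t) / P t * (cos (\<phi> t))\<^sup>2 +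
      (- P t) * (sin (\<phi> t))\<^sup>2 + (2 * \<beta> t - P' t / P t) * (sin (\<phi> t) * cos (\<phi> t))) \<phi>"
    and close: "\<And>t. t \<in> {x0..b} \<Longrightarrow> \<bar>\<phi> t - \<theta> t\<bar> < pi"
    by (rule prufer_angle_change_frame[OF \<theta> \<open>x0 \<le> b\<close> iq bq dP cP' P(1) d\<beta> c\<beta>']) (assumption+, rule that)
  define e where "e = (\<lambda>t. (V t - Q0 t + \<beta>' t - \<beta> t * \<beta> t) / P t * (cos (\<phi> t))\<^sup>2)"
  have \<phi>: "primitive_on x0 b (\<lambda>t. - P t + e t) \<phi>"
  proof (rule primitive_on_cong[OF \<phi>0])
    fix t assume t: "t \<in> {x0..b}"
    have G: "2 * \<beta> t - P' t / P t = 0"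
      unfolding \<beta>_def P'_def P(2)[OF t, symmetric] using nz[OF t] by (simp add: power2_eq_square)
    have "(V t - R\<^sup>2 + \<beta>' t - \<beta> t * \<beta> t) / P t = (V t - Q0 t + \<beta>' t - \<beta> t * \<beta> t - (P t)\<^sup>2) / P t"
      unfolding P(2)[OF t] by simp
    also have "\<dots> = (V t - Q0 t + \<beta>' t - \<beta> t * \<beta> t) / P t - P t"
      using nz[OF t] by (simp add: diff_divide_distrib power2_eq_square)
    finally have W: "(V t - R\<^sup>2 + \<beta>' t - \<beta> t * \<beta> t) / P t = (V t - Q0 t + \<beta>' t - \<beta> t * \<beta> t) / P t - P t" .
    have "(w - p) * c + (- p) * (1 - c) + 0 * x = - p + w * c" for w p c x :: real by algebra
    then show "(V t - R\<^sup>2 + \<beta>' t - \<beta> t * \<beta> t) / P t * (cos (\<phi> t))\<^sup>2 +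
        (- P t) * (sin (\<phi> t))\<^sup>2 + (2 * \<beta> t - P' t / P t) * (sin (\<phi> t) * cos (\<phi> t)) = - P t + e t"
      unfolding G W e_def sin_squared_eq .
  qed simp
  define B where "B = (\<lambda>t. 2 * C * arcsin (exp t / (2 * R)) + 5 / 12 * (R\<^sup>2 / (P t) ^ 3))"
  define B' where "B' = (\<lambda>t. (C * exp t + 5 / 4 * (R\<^sup>2 * Q0 t) / (R\<^sup>2 - Q0 t)\<^sup>2) / P t)"
  have pB: "primitive_on x0 b B' B"
  proof (rule primitive_on_C1)
    show "(B has_real_derivative B' t) (at t within {x0..b})" if "t \<in> {x0..b}" for t
      using wkb_derivatives(4)[OF R(1) lt[OF that]] by (simp add: B_def B'_def P_def)
    show "continuous_on {x0..b} B'" unfolding B'_def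
      by (intro continuous_intros cQ cP) (use nz in auto)
  qed
  have pH: "primitive_on x0 b (\<lambda>t. - P t) H"
  proof (rule primitive_on_C1)
    show "(H has_real_derivative - P t) (at t within {x0..b})" if "t \<in> {x0..b}" for t
      using wkb_derivatives(3)[OF R(1) lt[OF that]] by (simp add: H_def P_def)
  qed (intro continuous_intros cP)
  have e_le: "\<bar>e t\<bar> \<le> B' t" if t: "t \<in> {x0..b}" for t
  proof -
    define X where "X = R\<^sup>2 - Q0 t"
    have X: "X > 0" using lt[OF t] by (simp add: X_def)
    have "\<bar>\<beta>' t - \<beta> t * \<beta> t\<bar> = (R\<^sup>2 * Q0 t + Q0 t * Q0 t / 4) / X\<^sup>2"
    proof -
      have "\<beta>' t - \<beta> t * \<beta> t = - ((R\<^sup>2 * Q0 t + Q0 t * Q0 t / 4) / X\<^sup>2)"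
        unfolding \<beta>'_def \<beta>_def X_def[symmetric] using X by (simp add: field_simps power2_eq_square)
      moreover have "(R\<^sup>2 * Q0 t + Q0 t * Q0 t / 4) / X\<^sup>2 \<ge> 0"
        using Q0_pos[of t] by (intro divide_nonneg_nonneg add_nonneg_nonneg) auto
      ultimately show ?thesis by (simp only: abs_minus_cancel abs_of_nonneg)
    qed
    \<comment> \<open>Here \<open>Q0 t < R\<^sup>2\<close> absorbs \<open>\<beta>\<^sup>2\<close>,
      which contributes the additional quarter.\<close>
    also have "\<dots> \<le> (5 / 4 * (R\<^sup>2 * Q0 t)) / X\<^sup>2"
      using lt[OF t] Q0_pos[of t] by (intro divide_right_mono) (auto simp: mult_right_mono)
    finally have "\<bar>V t - Q0 t + \<beta>' t - \<beta> t * \<beta> t\<bar> \<le> C * exp t + 5 / 4 * (R\<^sup>2 * Q0 t) / X\<^sup>2"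
      using C(2)[OF t] by linarith
    then have "\<bar>V t - Q0 t + \<beta>' t - \<beta> t * \<beta> t\<bar> / P t \<le> B' t"
      unfolding B'_def X_def using P(1)[OF t] by (intro divide_right_mono) auto
    moreover have "\<bar>e t\<bar> = \<bar>V t - Q0 t + \<beta>' t - \<beta> t * \<beta> t\<bar> / P t * (cos (\<phi> t))\<^sup>2"
      using P(1)[OF t] by (simp add: e_def abs_mult)
    moreover have "\<dots> \<le> \<bar>V t - Q0 t + \<beta>' t - \<beta> t * \<beta> t\<bar> / P t * 1"
      using P(1)[OF t] by (intro mult_left_mono) (auto simp: abs_square_le_1)
    ultimately show ?thesis by simp
  qed
  have p: "primitive_on x0 b (\<lambda>t. - P t + e t - - P t) (\<lambda>t. \<phi> t - H t)"
    by (rule primitive_on_diff[OF \<phi> pH])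
  have "(\<phi> b - H b) - (\<phi> x0 - H x0) \<le> B b - B x0"
    by (rule primitive_on_mono_diff[OF p pB]) (use e_le \<open>x0 \<le> b\<close> in \<open>force+\<close>)
  moreover have "- (\<phi> b - H b) - - (\<phi> x0 - H x0) \<le> B b - B x0"
    by (rule primitive_on_mono_diff[OF primitive_on_minus[OF p] pB]) (use e_le \<open>x0 \<le> b\<close> in \<open>force+\<close>)
  ultimately have "\<bar>\<phi> x0 - \<phi> b - (H x0 - H b)\<bar> \<le> B b - B x0" by linarith
  also have "\<dots> \<le> C * pi + 5 / 12 * (R\<^sup>2 / (P b) ^ 3)"
  proof -
    have x: "0 \<le> exp t / (2 * R) \<and> exp t / (2 * R) \<le> 1" if t: "t \<in> {x0..b}" for t
    proof -
      have "(exp t / 2)\<^sup>2 \<le> R\<^sup>2" using lt[OF t] by (simp add: Q0_def exp_double power_divide)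
      then have "exp t / 2 \<le> R" by (rule power2_le_imp_le) (use R in simp)
      then show ?thesis using R by simp
    qed
    have "arcsin (exp b / (2 * R)) \<le> pi / 2" using x[of b] \<open>x0 \<le> b\<close> by (intro arcsin_ubound) auto
    then have "2 * C * arcsin (exp b / (2 * R)) \<le> 2 * C * (pi / 2)" using C by (intro mult_left_mono) auto
    moreover have "0 \<le> arcsin (exp x0 / (2 * R))"
      using x[of x0] \<open>x0 \<le> b\<close> by (intro arcsin_nonneg) auto
    then have "0 \<le> 2 * C * arcsin (exp x0 / (2 * R))" using C by simp
    moreover have "0 \<le> 5 / 12 * (R\<^sup>2 / (P x0) ^ 3)" using P(1)[of x0] \<open>x0 \<le> b\<close> by simp
    ultimately show ?thesis by (simp add: B_def)
  qed
  finally show ?thesis using close[of x0] close[of b] \<open>x0 \<le> b\<close> by (simp add: abs_le_iff abs_less_iff)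
qed

text \<open>Scaling the slope by \<open>m\<^sup>2\<close> turns the rate into
  \<open>(V - T) / m\<^sup>2\<close> and \<open>m\<^sup>2\<close> terms, both of order
  \<open>m\<^sup>2\<close> because \<open>V - T\<close> has order \<open>m ^ 4\<close>; the window
  is no longer than \<open>1 / m\<^sup>2\<close>. Both ends of the frame change cost another
  \<open>2 * pi\<close>.\<close>

lemma turning_point_window:
  assumes \<theta>: "prufer_angle (\<lambda>t. V t - m ^ 6) t1 a \<theta>" and "t1 \<le> a"
    and V: "V integrable_on {t1..a}"
    and C: "C > 0" "\<And>t. t \<in> {t1..a} \<Longrightarrow> \<bar>V t - Q0 t\<bar> \<le> C * exp t"
    and m: "m \<ge> 1" and t1: "Q0 t1 = m ^ 6 - m ^ 4" and a: "exp a = 2 * m ^ 3 + 4 * C"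
    and width: "m\<^sup>2 * (a - t1) \<le> 1"
  shows "\<bar>\<theta> t1 - \<theta> a\<bar> \<le> 2 * pi + (2 + 6 * C + 8 * C\<^sup>2)"
proof -
  \<comment> \<open>In units of \<open>m ^ 4\<close>: the distance from \<open>Q0\<close> to
    \<open>m ^ 6\<close> costs at most \<open>1 + 4 * C + 4 * C\<^sup>2\<close>, the perturbation
    \<open>2 * C + 4 * C\<^sup>2\<close>.\<close>
  define A where "A = 1 + 6 * C + 8 * C\<^sup>2"
  have m2: "m\<^sup>2 > 0" using m by simp
  have pow: "m ^ 4 = m\<^sup>2 * m\<^sup>2" by (simp flip: power_add)
  have m34: "1 \<le> m ^ 4" "m ^ 3 \<le> m ^ 4" using m by (auto intro: power_increasing one_le_power)
  have q: "\<bar>V t - m ^ 6\<bar> \<le> A * m ^ 4" if t: "t \<in> {t1..a}" for t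
  proof -
    have et: "exp t \<le> 2 * m ^ 3 + 4 * C" using t a by (metis atLeastAtMost_iff exp_le_cancel_iff)
    have up: "Q0 t \<le> (2 * m ^ 3 + 4 * C)\<^sup>2 / 4"
      unfolding Q0_def exp_double using et by (intro divide_right_mono power_mono) auto
    have lo: "m ^ 6 - m ^ 4 \<le> Q0 t" unfolding t1[symmetric] using t by (simp add: Q0_def)
    have "C * exp t \<le> C * (2 * m ^ 3 + 4 * C)" using C et by (intro mult_left_mono) auto
    then have \<epsilon>: "\<bar>V t - Q0 t\<bar> \<le> 2 * (C * m ^ 3) + 4 * C\<^sup>2" using C(2)[OF t] by (simp add: algebra_simps power2_eq_square)
    have sq: "(2 * m ^ 3 + 4 * C)\<^sup>2 / 4 = m ^ 6 + 4 * (C * m ^ 3) + 4 * C\<^sup>2"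
      by (simp add: power2_eq_square algebra_simps flip: power_add)
    have c3: "C * m ^ 3 \<le> C * m ^ 4" "C\<^sup>2 * 1 \<le> C\<^sup>2 * m ^ 4"
      using C m34 by (auto intro!: mult_left_mono)
    have c0: "0 \<le> C * m ^ 3" "0 \<le> C\<^sup>2" using C m by auto
    have "A * m ^ 4 = m ^ 4 + 6 * (C * m ^ 4) + 8 * (C\<^sup>2 * m ^ 4)" by (simp add: A_def algebra_simps)
    then show ?thesis using up lo \<epsilon> c3 c0 m34(1) unfolding sq mult_1_right by linarith
  qed
  have iq: "(\<lambda>t. V t - m ^ 6) integrable_on {t1..a}" by (intro integrable_diff V integrable_const_ivl)
  obtain \<phi> where \<phi>: "primitive_on t1 a (\<lambda>t. (V t - m ^ 6 + 0 - 0 * 0) / m\<^sup>2 * (cos (\<phi> t))\<^sup>2 +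
      (- m\<^sup>2) * (sin (\<phi> t))\<^sup>2 + (2 * 0 - 0 / m\<^sup>2) * (sin (\<phi> t) * cos (\<phi> t))) \<phi>"
    and close: "\<And>t. t \<in> {t1..a} \<Longrightarrow> \<bar>\<phi> t - \<theta> t\<bar> < pi"
    by (rule prufer_angle_change_frame[OF \<theta> \<open>t1 \<le> a\<close> iq q, where P="\<lambda>_. m\<^sup>2" and P'="\<lambda>_. 0" and \<beta>="\<lambda>_. 0" and \<beta>'="\<lambda>_. 0"])
      (use m2 in \<open>auto intro: that\<close>)
  have "\<bar>\<phi> a - \<phi> t1\<bar> \<le> (A + 1) * m\<^sup>2 * (a - t1)"
  proof (rule primitive_on_increment_le[OF \<phi>])
    fix t assume t: "t \<in> {t1..a}"
    have "\<bar>V t - m ^ 6\<bar> \<le> A * m\<^sup>2 * m\<^sup>2" using q[OF t] unfolding pow mult.assoc .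
    then have "\<bar>V t - m ^ 6\<bar> / m\<^sup>2 \<le> A * m\<^sup>2" unfolding pos_divide_le_eq[OF m2] .
    then have q': "\<bar>(V t - m ^ 6) / m\<^sup>2\<bar> \<le> A * m\<^sup>2" unfolding abs_divide abs_power2 .
    have "\<bar>(V t - m ^ 6) / m\<^sup>2\<bar> * \<bar>(cos (\<phi> t))\<^sup>2\<bar> \<le> (A * m\<^sup>2) * 1"
      by (rule mult_mono[OF q']) (use order_trans[OF abs_ge_zero q'] in \<open>auto simp: abs_square_le_1\<close>)
    then have b1: "\<bar>(V t - m ^ 6) / m\<^sup>2 * (cos (\<phi> t))\<^sup>2\<bar> \<le> (A * m\<^sup>2) * 1" unfolding abs_mult .
    have b2: "\<bar>m\<^sup>2 * (sin (\<phi> t))\<^sup>2\<bar> \<le> m\<^sup>2 * 1"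
      unfolding abs_mult by (intro mult_mono) (auto simp: abs_square_le_1)
    have add: "\<bar>u\<bar> \<le> X \<Longrightarrow> \<bar>p * w\<bar> \<le> Y \<Longrightarrow> \<bar>u + (- p) * w + 0 * z\<bar> \<le> X + Y" for u p w z X Y :: real
      by simp
    have eqs: "2 * 0 - 0 / m\<^sup>2 = 0" "V t - m ^ 6 + 0 - 0 * 0 = V t - m ^ 6"
      "(A + 1) * m\<^sup>2 = (A * m\<^sup>2) * 1 + m\<^sup>2 * 1"
      by (simp_all add: distrib_right)
    show "\<bar>(V t - m ^ 6 + 0 - 0 * 0) / m\<^sup>2 * (cos (\<phi> t))\<^sup>2 + (- m\<^sup>2) * (sin (\<phi> t))\<^sup>2 +
        (2 * 0 - 0 / m\<^sup>2) * (sin (\<phi> t) * cos (\<phi> t))\<bar> \<le> (A + 1) * m\<^sup>2"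
      unfolding eqs by (rule add[OF b1 b2])
  qed (use \<open>t1 \<le> a\<close> in auto)
  also have "\<dots> = (A + 1) * (m\<^sup>2 * (a - t1))" by (simp add: mult.assoc)
  also have "\<dots> \<le> (A + 1) * 1" using C width by (intro mult_left_mono) (auto simp: A_def)
  also have "\<dots> = 2 + 6 * C + 8 * C\<^sup>2" by (simp add: A_def)
  finally have "\<bar>\<phi> a - \<phi> t1\<bar> \<le> 2 + 6 * C + 8 * C\<^sup>2" .
  moreover have "\<bar>\<phi> t1 - \<theta> t1\<bar> < pi" "\<bar>\<phi> a - \<theta> a\<bar> < pi" using close \<open>t1 \<le> a\<close> by auto
  ultimately show ?thesis by linarith
qed

context confining_potential
begin

text \<open>At the right end of the window the angle is in the strip; going left, the window changes
  it boundedly and the oscillatory region adds the phase \<open>H x0 - H (t1 m)\<close>. Here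
  \<open>H x0\<close> carries the asymptotic expansion and \<open>H (t1 m)\<close> stays
  bounded.\<close>

lemma decaying_angle_asymptotics:
  assumes C: "C > 0" "\<And>t. t \<ge> x0 \<Longrightarrow> \<bar>V t - Q0 t\<bar> \<le> C * exp t"
  shows "\<exists>K. \<forall>\<^sub>F T in at_top. \<bar>decaying_angle T x0 - (sqrt T * ln (sqrt T) + (2 * ln 2 - 1 - x0) * sqrt T)\<bar> \<le> K"
proof -
  define d where "d = Q0 x0"
  have d: "d > 0" by (simp add: d_def Q0_def)
  \<comment> \<open>The cut-off: \<open>Q0 (t1 m) = m^6 - m^4\<close>, so
    \<open>P = m\<^sup>2\<close> and \<open>P ^ 3 = m ^ 6 = T\<close>.\<close>
  define t1 where "t1 = (\<lambda>m::real. ln 2 + ln (m^6 - m^4) / 2)"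
  \<comment> \<open>In this order: the strip at the right end, the window, the oscillatory region
    with \<open>T / P ^ 3 = 1\<close>, and two phase errors below 1.\<close>
  define K where "K = pi / 2 + (2 * pi + (2 + 6 * C + 8 * C\<^sup>2)) + (2 * pi + C * pi + 5 / 12) + 2"
  have ev1: "\<forall>\<^sub>F m in at_top. \<bar>m^3 * (ln (m^3 + sqrt (m^6 - d)) + ln 2 - x0) - sqrt (m^6 - d) -
      (m^3 * ln (m^3) + (2 * ln 2 - 1 - x0) * m^3)\<bar> < 1"
    using tendstoD[OF wkb_phase_at_left[OF d, of x0], of 1] by (simp add: dist_real_def)
  have ev2: "\<forall>\<^sub>F m in at_top. \<bar>m^3 * (ln (m^3 + m^2) + ln 2 - t1 m) - m^2\<bar> < 1"
  proof -
    have "\<forall>\<^sub>F m::real in at_top. m^3 * (ln (m^3 + m^2) + ln 2 - t1 m) - m^2 < 1"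
      "\<forall>\<^sub>F m::real in at_top. -1 < m^3 * (ln (m^3 + m^2) + ln 2 - t1 m) - m^2"
      unfolding t1_def
      by (rule order_tendstoD[OF wkb_phase_at_turning_point]; simp)+
    then show ?thesis by eventually_elim (simp add: abs_less_iff)
  qed
  have ev3: "\<forall>\<^sub>F m in at_top. m^2 * (ln (2 * m^3 + 4 * C) - t1 m) < 1"
    unfolding t1_def by (rule order_tendstoD[OF window_width[OF C(1)]]) simp
  \<comment> \<open>This gives \<open>m ^ 6 - m ^ 4 \<ge> m + 1 > d\<close>, so that the cut-off
    lies to the right of \<open>x0\<close>.\<close>
  have ev4: "\<forall>\<^sub>F m in at_top. max 2 (d + 1) \<le> m" by (rule eventually_ge_at_top)
  have "\<forall>\<^sub>F m in at_top. \<bar>decaying_angle (m ^ 6) x0 - (m^3 * ln (m^3) + (2 * ln 2 - 1 - x0) * m^3)\<bar> \<le> K"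
    using ev1 ev2 ev3 ev4
  proof eventually_elim
    case (elim m)
    have m: "m \<ge> 2" "m \<ge> d + 1" using elim(4) by auto
    \<comment> \<open>For \<open>t \<ge> a\<close> the factor \<open>exp t / 4 - C\<close> is at
      least \<open>m ^ 3 / 2\<close> and \<open>exp t\<close> at least \<open>2 * m ^ 3\<close>;
      their product \<open>Q0 t - C * exp t\<close> reaches \<open>m ^ 6\<close>, so the potential
      stays above \<open>T\<close> despite the perturbation.\<close>
    define a where "a = ln (2 * m ^ 3 + 4 * C)"
    define \<theta> where "\<theta> = decaying_angle (m ^ 6)"
    have m3: "m ^ 3 > 0" using m by simp
    have gap: "m ^ 6 - m ^ 4 > d"
    proof -
      have "1 * 1 \<le> m ^ 4 * (m - 1)" using m by (intro mult_mono one_le_power) auto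
      have "m ^ 6 - m ^ 4 = m ^ 4 * (m - 1) * (m + 1)" by (simp add: algebra_simps flip: power_Suc2 power_Suc power_add)
      also have "\<dots> \<ge> m + 1"
        using mult_right_mono[OF \<open>1 * 1 \<le> m ^ 4 * (m - 1)\<close>, of "m + 1"] m by simp
      finally show ?thesis using m by linarith
    qed
    have gap0: "m ^ 6 - m ^ 4 > 0" using gap d by linarith
    have Qt1: "Q0 (t1 m) = m ^ 6 - m ^ 4"
    proof -
      have "exp (2 * t1 m) = exp (ln 2) ^ 2 * exp (ln (m ^ 6 - m ^ 4))"
        by (simp add: t1_def distrib_left exp_add exp_double)
      then show ?thesis using gap0 by (simp add: Q0_def)
    qed
    have ea: "exp a = 2 * m ^ 3 + 4 * C" using m3 C by (simp add: a_def add_pos_pos)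
    have x0t1: "x0 \<le> t1 m"
    proof -
      have "Q0 x0 < Q0 (t1 m)" using gap by (simp add: Qt1 d_def)
      then show ?thesis by (simp add: Q0_def)
    qed
    have t1a: "t1 m \<le> a"
    proof -
      have "(exp (t1 m))\<^sup>2 = 4 * (m ^ 6 - m ^ 4)" using Qt1 by (simp add: Q0_def exp_double)
      also have "\<dots> \<le> (2 * m ^ 3)\<^sup>2" by (simp add: power_mult_distrib flip: power_mult)
      finally have "exp (t1 m) \<le> 2 * m ^ 3" by (rule power2_le_imp_le) (use m3 in simp)
      also have "\<dots> \<le> exp a" using C by (simp add: ea)
      finally show ?thesis by simp
    qed
    have far: "m ^ 6 \<le> V t" if t: "t \<ge> a" for t
    proof -
      define y where "y = exp t"
      have y: "y \<ge> 2 * m ^ 3 + 4 * C" using t by (simp add: y_def flip: ea)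
      have "m ^ 6 \<le> (2 * m ^ 3) * (m ^ 3 / 2)" by (simp flip: power_add)
      also have "\<dots> \<le> y * (y / 4 - C)" using y C m3 by (intro mult_mono) (auto simp: y_def)
      also have "\<dots> = Q0 t - C * exp t"
        by (simp add: Q0_def y_def exp_double power2_eq_square right_diff_distrib)
      also have "\<dots> \<le> V t" using C(2)[of t] t t1a x0t1 by (simp add: abs_le_iff)
      finally show ?thesis .
    qed
    have \<theta>a: "- pi / 2 \<le> \<theta> a" "\<theta> a \<le> 0"
      unfolding \<theta>_def using x0t1 t1a decaying_angle_ge[of a "m ^ 6"] decaying_angle_le_0[of a "m ^ 6" a, OF _ far]
      by simp_all
    have w: "\<bar>\<theta> (t1 m) - \<theta> a\<bar> \<le> 2 * pi + (2 + 6 * C + 8 * C\<^sup>2)"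
    proof (rule turning_point_window[OF _ t1a _ C(1) _ _ Qt1 ea])
      show "prufer_angle (\<lambda>t. V t - m ^ 6) (t1 m) a \<theta>"
        unfolding \<theta>_def by (rule prufer_angle_subinterval[OF decaying_angle[of _ a]]) (use x0t1 in auto)
      show "V integrable_on {t1 m..a}"
        by (rule integrable_on_subinterval[OF V_integrable[of a]]) (use x0t1 in auto)
      show "m\<^sup>2 * (a - t1 m) \<le> 1" using elim(3) by (simp add: a_def)
    qed (use m C x0t1 in auto)
    obtain M where M: "\<And>t. t \<in> {x0..t1 m} \<Longrightarrow> \<bar>V t\<bar> \<le> M" using V_bounded by meson
    define P where "P = (\<lambda>t. sqrt ((m ^ 3)\<^sup>2 - Q0 t))"
    define H where "H = (\<lambda>t. m ^ 3 * (ln (m ^ 3 + P t) + ln 2 - t) - P t)"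
    have m6: "(m ^ 3)\<^sup>2 = m ^ 6" by (simp flip: power_mult)
    have Pt1: "P (t1 m) = m\<^sup>2"
    proof -
      have "P (t1 m) = sqrt ((m\<^sup>2)\<^sup>2)" by (simp add: P_def m6 Qt1 flip: power_mult)
      then show ?thesis by (simp only: real_sqrt_abs abs_power2)
    qed
    have "\<bar>\<theta> x0 - \<theta> (t1 m) - (H x0 - H (t1 m))\<bar> \<le> 2 * pi + C * pi + 5 / 12 * ((m ^ 3)\<^sup>2 / (P (t1 m)) ^ 3)"
      unfolding H_def P_def
    proof (rule wkb_region[OF _ x0t1 V_integrable M C(1)])
      show "prufer_angle (\<lambda>t. V t - (m ^ 3)\<^sup>2) x0 (t1 m) \<theta>"
        unfolding \<theta>_def m6 by (rule decaying_angle)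
      show "Q0 (t1 m) < (m ^ 3)\<^sup>2" unfolding m6 Qt1 using m by simp
    qed (use C m3 in auto)
    also have "(m ^ 3)\<^sup>2 / (P (t1 m)) ^ 3 = 1" using m by (simp add: Pt1 flip: power_mult)
    finally have wkb: "\<bar>\<theta> x0 - \<theta> (t1 m) - (H x0 - H (t1 m))\<bar> \<le> 2 * pi + C * pi + 5 / 12" by simp
    have H1: "\<bar>H (t1 m)\<bar> < 1" using elim(2) by (simp add: H_def Pt1)
    have H0: "\<bar>H x0 - (m^3 * ln (m^3) + (2 * ln 2 - 1 - x0) * m^3)\<bar> < 1"
      using elim(1) by (simp add: H_def P_def m6 d_def)
    have "\<bar>u - v\<bar> \<le> X \<Longrightarrow> - pi / 2 \<le> v \<Longrightarrow> v \<le> 0 \<Longrightarrow> \<bar>w - u - (h - h')\<bar> \<le> Y \<Longrightarrow> \<bar>h'\<bar> < 1 \<Longrightarrow> \<bar>h - s\<bar> < 1 \<Longrightarrow>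
        \<bar>w - s\<bar> \<le> pi / 2 + X + Y + 2" for u v w h h' s X Y :: real
      by linarith
    from this[OF w \<theta>a wkb H1 H0] show ?case by (simp only: K_def \<theta>_def)
  qed
  then obtain m0 where m0: "\<And>m. m \<ge> m0 \<Longrightarrow>
      \<bar>decaying_angle (m ^ 6) x0 - (m^3 * ln (m^3) + (2 * ln 2 - 1 - x0) * m^3)\<bar> \<le> K"
    by (auto simp: eventually_at_top_linorder)
  have "\<forall>\<^sub>F T in at_top. \<bar>decaying_angle T x0 - (sqrt T * ln (sqrt T) + (2 * ln 2 - 1 - x0) * sqrt T)\<bar> \<le> K"
    using eventually_ge_at_top[of "(max m0 0) ^ 6"]
  proof eventually_elim
    case (elim T)
    define m where "m = root 6 T"
    have "0 \<le> (max m0 0) ^ 6" by simp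
    then have T: "T \<ge> 0" using elim by linarith
    have m: "m ^ 6 = T" "m \<ge> 0" using T by (auto simp: m_def)
    have "root 6 ((max m0 0) ^ 6) \<le> m" unfolding m_def using elim by simp
    then have "m \<ge> m0" by (simp add: real_root_power_cancel)
    have "sqrt T = m ^ 3"
    proof -
      have "T = (m ^ 3)\<^sup>2" using m(1) by (simp flip: power_mult)
      then show ?thesis using m(2) by (simp add: real_sqrt_unique)
    qed
    then show ?case using m0[OF \<open>m \<ge> m0\<close>] by (simp add: m(1))
  qed
  then show ?thesis by blast
qed

end

section \<open>Exponentially bounded perturbations of \<open>Q0\<close>\<close>

lemma perturbation_confining:
  assumes V: "\<And>b. V integrable_on {x0..b}" and C: "C > 0" "\<And>t. t \<ge> x0 \<Longrightarrow> \<bar>V t - Q0 t\<bar> \<le> C * exp t"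
  shows "confining_potential V x0"
proof
  show "V integrable_on {x0..b}" for b by (rule V)
  show "\<exists>M. \<forall>t\<in>{x0..b}. \<bar>V t\<bar> \<le> M" for b
  proof (intro exI ballI)
    fix t assume t: "t \<in> {x0..b}"
    have "\<bar>V t\<bar> \<le> \<bar>Q0 t\<bar> + \<bar>V t - Q0 t\<bar>" by simp
    also have "\<dots> \<le> Q0 b + C * exp b"
    proof (rule add_mono)
      show "\<bar>Q0 t\<bar> \<le> Q0 b" using t by (simp add: Q0_def)
      have "C * exp t \<le> C * exp b" using t C by (intro mult_left_mono) auto
      then show "\<bar>V t - Q0 t\<bar> \<le> C * exp b" using C(2)[of t] t by simp
    qed
    finally show "\<bar>V t\<bar> \<le> Q0 b + C * exp b" .
  qed
  fix \<Lambda> :: real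
  \<comment> \<open>For \<open>exp t \<ge> y0\<close> both
    \<open>exp t \<ge> \<bar>\<Lambda>\<bar>\<close> and \<open>exp t / 4 - C \<ge> 1\<close> hold,
    so the product \<open>Q0 t - C * exp t\<close> is at least \<open>\<Lambda>\<close>.\<close>
  define y0 where "y0 = 4 * C + 4 + \<bar>\<Lambda>\<bar>"
  have y0: "y0 > 0" using C by (simp add: y0_def add_pos_nonneg)
  show "\<exists>a\<ge>x0. \<forall>t\<ge>a. \<Lambda> \<le> V t"
  proof (intro exI[of _ "max x0 (ln y0)"] conjI allI impI)
    fix t assume t: "t \<ge> max x0 (ln y0)"
    then have "exp (ln y0) \<le> exp t" by simp
    then have y: "y0 \<le> exp t" using y0 by simp
    have "\<bar>\<Lambda>\<bar> * 1 \<le> exp t * (exp t / 4 - C)" using y C by (intro mult_mono) (auto simp: y0_def)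
    also have "\<dots> = Q0 t - C * exp t" by (simp add: Q0_def exp_double power2_eq_square right_diff_distrib)
    also have "\<dots> \<le> V t" using C(2)[of t] t by (simp add: abs_le_iff)
    finally show "\<Lambda> \<le> V t" by simp
  qed simp
qed

lemma perturbation_eigenvalue_count:
  assumes V: "locally_integrable_from x0 V" and C: "C > 0" "\<And>t. t \<ge> x0 \<Longrightarrow> \<bar>V t - Q0 t\<bar> \<le> C * exp t"
  shows "finite (eigenvalues_below T V x0 \<alpha>)"
    and "\<exists>K. \<forall>\<^sub>F T in at_top. \<forall>\<alpha>. \<bar>real (eigenvalue_count T V x0 \<alpha>) -
      (1 / pi * sqrt T * ln (sqrt T) + 1 / pi * (2 * ln 2 - 1 - x0) * sqrt T)\<bar> \<le> K"
proof -
  have "V integrable_on {x0..b}" for b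
    using V set_lebesgue_integral_eq_integral(1) unfolding locally_integrable_from_def by blast
  then interpret confining_potential V x0 by (rule perturbation_confining[OF _ C])
  show "finite (eigenvalues_below T V x0 \<alpha>)" by (rule eigenvalue_count_angle(1))
  obtain K where K: "\<forall>\<^sub>F T in at_top. \<bar>decaying_angle T x0 - (sqrt T * ln (sqrt T) + (2 * ln 2 - 1 - x0) * sqrt T)\<bar> \<le> K"
    using decaying_angle_asymptotics[OF C] by blast
  obtain T0 where T0: "\<forall>T\<ge>T0. \<forall>\<alpha>. \<bar>real (eigenvalue_count T V x0 \<alpha>) - decaying_angle T x0 / pi\<bar> \<le> 3"
    using eigenvalue_count_angle(2) by blast
  have "\<forall>\<^sub>F T in at_top. \<forall>\<alpha>. \<bar>real (eigenvalue_count T V x0 \<alpha>) -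
      (1 / pi * sqrt T * ln (sqrt T) + 1 / pi * (2 * ln 2 - 1 - x0) * sqrt T)\<bar> \<le> 3 + K / pi"
    using K eventually_ge_at_top[of T0]
  proof eventually_elim
    case (elim T)
    define S where "S = sqrt T * ln (sqrt T) + (2 * ln 2 - 1 - x0) * sqrt T"
    have "\<bar>decaying_angle T x0 / pi - S / pi\<bar> \<le> K / pi"
      using elim(1) by (simp add: S_def abs_divide divide_right_mono flip: diff_divide_distrib)
    moreover have "S / pi = 1 / pi * sqrt T * ln (sqrt T) + 1 / pi * (2 * ln 2 - 1 - x0) * sqrt T"
      by (simp add: S_def add_divide_distrib)
    moreover have "\<bar>real (eigenvalue_count T V x0 \<alpha>) - decaying_angle T x0 / pi\<bar> \<le> 3" for \<alpha>
      using T0 elim(2) by blast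
    moreover have "\<bar>x - y\<bar> \<le> K / pi \<Longrightarrow> y = z \<Longrightarrow> \<bar>n - x\<bar> \<le> 3 \<Longrightarrow> \<bar>n - z\<bar> \<le> 3 + K / pi" for x y z n :: real
      by linarith
    ultimately show ?case by blast
  qed
  then show "\<exists>K. \<forall>\<^sub>F T in at_top. \<forall>\<alpha>. \<bar>real (eigenvalue_count T V x0 \<alpha>) -
      (1 / pi * sqrt T * ln (sqrt T) + 1 / pi * (2 * ln 2 - 1 - x0) * sqrt T)\<bar> \<le> K" by blast
qed

theorem theorem1p2:
  fixes x0 :: real and \<epsilon> :: "real \<Rightarrow> real"
  assumes "locally_integrable_from x0 (\<lambda>t. Q0 t + \<epsilon> t)"
    and "\<exists>C>0. \<forall>t\<ge>x0. \<bar>\<epsilon> t\<bar> \<le> C * exp t"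
  shows "(\<forall>\<alpha> T. finite (eigenvalues_below T (\<lambda>t. Q0 t + \<epsilon> t) x0 \<alpha>) \<and>
                finite (eigenvalues_below T Q0 x0 \<alpha>)) \<and>
    (\<exists>K. \<forall>\<^sub>F T in at_top. \<forall>\<alpha>.
       \<bar>real (eigenvalue_count T (\<lambda>t. Q0 t + \<epsilon> t) x0 \<alpha>) -
         (1 / pi * sqrt T * ln (sqrt T) + 1 / pi * (2 * ln 2 - 1 - x0) * sqrt T)\<bar> \<le> K) \<and>
    (\<exists>K. \<forall>\<^sub>F T in at_top. \<forall>\<alpha>.
       \<bar>real (eigenvalue_count T Q0 x0 \<alpha>) -
         real (eigenvalue_count T (\<lambda>t. Q0 t + \<epsilon> t) x0 \<alpha>)\<bar> \<le> K)"
proof -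
  obtain C where C: "C > 0" "\<And>t. t \<ge> x0 \<Longrightarrow> \<bar>\<epsilon> t\<bar> \<le> C * exp t" using assms(2) by blast
  have "continuous_on {x0..b} Q0" for b unfolding Q0_def by (intro continuous_intros) auto
  then have Q0: "locally_integrable_from x0 Q0"
    unfolding locally_integrable_from_def by (blast intro: absolutely_integrable_continuous_real)
  note perturbed = perturbation_eigenvalue_count[OF assms(1) C(1)]
  \<comment> \<open>\<open>Q0\<close> itself is the case of zero perturbation, covered by the same
    \<open>C\<close>; since the expansions share all growing terms, the two counts differ
    boundedly.\<close>
  note unperturbed = perturbation_eigenvalue_count[OF Q0 C(1)]
  have C': "\<bar>Q0 t + \<epsilon> t - Q0 t\<bar> \<le> C * exp t" "\<bar>Q0 t - Q0 t\<bar> \<le> C * exp t" if "t \<ge> x0" for t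
    using C that by auto
  obtain K1 where K1: "\<forall>\<^sub>F T in at_top. \<forall>\<alpha>. \<bar>real (eigenvalue_count T (\<lambda>t. Q0 t + \<epsilon> t) x0 \<alpha>) -
      (1 / pi * sqrt T * ln (sqrt T) + 1 / pi * (2 * ln 2 - 1 - x0) * sqrt T)\<bar> \<le> K1"
    using perturbed(2) C'(1) by blast
  obtain K2 where K2: "\<forall>\<^sub>F T in at_top. \<forall>\<alpha>. \<bar>real (eigenvalue_count T Q0 x0 \<alpha>) -
      (1 / pi * sqrt T * ln (sqrt T) + 1 / pi * (2 * ln 2 - 1 - x0) * sqrt T)\<bar> \<le> K2"
    using unperturbed(2) C'(2) by blast
  have "\<forall>\<^sub>F T in at_top. \<forall>\<alpha>. \<bar>real (eigenvalue_count T Q0 x0 \<alpha>) -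
      real (eigenvalue_count T (\<lambda>t. Q0 t + \<epsilon> t) x0 \<alpha>)\<bar> \<le> K1 + K2"
    using K1 K2
  proof eventually_elim
    case (elim T)
    show ?case
    proof
      fix \<alpha>
      have *: "\<bar>x - S\<bar> \<le> K1 \<Longrightarrow> \<bar>y - S\<bar> \<le> K2 \<Longrightarrow> \<bar>y - x\<bar> \<le> K1 + K2" for x y S :: real by linarith
      show "\<bar>real (eigenvalue_count T Q0 x0 \<alpha>) - real (eigenvalue_count T (\<lambda>t. Q0 t + \<epsilon> t) x0 \<alpha>)\<bar> \<le> K1 + K2"
        by (rule *[OF elim(1)[rule_format] elim(2)[rule_format]])
    qed
  qed
  then show ?thesis using perturbed(1) unperturbed(1) C' K1 by blast
qed

end
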